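(* Let $q$ be a prime power and let $n \geq 2$ be an integer. If the special unitary group $SU_{2n-1}(q)$ has a minimal logarithmic signature, then the projective special unitary group $PSU_{2n}(q)$ has a minimal logarithmic signature.
   Context: All groups are finite. For a finite group $G$, a logarithmic signature of $G$ is an ordered tuple $[A_1,\ldots,A_s]$ of subsets $A_i \subseteq G$ such that every element $g \in G$ can be written uniquely as a product $g = a_1a_2\cdots a_s$ with $a_i \in A_i$ for each $i$. Its length is $\sum_{i=1}^s |A_i|$. If $|G| = p_1^{\beta_1}\cdots p_k^{\beta_k}$ with $p_1,\ldots,p_k$ distinct primes and $\beta_j \ge 1$, every logarithmic signature has length at least $\sum_{j=1}^k \beta_j p_j$, and a logarithmic signature is called minimal (an MLS) if its length equals $\sum_{j=1}^k \beta_j p_j$. $SU_m(q)$ denotes the special unitary group of dimension $m$ over $GF(q^2)$ (isometries of determinant $1$ of a non-singular conjugate-symmetric sesquilinear form on $GF(q^2)^m$), and $PSU_m(q) = SU_m(q)/Z(SU_m(q))$. *)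

theory Defs
  imports "Jordan_Normal_Form.Determinant" "HOL-Algebra.Coset" "HOL-Computational_Algebra.Primes"
begin

definition tuple_prod :: "('g, 'b) monoid_scheme \<Rightarrow> 'g list \<Rightarrow> 'g" where
  "tuple_prod G xs = foldr (\<lambda>a b. a \<otimes>\<^bsub>G\<^esub> b) xs \<one>\<^bsub>G\<^esub>"

definition log_sig :: "('g, 'b) monoid_scheme \<Rightarrow> 'g set list \<Rightarrow> bool" where
  "log_sig G As \<longleftrightarrow> (\<forall>A\<in>set As. A \<subseteq> carrier G) \<and>
     bij_betw (tuple_prod G)
       {xs. length xs = length As \<and> (\<forall>i<length As. xs ! i \<in> As ! i)} (carrier G)"

definition ls_length :: "'g set list \<Rightarrow> nat" where
  "ls_length As = sum_list (map card As)"

definition mls_bound :: "nat \<Rightarrow> nat" where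
  "mls_bound n = (\<Sum>p\<in>prime_factors n. multiplicity p n * p)"

definition has_MLS :: "('g, 'b) monoid_scheme \<Rightarrow> bool" where
  "has_MLS G \<longleftrightarrow> (\<exists>As. log_sig G As \<and> ls_length As = mls_bound (order G))"

definition prime_power :: "nat \<Rightarrow> bool" where
  "prime_power q \<longleftrightarrow> (\<exists>p k. prime p \<and> k \<ge> 1 \<and> q = p ^ k)"

definition group_center :: "('g, 'b) monoid_scheme \<Rightarrow> 'g set" where
  "group_center G = {z \<in> carrier G. \<forall>g\<in>carrier G. z \<otimes>\<^bsub>G\<^esub> g = g \<otimes>\<^bsub>G\<^esub> z}"

text \<open>Special unitary group SU_m(q) over a field 'a of order q^2, w.r.t. the standard
non-degenerate Hermitian form (x,y) = sum x_i y_i^q; conjugation is the involutive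
field automorphism x \<mapsto> x^q.\<close>

definition conj_tr :: "nat \<Rightarrow> 'a::field mat \<Rightarrow> 'a mat" where
  "conj_tr q A = map_mat (\<lambda>x. x ^ q) (transpose_mat A)"

definition SU :: "nat \<Rightarrow> nat \<Rightarrow> ('a::field mat) monoid" where
  "SU m q = \<lparr> carrier = {A \<in> carrier_mat m m. A * conj_tr q A = 1\<^sub>m m \<and> det A = 1},
             mult = (*), one = 1\<^sub>m m \<rparr>"

definition PSU :: "nat \<Rightarrow> nat \<Rightarrow> ('a::field mat set) monoid" where
  "PSU m q = (SU m q) Mod (group_center (SU m q))"

end

theory Submission
  imports Defs "HOL-Algebra.Algebraic_Closure_Type" "HOL-Number_Theory.Residues"
begin

text \<open>
  Let \<open>F = GF(q\<^sup>2)\<close> and write vectors of \<open>F\<^bsup>2n\<^esup>\<close> as pairs \<open>(x, y)\<close> with respect to a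
  decomposition into two totally isotropic subspaces, so that \<open>(x, y)\<close> is a unit vector iff
  \<open>x\<^sup>*y + y\<^sup>*x = 1\<close>. The stabilizer of a unit vector \<open>(e\<^sub>0, y\<^sub>0)\<close> in \<open>SU\<^bsub>2n\<^esub>(q)\<close> is
  \<open>SU\<^bsub>2n-1\<^esub>(q)\<close>, so it remains to factorize a transversal, that is, to reach every unit vector
  from \<open>(e\<^sub>0, y\<^sub>0)\<close> exactly once by a product of blocks.

  The unit vectors \<open>(e\<^sub>0, y)\<close> form one orbit of the abelian group \<open>U\<close> of unipotent maps
  \<open>(x, y) \<mapsto> (x, y + Sx)\<close>, where \<open>S\<close> is skew-Hermitian and supported in its first row and column.
  For the first component one uses block diagonal isometries \<open>diag(A, A\<^bsup>-*\<^esup>)\<close>, which have determinant 1 iff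
  \<open>det A \<in> GF(q)\<close>. If \<open>s\<close> is a Singer cycle with \<open>s\<^bsup>i\<^esup> e\<^sub>0 = e\<^sub>i\<close> for \<open>i < n\<close>, the powers of \<open>s\<^bsup>q+1\<^esup>\<close>
  are of this kind, contain the centre of \<open>SU\<^bsub>2n\<^esub>(q)\<close>, and have \<open>q + 1\<close> orbits on nonzero
  vectors. With \<open>e = gcd(n, q + 1)\<close>, representatives of these orbits are the vectors \<open>s\<^bsup>a\<^esup> y\<^bsup>j\<^esup> e\<^sub>0\<close> with
  \<open>a < e\<close> and \<open>j < (q + 1)/e\<close>, where \<open>y\<close> is a generator of \<open>F\<^sup>*\<close>. The scalars \<open>y\<^bsup>j\<^esup>\<close> are
  realized on \<open>e\<^sub>0\<close> by \<open>diag(y, 1, \<dots>, 1, y\<^sup>-\<^sup>1)\<^bsup>j\<^esup>\<close>. The exponents \<open>a\<close> are split along the prime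
  factorization of \<open>e\<close>: if \<open>m = rm'\<close> with \<open>r\<close> prime and \<open>m \<le> n\<close>, the vectors \<open>e\<^sub>a\<close> with \<open>a < m'\<close>
  lie in the hyperplane spanned by \<open>e\<^sub>0, \<dots>, e\<^bsub>n-2\<^esub>\<close>, so \<open>s\<^bsup>jm'\<^esup>\<close> may be replaced by an element of
  determinant 1 that agrees with it on this hyperplane.
\<close>

hide_const (open) Divisibility.prime Divisibility.irreducible Polynomials.degree
  Polynomials.lead_coeff up_ring.coeff up_ring.monom

section \<open>Factorizations of subsets of a group\<close>

definition block_tuples :: "'g set list \<Rightarrow> 'g list set" where
  "block_tuples As = {xs. length xs = length As \<and> (\<forall>i<length As. xs ! i \<in> As ! i)}"

text \<open>Minimality is stated for subsets because the transversals used as factors need not be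
  subgroups; the bound is then the one for \<open>card V\<close>.\<close>

definition mls_on :: "('g, 'b) monoid_scheme \<Rightarrow> 'g set \<Rightarrow> bool" where
  "mls_on G V \<longleftrightarrow> (\<exists>As. (\<forall>A\<in>set As. A \<subseteq> carrier G) \<and>
     bij_betw (tuple_prod G) (block_tuples As) V \<and> ls_length As = mls_bound (card V))"

lemma has_MLS_iff_mls_on: "has_MLS G \<longleftrightarrow> mls_on G (carrier G)"
  by (auto simp: has_MLS_def mls_on_def log_sig_def block_tuples_def order_def)

lemma block_tuples_conv: "block_tuples As = {xs. list_all2 (\<in>) xs As}"
  by (auto simp: block_tuples_def list_all2_conv_all_nth)

lemma block_tuples_Nil [simp]: "block_tuples [] = {[]}"
  by (auto simp: block_tuples_conv)

lemma block_tuples_single: "block_tuples [A] = (\<lambda>a. [a]) ` A"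
  by (auto simp: block_tuples_conv list_all2_Cons2)

lemma block_tuples_append:
  "block_tuples (As @ Bs) = (\<lambda>(xs, ys). xs @ ys) ` (block_tuples As \<times> block_tuples Bs)"
proof (intro equalityI subsetI)
  fix zs assume "zs \<in> block_tuples (As @ Bs)"
  then obtain xs ys where "zs = xs @ ys" "xs \<in> block_tuples As" "ys \<in> block_tuples Bs"
    by (auto simp: block_tuples_conv list_all2_append2)
  thus "zs \<in> (\<lambda>(xs, ys). xs @ ys) ` (block_tuples As \<times> block_tuples Bs)" by auto
qed (auto simp: block_tuples_conv intro: list_all2_appendI)

lemma block_tuples_length: "xs \<in> block_tuples As \<Longrightarrow> length xs = length As"
  by (simp add: block_tuples_def)

lemma block_tuples_carrier:
  assumes "\<forall>A\<in>set As. A \<subseteq> C" "xs \<in> block_tuples As"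
  shows "set xs \<subseteq> C"
proof
  fix x assume "x \<in> set xs"
  then obtain i where "i < length As" "x \<in> As ! i"
    using assms(2) by (auto simp: block_tuples_def in_set_conv_nth)
  thus "x \<in> C" using assms(1) nth_mem by blast
qed

lemma tuple_prod_Nil [simp]: "tuple_prod G [] = \<one>\<^bsub>G\<^esub>"
  by (simp add: tuple_prod_def)

lemma tuple_prod_Cons [simp]: "tuple_prod G (x # xs) = x \<otimes>\<^bsub>G\<^esub> tuple_prod G xs"
  by (simp add: tuple_prod_def)

lemma (in monoid) tuple_prod_closed:
  "set xs \<subseteq> carrier G \<Longrightarrow> tuple_prod G xs \<in> carrier G"
  by (induction xs) auto

lemma (in monoid) tuple_prod_append:
  "set xs \<subseteq> carrier G \<Longrightarrow> set ys \<subseteq> carrier G \<Longrightarrow>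
    tuple_prod G (xs @ ys) = tuple_prod G xs \<otimes> tuple_prod G ys"
  by (induction xs) (auto simp: m_assoc tuple_prod_closed)

lemma (in monoid) mls_on_subset: "mls_on G V \<Longrightarrow> V \<subseteq> carrier G"
  by (auto simp: mls_on_def bij_betw_def intro!: tuple_prod_closed dest: block_tuples_carrier)

section \<open>Additivity of the length bound and products of blocks\<close>

lemma mls_bound_conv: "mls_bound n = sum_mset (prime_factorization n)"
proof -
  have *: "sum_mset M = (\<Sum>x\<in>set_mset M. count M x * x)" for M :: "nat multiset"
  proof (induction M)
    case (add x M)
    have "(\<Sum>y\<in>set_mset (add_mset x M). count M y * y) = (\<Sum>y\<in>set_mset M. count M y * y)"
      by (intro sum.mono_neutral_right) (auto simp: not_in_iff)
    moreover have "(\<Sum>y\<in>set_mset (add_mset x M). (if y = x then 1 else 0) * y) = x"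
      by (subst sum.remove[of _ x]) auto
    moreover have "count (add_mset x M) y * y = count M y * y + (if y = x then 1 else 0) * y" for y
      by auto
    ultimately show ?case using add.IH by (simp only: sum.distrib sum_mset.add_mset)
  qed simp
  show ?thesis
    unfolding mls_bound_def *
    by (intro sum.cong) (auto simp: count_prime_factorization_prime in_prime_factors_imp_prime)
qed

text \<open>Prime factorizations of a product add up as multisets; this is why minimality passes
  from two factors to their product.\<close>

lemma mls_bound_mult: "a > 0 \<Longrightarrow> b > 0 \<Longrightarrow> mls_bound (a * b) = mls_bound a + mls_bound b"
  by (simp add: mls_bound_conv prime_factorization_mult)

lemma mls_bound_1 [simp]: "mls_bound (Suc 0) = 0"
  by (simp add: mls_bound_conv)

lemma mls_bound_prime: "prime p \<Longrightarrow> mls_bound p = p"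
  by (simp add: mls_bound_conv prime_factorization_prime)

lemma mls_on_one: "mls_on G {\<one>\<^bsub>G\<^esub>}"
  unfolding mls_on_def by (intro exI[of _ "[]"]) (auto simp: bij_betw_def ls_length_def)

text \<open>A single block works, since its length p is exactly the bound at a prime p.\<close>

lemma (in monoid) mls_on_prime:
  assumes "V \<subseteq> carrier G" "prime (card V)"
  shows "mls_on G V"
  unfolding mls_on_def
proof (intro exI[of _ "[V]"] conjI)
  show "bij_betw (tuple_prod G) (block_tuples [V]) V"
    unfolding block_tuples_single
    by (intro bij_betw_byWitness[where f' = "\<lambda>a. [a]"]) (use assms in auto)
qed (use assms in \<open>auto simp: ls_length_def mls_bound_prime\<close>)

text \<open>Concatenating the block lists adds the lengths, while unique products multiply the
  cardinalities. Nonemptiness keeps both cardinalities positive, as additivity of the bound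
  requires.\<close>

lemma (in monoid) mls_on_mult:
  assumes V: "mls_on G V" and Y: "mls_on G Y" and fin: "finite V" "finite Y" "V \<noteq> {}" "Y \<noteq> {}"
    and bij: "bij_betw (\<lambda>(x, y). x \<otimes> y) (V \<times> Y) W"
  shows "mls_on G W"
proof -
  obtain As where As: "\<forall>A\<in>set As. A \<subseteq> carrier G" "bij_betw (tuple_prod G) (block_tuples As) V"
    "ls_length As = mls_bound (card V)"
    using V unfolding mls_on_def by blast
  obtain Bs where Bs: "\<forall>A\<in>set Bs. A \<subseteq> carrier G" "bij_betw (tuple_prod G) (block_tuples Bs) Y"
    "ls_length Bs = mls_bound (card Y)"
    using Y unfolding mls_on_def by blast
  let ?T = "block_tuples As \<times> block_tuples Bs"
  have "inj_on (\<lambda>(xs, ys). xs @ ys) ?T"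
    by (auto simp: inj_on_def block_tuples_length)
  hence app: "bij_betw (\<lambda>(xs, ys). xs @ ys) ?T (block_tuples (As @ Bs))"
    by (simp add: bij_betw_def block_tuples_append)
  have "bij_betw (map_prod (tuple_prod G) (tuple_prod G)) ?T (V \<times> Y)"
    using As Bs by (intro bij_betw_map_prod)
  hence "bij_betw ((\<lambda>(x, y). x \<otimes> y) \<circ> map_prod (tuple_prod G) (tuple_prod G)) ?T W"
    using bij by (rule bij_betw_trans)
  also have "?this \<longleftrightarrow> bij_betw (tuple_prod G \<circ> (\<lambda>(xs, ys). xs @ ys)) ?T W"
    using As(1) Bs(1)
    by (intro bij_betw_cong) (auto simp: tuple_prod_append block_tuples_carrier)
  finally have "bij_betw (tuple_prod G) (block_tuples (As @ Bs)) W"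
    using bij_betw_comp_iff[OF app] by blast
  moreover have "card W = card V * card Y"
    using bij bij_betw_same_card card_cartesian_product by metis
  moreover have "card V > 0" "card Y > 0"
    using fin by (auto simp: card_gt_0_iff)
  ultimately show ?thesis
    unfolding mls_on_def using As Bs
    by (intro exI[of _ "As @ Bs"]) (auto simp: ls_length_def mls_bound_mult)
qed

section \<open>Powers of an element and abelian subgroups\<close>

lemma (in monoid) mls_on_powers:
  assumes "g \<in> carrier G" "N > 0" "inj_on (\<lambda>j::nat. g [^] j) {..<N}"
  shows "mls_on G ((\<lambda>j. g [^] j) ` {..<N})"
  using assms
proof (induction N arbitrary: g rule: less_induct)
  case (less N)
  show ?case
  proof (cases "N = 1")
    case True
    have "{..<Suc 0} = {0}" by auto
    then show ?thesis using True by (auto simp: mls_on_one)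
  next
    case False
    \<comment> \<open>Exponents below \<open>p * k\<close> are written as \<open>i + p * j\<close>
      with \<open>i < p\<close>: the first digit gives a block of prime size, the second a range of
      powers of \<open>g [^] p\<close>.\<close>
    then obtain p k where p: "prime p" "N = p * k"
      using prime_factor_nat[of N] less.prems by (auto elim: dvdE)
    have k: "k > 0" "k < N" using p less.prems prime_gt_1_nat[of p] by auto
    have pow: "(g [^] p) [^] j = g [^] (p * j)" for j
      using less.prems by (simp add: nat_pow_pow)
    have lt: "i + p * j < N" if "i < p" "j < k" for i j
    proof -
      have "i + p * j < p + p * j" using that by simp
      also have "\<dots> = p * Suc j" by simp
      also have "\<dots> \<le> p * k" using that by (intro mult_le_mono) auto
      finally show ?thesis using p by simp
    qed
    have pk: "p > 0" using p prime_gt_0_nat by auto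
    have "inj_on (\<lambda>j. (g [^] p) [^] j) {..<k}"
    proof (rule inj_onI)
      fix i j assume ij: "i \<in> {..<k}" "j \<in> {..<k}" and eq: "(g [^] p) [^] i = (g [^] p) [^] j"
      have "p * i = p * j"
        using less.prems(3) eq lt[of 0 i] lt[of 0 j] ij pk unfolding pow
        by (elim inj_onD) auto
      thus "i = j" using pk by simp
    qed
    hence Y: "mls_on G ((\<lambda>j. (g [^] p) [^] j) ` {..<k})"
      using less.IH[of k "g [^] p"] k less.prems by auto
    have injp: "inj_on (\<lambda>j. g [^] j) {..<p}"
      using less.prems(3) by (rule inj_on_subset) (use p k in auto)
    have V: "mls_on G ((\<lambda>j. g [^] j) ` {..<p})"
      using less.prems p injp by (intro mls_on_prime) (auto simp: card_image)
    show ?thesis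
    proof (rule mls_on_mult[OF V Y])
      have eq: "g [^] i \<otimes> (g [^] p) [^] j = g [^] (i + p * j)" for i j
        using less.prems by (simp add: pow nat_pow_mult)
      show "bij_betw (\<lambda>(x, y). x \<otimes> y)
        (((\<lambda>j. g [^] j) ` {..<p}) \<times> ((\<lambda>j. (g [^] p) [^] j) ` {..<k})) ((\<lambda>j. g [^] j) ` {..<N})"
        unfolding bij_betw_def
      proof
        show "inj_on (\<lambda>(x, y). x \<otimes> y) ((([^]) g ` {..<p}) \<times> (([^]) (g [^] p) ` {..<k}))"
        proof (rule inj_onI; clarify)
          fix i j i' j' assume a: "i < p" "i' < p" "j < k" "j' < k"
            and e: "g [^] i \<otimes> (g [^] p) [^] j = g [^] i' \<otimes> (g [^] p) [^] j'"
          have "i + p * j = i' + p * j'"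
            using less.prems(3) e[unfolded eq] lt a by (elim inj_onD) auto
          hence "(i + p * j) mod p = (i' + p * j') mod p" "(i + p * j) div p = (i' + p * j') div p"
            by simp_all
          hence "i = i' \<and> j = j'" using a pk by simp
          thus "g [^] i = g [^] i' \<and> (g [^] p) [^] j = (g [^] p) [^] j'" by simp
        qed
        have "m \<in> (\<lambda>(i, j). i + p * j) ` ({..<p} \<times> {..<k})" if "m < N" for m
          using that pk p by (intro image_eqI[of _ _ "(m mod p, m div p)"])
            (auto simp: less_mult_imp_div_less mult.commute)
        thus "(\<lambda>(x, y). x \<otimes> y) ` ((([^]) g ` {..<p}) \<times> (([^]) (g [^] p) ` {..<k})) = ([^]) g ` {..<N}"
          using lt by (auto simp: eq image_iff) force
      qed
    qed (use k pk in auto)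
  qed
qed

text \<open>On a finite set closed under multiplication, an injective left translation is onto, so
  the set contains the identity and then inverses.\<close>

lemma (in group) finite_subgroupI:
  assumes "finite Y" "Y \<subseteq> carrier G" "Y \<noteq> {}" and mult: "\<And>a b. a \<in> Y \<Longrightarrow> b \<in> Y \<Longrightarrow> a \<otimes> b \<in> Y"
  shows "subgroup Y G"
proof (rule subgroupI)
  fix a assume a: "a \<in> Y"
  have "inj_on (\<lambda>b. a \<otimes> b) Y"
    using a assms(2) by (intro inj_onI) (metis Units_eq Units_l_cancel subsetD)
  hence surj: "(\<lambda>b. a \<otimes> b) ` Y = Y"
    using assms(1) mult a by (intro endo_inj_surj) auto
  then obtain e where e: "e \<in> Y" "a \<otimes> e = a" using a by (metis imageE)
  hence "e = \<one>" using a assms(2) by (metis l_cancel_one subsetD)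
  then obtain b where "b \<in> Y" "a \<otimes> b = \<one>" using surj e by (metis imageE)
  thus "inv a \<in> Y" using a assms(2) by (metis inv_comm inv_equality subsetD)
qed (use assms in auto)

text \<open>A maximal subgroup \<open>Y \<subseteq> U\<close> admitting such a factorization is \<open>U\<close> itself: otherwise adjoin
  \<open>u \<in> U - Y\<close> and multiply by the powers of \<open>u\<close> below the first one that lies in \<open>Y\<close>.\<close>

lemma (in group) mls_on_abelian_subgroup:
  assumes "subgroup U G" "finite U" and comm: "\<And>x y. x \<in> U \<Longrightarrow> y \<in> U \<Longrightarrow> x \<otimes> y = y \<otimes> x"
  shows "mls_on G U"
proof -
  interpret U: subgroup U G by fact
  define S where "S = {Y. subgroup Y G \<and> Y \<subseteq> U \<and> mls_on G Y}"
  have "S \<subseteq> Pow U" by (auto simp: S_def)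
  hence "finite S" using assms(2) finite_subset by blast
  moreover have "{\<one>} \<in> S"
    by (auto simp: S_def mls_on_one triv_subgroup)
  ultimately obtain Y where Y: "Y \<in> S" and max: "\<And>Y'. Y' \<in> S \<Longrightarrow> Y \<subseteq> Y' \<Longrightarrow> Y = Y'"
    using finite_has_maximal[of S] by auto
  interpret Y: subgroup Y G using Y by (simp add: S_def)
  have YU: "Y \<subseteq> U" and mY: "mls_on G Y" using Y by (auto simp: S_def)
  have "Y = U"
  proof (rule ccontr)
    assume "Y \<noteq> U"
    then obtain u where u: "u \<in> U" "u \<notin> Y" using YU by blast
    have uG: "u \<in> carrier G" using u by auto
    have upow: "u [^] j \<in> U" for j :: nat
      using u by (induction j) auto
    define P where "P k \<longleftrightarrow> k > 0 \<and> u [^] k \<in> Y" for k :: nat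
    \<comment> \<open>Finiteness of \<open>U\<close> makes two powers of \<open>u\<close> coincide,
      so some positive power of \<open>u\<close> is trivial and lies in \<open>Y\<close>; hence the
      least exponent \<open>k\<close> below exists.\<close>
    have "\<not> inj (\<lambda>j::nat. u [^] j)"
    proof
      assume "inj (\<lambda>j::nat. u [^] j)"
      moreover have "finite (range (\<lambda>j::nat. u [^] j))"
        using upow assms(2) by (auto intro: finite_subset)
      ultimately show False using finite_imageD infinite_UNIV_nat by blast
    qed
    then obtain i j :: nat where ij: "i \<noteq> j" "u [^] i = u [^] j" by (auto simp: inj_def)
    have "\<exists>i j :: nat. i < j \<and> u [^] i = u [^] j"
      using ij by (metis linorder_neqE_nat)
    then obtain i j :: nat where ij: "i < j" "u [^] i = u [^] j" by blast
    have "u [^] i \<otimes> u [^] (j - i) = u [^] (i + (j - i))"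
      using uG by (simp add: nat_pow_mult)
    hence "u [^] i \<otimes> u [^] (j - i) = u [^] i \<otimes> \<one>"
      using ij uG by simp
    hence "u [^] (j - i) = \<one>" using uG by (metis Units_eq Units_l_cancel nat_pow_closed one_closed)
    hence "P (j - i)" using ij by (simp add: P_def)
    define k where "k = (LEAST k. P k)"
    have Pk: "P k" unfolding k_def using \<open>P (j - i)\<close> by (rule LeastI)
    have kmin: "u [^] l \<notin> Y" if "0 < l" "l < k" for l
      using not_less_Least[of l P] that by (auto simp: P_def k_def)
    let ?C = "(\<lambda>j. u [^] j) ` {..<k}"
    \<comment> \<open>The cosets of \<open>Y\<close> through \<open>u [^] l\<close>,
      \<open>l < k\<close>, are distinct: otherwise \<open>u [^] (m - l)\<close> would lie in
      \<open>Y\<close> with a positive exponent below \<open>k\<close>.\<close>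
    have key: "l = m" if "l < k" "m < k" "y \<in> Y" "y' \<in> Y" "y \<otimes> u [^] l = y' \<otimes> u [^] m" for l m y y'
    proof -
      have aux: False if "l < m" "m < k" "y \<in> Y" "y' \<in> Y" "y \<otimes> u [^] l = y' \<otimes> u [^] m"
        for l m y y'
      proof -
        have c: "y \<in> carrier G" "y' \<in> carrier G" using that by auto
        have "u [^] m = u [^] (m - l) \<otimes> u [^] l" using that uG by (simp add: nat_pow_mult)
        hence "y \<otimes> u [^] l = y' \<otimes> u [^] (m - l) \<otimes> u [^] l"
          using that c uG by (simp add: m_assoc)
        hence "y = y' \<otimes> u [^] (m - l)"
          using c uG by (meson m_closed nat_pow_closed right_cancel)
        hence "u [^] (m - l) = inv y' \<otimes> y"
          using c uG by (metis inv_solve_left nat_pow_closed)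
        moreover have "m - l < k" using that by linarith
        ultimately show False using kmin[of "m - l"] that by auto
      qed
      show ?thesis using aux[of l m y y'] aux[of m l y' y] that by (metis linorder_neqE_nat)
    qed
    have "inj_on (\<lambda>j. u [^] j) {..<k}"
      using key[of _ _ \<one> \<one>] uG by (auto intro!: inj_onI)
    hence mC: "mls_on G ?C"
      using uG Pk by (intro mls_on_powers) (auto simp: P_def)
    define Y' where "Y' = (\<lambda>(x, y). x \<otimes> y) ` (Y \<times> ?C)"
    have inj: "inj_on (\<lambda>(x, y). x \<otimes> y) (Y \<times> ?C)"
    proof (rule inj_onI; clarify)
      fix y y' l m assume a: "y \<in> Y" "y' \<in> Y" "l < k" "m < k" "y \<otimes> u [^] l = y' \<otimes> u [^] m"
      hence "l = m" using key by blast
      thus "y = y' \<and> u [^] l = u [^] m"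
        using a uG by (metis Y.mem_carrier nat_pow_closed right_cancel)
    qed
    have "finite Y" using YU assms(2) finite_subset by blast
    hence "mls_on G Y'"
      using inj Pk by (intro mls_on_mult[OF mY mC]) (auto simp: Y'_def bij_betw_def P_def)
    moreover have Y'U: "Y' \<subseteq> U"
      using YU upow by (auto simp: Y'_def)
    \<comment> \<open>Since \<open>u [^] k\<close> lies in \<open>Y\<close>, every exponent can be
      reduced modulo \<open>k\<close>; so \<open>Y'\<close> contains the product of \<open>Y\<close>
      with all powers of \<open>u\<close>.\<close>
    have Y'1: "y \<otimes> u [^] m \<in> Y'" if "y \<in> Y" for y and m :: nat
    proof -
      define a where "a = (u [^] k) [^] (m div k)"
      have "(u [^] k) [^] j \<in> Y" for j :: nat
        using Pk by (induction j) (auto simp: P_def)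
      hence aY: "a \<in> Y" by (simp add: a_def)
      have "u [^] m = a \<otimes> u [^] (m mod k)"
        unfolding a_def using uG by (simp add: nat_pow_pow nat_pow_mult)
      hence "y \<otimes> u [^] m = (y \<otimes> a) \<otimes> u [^] (m mod k)"
        using uG aY that by (simp add: m_assoc)
      moreover have "(y \<otimes> a) \<otimes> u [^] (m mod k) \<in> Y'"
        unfolding Y'_def using aY that Pk
        by (intro image_eqI[of _ _ "(y \<otimes> a, u [^] (m mod k))"]) (auto simp: P_def)
      ultimately show ?thesis by simp
    qed
    have mult: "a \<otimes> b \<in> Y'" if abY: "a \<in> Y'" "b \<in> Y'" for a b
    proof -
      obtain y y' and l m :: nat where ab: "y \<in> Y" "y' \<in> Y" "a = y \<otimes> u [^] l" "b = y' \<otimes> u [^] m"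
        using abY unfolding Y'_def by auto
      have yc: "y \<in> carrier G" "y' \<in> carrier G" using ab by auto
      \<comment> \<open>Commutativity moves the power past \<open>y'\<close>, which brings the
        product into the form treated by \<open>Y'1\<close>.\<close>
      have "u [^] l \<otimes> y' = y' \<otimes> u [^] l" using comm upow ab YU by blast
      hence "a \<otimes> b = (y \<otimes> y') \<otimes> u [^] (l + m)"
        using ab yc uG by (simp add: m_assoc flip: nat_pow_mult) (simp flip: m_assoc)
      thus ?thesis using Y'1[of "y \<otimes> y'"] ab by simp
    qed
    have "subgroup Y' G"
    proof (rule finite_subgroupI)
      show "finite Y'" using Y'U assms(2) finite_subset by blast
      show "Y' \<subseteq> carrier G" using Y'U by auto
      show "Y' \<noteq> {}" using Y'1[of \<one> 0] by auto
    qed (fact mult)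
    hence "Y' \<in> S" using Y'U calculation by (auto simp: S_def)
    moreover have "Y \<subseteq> Y'" using Y'1[of _ 0] by auto
    ultimately have "Y = Y'" using max by blast
    moreover have "u \<in> Y'" using Y'1[of \<one> 1] uG by simp
    ultimately show False using u by simp
  qed
  thus ?thesis using mY by simp
qed

section \<open>Transport along homomorphisms and assembly of four factors\<close>

lemma (in monoid) mls_on_hom:
  assumes "monoid G'" "\<phi> \<in> hom G G'" "\<phi> \<one> = \<one>\<^bsub>G'\<^esub>" "mls_on G V" "inj_on \<phi> V" "V \<noteq> {}"
  shows "mls_on G' (\<phi> ` V)"
proof -
  interpret G': monoid G' by fact
  obtain As where As: "\<forall>A\<in>set As. A \<subseteq> carrier G" "bij_betw (tuple_prod G) (block_tuples As) V"
    "ls_length As = mls_bound (card V)"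
    using assms unfolding mls_on_def by blast
  have tp: "\<phi> (tuple_prod G xs) = tuple_prod G' (map \<phi> xs)" if "set xs \<subseteq> carrier G" for xs
    using that assms(2,3) by (induction xs) (auto simp: hom_mult tuple_prod_closed)
  define As' where "As' = map ((`) \<phi>) As"
  have ne: "\<exists>xs. xs \<in> block_tuples As" using As(2) assms(6) by (auto simp: bij_betw_def)
  then obtain xs0 where xs0: "xs0 \<in> block_tuples As" by blast
  have inj2: "inj_on (tuple_prod G' \<circ> map \<phi>) (block_tuples As)"
  proof -
    have "inj_on (\<phi> \<circ> tuple_prod G) (block_tuples As)"
      using As(2) assms(5) by (auto simp: bij_betw_def intro: comp_inj_on)
    thus ?thesis using tp block_tuples_carrier[OF As(1)] by (auto simp: inj_on_def)
  qed
  have injm: "inj_on (map \<phi>) (block_tuples As)" using inj2 by (rule inj_on_imageI2)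
  \<comment> \<open>Block sizes must be preserved, but injectivity is known on \<open>V\<close>
    only. Two elements of one block are compared by substituting each into the fixed tuple
    \<open>xs0\<close>, since distinct tuples have distinct images.\<close>
  have injA: "inj_on \<phi> (As ! i)" if i: "i < length As" for i
  proof (rule inj_onI)
    fix a b assume ab: "a \<in> As ! i" "b \<in> As ! i" "\<phi> a = \<phi> b"
    have upd: "xs0[i := x] \<in> block_tuples As" if "x \<in> As ! i" for x
      using that xs0 i by (auto simp: block_tuples_def) (metis nth_list_update)
    have "xs0[i := a] = xs0[i := b]"
      using injm by (rule inj_onD) (use ab upd in \<open>auto simp: map_update\<close>)
    thus "a = b" using i xs0 by (metis block_tuples_length nth_list_update_eq)
  qed
  have img: "map \<phi> ` block_tuples As = block_tuples As'"
  proof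
    show "map \<phi> ` block_tuples As \<subseteq> block_tuples As'"
      by (auto simp: block_tuples_def As'_def)
    show "block_tuples As' \<subseteq> map \<phi> ` block_tuples As"
    proof
      fix ys assume ys: "ys \<in> block_tuples As'"
      hence "\<forall>i<length As. \<exists>x. x \<in> As ! i \<and> ys ! i = \<phi> x"
        by (auto simp: block_tuples_def As'_def)
      then obtain f where f: "\<And>i. i < length As \<Longrightarrow> f i \<in> As ! i \<and> ys ! i = \<phi> (f i)" by metis
      show "ys \<in> map \<phi> ` block_tuples As"
        using ys f by (intro image_eqI[of _ _ "map f [0..<length As]"] nth_equalityI)
          (auto simp: block_tuples_def As'_def)
    qed
  qed
  have b1: "bij_betw (map \<phi>) (block_tuples As) (block_tuples As')"
    using injm img by (simp add: bij_betw_def)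
  have "bij_betw (\<phi> \<circ> tuple_prod G) (block_tuples As) (\<phi> ` V)"
    using As(2) assms(5) by (meson bij_betw_trans inj_on_imp_bij_betw)
  also have "?this \<longleftrightarrow> bij_betw (tuple_prod G' \<circ> map \<phi>) (block_tuples As) (\<phi> ` V)"
    using tp block_tuples_carrier[OF As(1)] by (intro bij_betw_cong) auto
  finally have "bij_betw (tuple_prod G') (block_tuples As') (\<phi> ` V)"
    using bij_betw_comp_iff[OF b1] by blast
  moreover have "ls_length As' = ls_length As"
    unfolding ls_length_def As'_def using injA
    by (auto intro!: arg_cong[where f = sum_list] card_image simp: in_set_conv_nth)
  moreover have "\<forall>A\<in>set As'. A \<subseteq> carrier G'"
    using As(1) assms(2) by (auto simp: As'_def hom_def)
  ultimately show ?thesis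
    unfolding mls_on_def using As(3) assms(5) by (intro exI[of _ As']) (auto simp: card_image)
qed

text \<open>The shorter products over \<open>A\<close>, \<open>B\<close> and over \<open>A\<close>,
  \<open>B\<close>, \<open>C\<close> inherit uniqueness by padding with the identity; this is the
  reason for placing \<open>\<one>\<close> in the last two factors.\<close>

lemma (in monoid) has_MLS_four_factors:
  assumes mls: "mls_on G A" "mls_on G B" "mls_on G C" "mls_on G D"
    and fin: "finite (carrier G)" and ne: "A \<noteq> {}" "B \<noteq> {}" and one: "\<one> \<in> C" "\<one> \<in> D"
    and inj: "\<And>a b c d a' b' c' d'. a \<in> A \<Longrightarrow> b \<in> B \<Longrightarrow> c \<in> C \<Longrightarrow> d \<in> D \<Longrightarrow>
      a' \<in> A \<Longrightarrow> b' \<in> B \<Longrightarrow> c' \<in> C \<Longrightarrow> d' \<in> D \<Longrightarrow>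
      a \<otimes> b \<otimes> c \<otimes> d = a' \<otimes> b' \<otimes> c' \<otimes> d' \<Longrightarrow> a = a' \<and> b = b' \<and> c = c' \<and> d = d'"
    and surj: "\<And>g. g \<in> carrier G \<Longrightarrow> \<exists>a\<in>A. \<exists>b\<in>B. \<exists>c\<in>C. \<exists>d\<in>D. g = a \<otimes> b \<otimes> c \<otimes> d"
  shows "has_MLS G"
proof -
  have sub: "A \<subseteq> carrier G" "B \<subseteq> carrier G" "C \<subseteq> carrier G" "D \<subseteq> carrier G"
    using mls mls_on_subset by auto
  let ?m = "\<lambda>(x, y). x \<otimes> y"
  define AB where "AB = ?m ` (A \<times> B)"
  define ABC where "ABC = ?m ` (AB \<times> C)"
  have fins: "finite A" "finite B" "finite C" "finite D"
    using sub fin by (auto dest: finite_subset)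
  have "inj_on ?m (A \<times> B)"
  proof (rule inj_onI; clarify)
    fix a b a' b' assume *: "a \<in> A" "b \<in> B" "a' \<in> A" "b' \<in> B" "a \<otimes> b = a' \<otimes> b'"
    thus "a = a' \<and> b = b'" using inj[of a b \<one> \<one> a' b' \<one> \<one>] one by simp
  qed
  hence AB: "mls_on G AB" "finite AB" "AB \<noteq> {}"
    using fins ne mls by (auto simp: AB_def bij_betw_def intro!: mls_on_mult[of A B])
  have "inj_on ?m (AB \<times> C)"
    unfolding AB_def
  proof (rule inj_onI; clarsimp)
    fix a b c a' b' c' assume *: "a \<in> A" "b \<in> B" "c \<in> C" "a' \<in> A" "b' \<in> B" "c' \<in> C"
      "a \<otimes> b \<otimes> c = a' \<otimes> b' \<otimes> c'"
    thus "a \<otimes> b = a' \<otimes> b' \<and> c = c'" using inj[of a b c \<one> a' b' c' \<one>] one by simp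
  qed
  hence ABC: "mls_on G ABC" "finite ABC" "ABC \<noteq> {}"
    using fins one mls AB by (auto simp: ABC_def bij_betw_def intro!: mls_on_mult[of AB C])
  have "inj_on ?m (ABC \<times> D)"
    unfolding AB_def ABC_def
  proof (rule inj_onI; clarsimp)
    fix a b c d a' b' c' d' assume *: "a \<in> A" "b \<in> B" "c \<in> C" "d \<in> D"
      "a' \<in> A" "b' \<in> B" "c' \<in> C" "d' \<in> D" "a \<otimes> b \<otimes> c \<otimes> d = a' \<otimes> b' \<otimes> c' \<otimes> d'"
    thus "a \<otimes> b \<otimes> c = a' \<otimes> b' \<otimes> c' \<and> d = d'" using inj[of a b c d a' b' c' d'] by simp
  qed
  moreover have "?m ` (ABC \<times> D) = carrier G"
  proof
    show "?m ` (ABC \<times> D) \<subseteq> carrier G" using sub by (fastforce simp: ABC_def AB_def)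
    show "carrier G \<subseteq> ?m ` (ABC \<times> D)"
    proof
      fix g assume "g \<in> carrier G"
      then obtain a b c d where *: "a \<in> A" "b \<in> B" "c \<in> C" "d \<in> D" "g = a \<otimes> b \<otimes> c \<otimes> d"
        using surj by blast
      have "a \<otimes> b \<otimes> c \<in> ABC" using * by (force simp: ABC_def AB_def)
      thus "g \<in> ?m ` (ABC \<times> D)" using * by force
    qed
  qed
  ultimately have "bij_betw ?m (ABC \<times> D) (carrier G)"
    by (simp only: bij_betw_def)
  hence "mls_on G (carrier G)"
    using fins one by (intro mls_on_mult[OF ABC(1) mls(4) ABC(2) _ ABC(3)]) auto
  thus ?thesis by (simp add: has_MLS_iff_mls_on)
qed

section \<open>Finite fields\<close>

lemma finite_field_pow_card:
  fixes x :: "'a :: {field, finite}"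
  shows "x ^ card (UNIV :: 'a set) = x"
proof (cases "x = 0")
  case False
  let ?U = "UNIV - {0 :: 'a}"
  \<comment> \<open>Multiplication by a nonzero \<open>x\<close> permutes the nonzero elements;
    comparing the two products gives \<open>x ^ card ?U = 1\<close>.\<close>
  have "(\<Prod>y\<in>?U. y) = (\<Prod>y\<in>?U. x * y)"
    by (rule prod.reindex_bij_witness[of _ "\<lambda>y. x * y" "\<lambda>y. y / x"]) (use False in auto)
  also have "\<dots> = x ^ card ?U * (\<Prod>y\<in>?U. y)"
    by (simp add: prod.distrib)
  finally have "x ^ card ?U = 1" by simp
  moreover have "card (UNIV :: 'a set) = Suc (card ?U)"
    by (rule card.remove) auto
  ultimately show ?thesis by (metis mult.right_neutral power_Suc)
next
  case True
  have "card (UNIV :: 'a set) \<noteq> 0" unfolding card_eq_0_iff by simp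
  thus ?thesis unfolding True by (simp only: power_0_left if_False)
qed

lemma card_eq_prime_power_imp_CHAR:
  assumes "prime p" "card (UNIV :: 'a :: {field, finite} set) = p ^ k"
  shows "CHAR('a) = p"
proof -
  have "prime CHAR('a)"
    by (intro prime_CHAR_semidom finite_imp_CHAR_pos) auto
  moreover have "CHAR('a) dvd p ^ k" using CHAR_dvd_CARD[where ?'a = 'a] assms by simp
  ultimately show ?thesis
    using assms(1) by (metis prime_dvd_power primes_dvd_imp_eq)
qed

text \<open>Over an algebraically closed field the roots counted with multiplicity number exactly
  the degree, and here every multiplicity is 1.\<close>

lemma card_roots_rsquarefree:
  fixes p :: "'a :: alg_closed_field poly"
  assumes "rsquarefree p"
  shows "card {x. poly p x = 0} = degree p"
proof -
  have p: "p \<noteq> 0" using assms by (auto simp: rsquarefree_def)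
  obtain A where A: "size A = degree p" "p = smult (lead_coeff p) (\<Prod>x\<in>#A. [:-x, 1:])"
    using alg_closed_imp_factorization[OF p] by blast
  have nz: "(\<Prod>x\<in>#B. [:-x, 1:]) \<noteq> 0" for B :: "'a multiset"
    by (auto simp: prod_mset_zero_iff)
  have "proots (\<Prod>x\<in>#B. [:-x, 1:]) = B" for B :: "'a multiset"
    by (induction B) (simp_all add: proots_mult[OF _ nz] del: mult_pCons_left)
  hence "proots p = A"
    using p by (subst A(2)) simp
  hence "size (proots p) = degree p" using A by simp
  moreover have "size (proots p) = (\<Sum>x | poly p x = 0. Polynomial.order x p)"
    using p by (simp add: size_multiset_overloaded_eq)
  moreover have "(\<Sum>x | poly p x = 0. Polynomial.order x p) = (\<Sum>x | poly p x = 0. 1)"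
    using assms p by (intro sum.cong) (auto simp: rsquarefree_root_order)
  ultimately show ?thesis by simp
qed

text \<open>The derivative of X^N - X is -1 because N vanishes in the field, so all N roots are
  simple. This yields finite subfields of the closure by counting.\<close>

lemma card_power_fixed_points:
  fixes N :: nat
  assumes "N > 1" "CHAR('a :: alg_closed_field) dvd N"
  shows "card {x :: 'a :: alg_closed_field. x ^ N = x} = N"
proof -
  let ?p = "monom 1 N - monom 1 1 :: 'a poly"
  have "of_nat N = (0 :: 'a)" using assms by (simp add: of_nat_eq_0_iff_char_dvd)
  hence "pderiv ?p = - 1"
    by (simp add: pderiv_diff pderiv_monom monom_0 one_pCons)
  hence d1: "poly (pderiv ?p) a = - 1" for a by simp
  have d: "degree ?p = N"
    unfolding diff_conv_add_uminus using assms by (subst degree_add_eq_left) (auto simp: degree_monom_eq)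
  hence p0: "?p \<noteq> 0" using assms by auto
  have "Polynomial.order a ?p \<le> 1" for a
  proof (rule ccontr)
    assume "\<not> Polynomial.order a ?p \<le> 1"
    hence "[:-a, 1:] ^ 2 dvd ?p"
      using order_divides[of a 2 ?p] p0 by simp
    then obtain r where "?p = [:-a, 1:] ^ 2 * r" by (rule dvdE)
    hence "?p = [:-a, 1:] * ([:-a, 1:] * r)"
      by (simp only: power2_eq_square mult.assoc)
    hence "poly (pderiv ?p) a = 0"
      by (simp only: pderiv_mult) simp
    thus False using d1 by simp
  qed
  hence "rsquarefree ?p"
    using p0 unfolding rsquarefree_def by (metis One_nat_def le_Suc_eq le_zero_eq)
  thus ?thesis
    using card_roots_rsquarefree[of ?p] d by (simp add: poly_monom)
qed

lemma card_power_fixed_points_le: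
  fixes N :: nat
  assumes "N > 1"
  shows "finite {x :: 'a :: field. x ^ N = x}" "card {x :: 'a. x ^ N = x} \<le> N"
proof -
  let ?p = "monom 1 N - monom 1 1 :: 'a poly"
  have d: "degree ?p = N"
    unfolding diff_conv_add_uminus using assms by (subst degree_add_eq_left) (auto simp: degree_monom_eq)
  hence "?p \<noteq> 0" using assms by auto
  thus "finite {x :: 'a. x ^ N = x}" "card {x :: 'a. x ^ N = x} \<le> N"
    using poly_roots_finite[of ?p] card_poly_roots_bound[of ?p] d by (auto simp: poly_monom)
qed

section \<open>Finite subfields of the algebraic closure\<close>

lemma finite_subfield_generator:
  fixes K :: "'a :: field set"
  assumes "finite K" "1 \<in> K" and K: "\<And>x y. x \<in> K \<Longrightarrow> y \<in> K \<Longrightarrow> x + y \<in> K"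
    "\<And>x y. x \<in> K \<Longrightarrow> y \<in> K \<Longrightarrow> x * y \<in> K" "\<And>x. x \<in> K \<Longrightarrow> - x \<in> K"
    "\<And>x. x \<in> K \<Longrightarrow> inverse x \<in> K"
  obtains \<theta> where "\<theta> \<in> K" "\<theta> \<noteq> 0" "K - {0} = range (\<lambda>i::nat. \<theta> ^ i)"
proof -
  \<comment> \<open>The set \<open>K\<close> is wrapped as a field record, which gives access to the
    cyclicity of the multiplicative group of a finite field.\<close>
  let ?R = "\<lparr>carrier = K, monoid.mult = (*), one = 1, ring.zero = 0, add = (+)\<rparr> :: 'a ring"
  have "0 \<in> K" using K(1)[of 1 "- 1"] K(3) assms(2) by simp
  have inv_add: "\<exists>y\<in>K. y + x = 0 \<and> x + y = 0" if "x \<in> K" for x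
    using K(3) that by (intro bexI[of _ "- x"]) auto
  have inv_mult: "\<exists>y\<in>K. y * x = 1 \<and> x * y = 1" if "x \<in> K" "x \<noteq> 0" for x
    using K(4) that by (intro bexI[of _ "inverse x"]) auto
  have "Ring.field ?R"
  proof (intro field.intro domain.intro cring.intro ring.intro)
    show "abelian_group ?R"
      using \<open>0 \<in> K\<close> K inv_add by (intro abelian_groupI) (auto simp: add_ac)
    show "Group.monoid ?R" using assms(2) K by unfold_locales (auto simp: mult_ac)
    show "ring_axioms ?R" by unfold_locales (auto simp: algebra_simps)
    show "Group.comm_monoid ?R" using assms(2) K by unfold_locales (auto simp: mult_ac)
    show "domain_axioms ?R" by unfold_locales auto
    show "field_axioms ?R"
      using inv_mult by unfold_locales (auto simp: Units_def)
  qed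
  note F = this
  define R where "R = ?R"
  have "Ring.field R" "finite (carrier R)" using F assms(1) by (simp_all add: R_def)
  from field.finite_field_mult_group_has_gen[OF this]
  obtain a where a: "a \<in> carrier (Multiplicative_Group.mult_of R)"
    "carrier (Multiplicative_Group.mult_of R) = {a [^]\<^bsub>R\<^esub> i | i::nat. i \<in> UNIV}"
    by (rule bexE)
  have pow: "a [^]\<^bsub>R\<^esub> i = a ^ i" for i :: nat
    by (induction i) (simp_all add: nat_pow_def R_def mult_ac)
  have "a \<in> K - {0}" "K - {0} = {a ^ i | i::nat. i \<in> UNIV}"
    using a unfolding Multiplicative_Group.carrier_mult_of pow by (auto simp: R_def)
  thus ?thesis by (intro that[of a]) auto
qed

text \<open>The image of the base field consists of roots of X^Q - X and already has Q elements, the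
  largest possible number of roots. The criterion serves to descend elements found in the
  closure.\<close>

lemma to_ac_range_iff:
  fixes x :: "'a :: {field, finite} alg_closure"
  shows "x \<in> range to_ac \<longleftrightarrow> x ^ card (UNIV :: 'a set) = x"
proof -
  let ?Q = "card (UNIV :: 'a set)"
  let ?S = "{x :: 'a alg_closure. x ^ ?Q = x}"
  have Q: "?Q > 1" using card_mono[of UNIV "{0, 1 :: 'a}"] by simp
  have sub: "range to_ac \<subseteq> ?S"
    using finite_field_pow_card[where ?'a = 'a] by (auto simp flip: to_ac_power simp del: to_ac_power)
  have c: "card (range (to_ac :: 'a \<Rightarrow> _)) = ?Q"
    by (rule card_image) (rule inj_to_ac)
  have "range to_ac = ?S"
    by (rule card_seteq[OF card_power_fixed_points_le(1)[OF Q] sub])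
      (use card_power_fixed_points_le(2)[OF Q, where ?'a = "'a alg_closure"] c in simp)
  thus ?thesis by blast
qed

lemma finite_field_extension_generator:
  fixes n k p :: nat
  defines "Q \<equiv> card (UNIV :: 'a :: {field, finite} set)"
  assumes p: "prime p" "Q = p ^ k" and n: "n > 0"
  obtains \<theta> :: "'a :: {field, finite} alg_closure" where "{x. x ^ (Q ^ n) = x} - {0} = range (\<lambda>i::nat. \<theta> ^ i)"
    "\<And>i j. \<theta> ^ i = \<theta> ^ j \<longleftrightarrow> i mod (Q ^ n - 1) = j mod (Q ^ n - 1)"
proof -
  have Q: "Q > 1" unfolding Q_def using card_mono[of UNIV "{0, 1 :: 'a}"] by simp
  have Qn: "Q ^ n > 1" using one_less_power[OF Q n] .
  have char: "CHAR('a alg_closure) = p"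
    using card_eq_prime_power_imp_CHAR[OF p(1), where ?'a = 'a] p(2) by (simp add: Q_def)
  have Qp: "Q ^ n = CHAR('a alg_closure) ^ (k * n)" by (simp only: char p(2) power_mult)
  have "k * n > 0" using Qn Qp by (cases "k * n = 0") auto
  hence dvd: "CHAR('a alg_closure) dvd Q ^ n" unfolding Qp by (rule dvd_power[OF disjI1])
  \<comment> \<open>The extension of degree \<open>n\<close> is realized as the fixed points of the
    \<open>Q ^ n\<close> power map inside the closure.\<close>
  define K where "K = {x :: 'a alg_closure. x ^ (Q ^ n) = x}"
  have cardK: "card K = Q ^ n" unfolding K_def by (rule card_power_fixed_points[OF Qn dvd])
  hence fin: "finite K" using Qn by (metis card.infinite not_one_less_zero)
  have add: "(x + y) ^ (Q ^ n) = x ^ (Q ^ n) + y ^ (Q ^ n)" for x y :: "'a alg_closure"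
    by (rule freshmans_dream'[OF _ Qp]) (simp only: char p(1))
  \<comment> \<open>Negation is handled by additivity of the power map, which avoids a case
    distinction on the parity of \<open>Q ^ n\<close>.\<close>
  have uminus: "- x \<in> K" if "x \<in> K" for x
  proof -
    have "(- x) ^ (Q ^ n) + x ^ (Q ^ n) = 0"
      unfolding add[symmetric] left_minus using Qn by (intro zero_power) linarith
    thus ?thesis using that by (simp add: K_def eq_neg_iff_add_eq_0)
  qed
  obtain \<theta> where th: "\<theta> \<in> K" "\<theta> \<noteq> 0" "K - {0} = range (\<lambda>i::nat. \<theta> ^ i)"
    by (rule finite_subfield_generator[of K])
      (use fin uminus in \<open>auto simp: K_def add power_mult_distrib power_inverse\<close>)
  define M where "M = Q ^ n - 1"
  have M: "M > 0" using Qn by (simp add: M_def)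
  have "\<theta> ^ (Q ^ n) = \<theta>" using th by (simp add: K_def)
  moreover have "Q ^ n = Suc M" using Qn by (simp add: M_def)
  ultimately have one: "\<theta> ^ M = 1" using th(2) by simp
  have mod: "\<theta> ^ i = \<theta> ^ (i mod M)" for i
  proof -
    have "\<theta> ^ i = \<theta> ^ (M * (i div M) + i mod M)" by simp
    also have "\<dots> = \<theta> ^ (i mod M)" by (simp only: power_add power_mult one) simp
    finally show ?thesis .
  qed
  \<comment> \<open>The exponents below \<open>M\<close> already give all \<open>M\<close> nonzero
    elements, so by counting they give each one once.\<close>
  have "range (\<lambda>i::nat. \<theta> ^ i) = (\<lambda>i. \<theta> ^ i) ` {..<M}"
    using mod M by (auto simp: image_iff) (metis lessThan_iff mod_less_divisor)
  moreover have "0 \<in> K" using Q by (simp add: K_def)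
  hence "card (K - {0}) = M" using fin cardK by (simp add: M_def)
  ultimately have "card ((\<lambda>i. \<theta> ^ i) ` {..<M}) = card {..<M}" using th(3) by simp
  hence inj: "inj_on (\<lambda>i. \<theta> ^ i) {..<M}" by (rule eq_card_imp_inj_on[OF finite_lessThan])
  show ?thesis
  proof (rule that[of \<theta>])
    show "{x. x ^ (Q ^ n) = x} - {0} = range (\<lambda>i::nat. \<theta> ^ i)" using th(3) by (simp add: K_def)
    show "\<theta> ^ i = \<theta> ^ j \<longleftrightarrow> i mod (Q ^ n - 1) = j mod (Q ^ n - 1)" for i j
    proof
      assume "\<theta> ^ i = \<theta> ^ j"
      hence "\<theta> ^ (i mod M) = \<theta> ^ (j mod M)" using mod by metis
      hence "i mod M = j mod M" using M by (intro inj_onD[OF inj]) auto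
      thus "i mod (Q ^ n - 1) = j mod (Q ^ n - 1)" by (simp add: M_def)
    next
      assume "i mod (Q ^ n - 1) = j mod (Q ^ n - 1)"
      thus "\<theta> ^ i = \<theta> ^ j" using mod[of i] mod[of j] by (simp add: M_def)
    qed
  qed
qed

section \<open>Counting vectors and finiteness of matrix spaces\<close>

lemma card_carrier_vec:
  "card (carrier_vec n :: 'a :: finite vec set) = card (UNIV :: 'a set) ^ n"
  "finite (carrier_vec n :: 'a :: finite vec set)"
proof -
  have *: "bij_betw vec_of_list {xs :: 'a list. length xs = n} (carrier_vec n)"
  proof (rule bij_betw_byWitness[where f' = list_of_vec])
    show "\<forall>xs\<in>{xs :: 'a list. length xs = n}. list_of_vec (vec_of_list xs) = xs"
      by (simp add: list_vec)
    show "\<forall>v\<in>carrier_vec n. vec_of_list (list_of_vec v) = (v :: 'a vec)"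
      by (simp add: vec_list)
    show "vec_of_list ` {xs :: 'a list. length xs = n} \<subseteq> carrier_vec n"
    proof (rule image_subsetI)
      fix xs :: "'a list" assume "xs \<in> {xs. length xs = n}"
      thus "vec_of_list xs \<in> carrier_vec n" by (intro carrier_vecI) simp
    qed
    show "list_of_vec ` carrier_vec n \<subseteq> {xs :: 'a list. length xs = n}"
      using length_list_of_vec carrier_vecD by blast
  qed
  have "{xs :: 'a list. length xs = n} = {xs. set xs \<subseteq> UNIV \<and> length xs = n}" by simp
  thus "card (carrier_vec n :: 'a vec set) = card (UNIV :: 'a set) ^ n"
    "finite (carrier_vec n :: 'a vec set)"
    using bij_betw_same_card[OF *] bij_betw_finite[OF *]
      card_lists_length_eq[of "UNIV :: 'a set" n] finite_lists_length_eq[of "UNIV :: 'a set" n]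
    by auto
qed

lemma finite_carrier_mat: "finite (carrier_mat n m :: 'a :: finite mat set)"
proof -
  have "carrier_mat n m \<subseteq> (\<lambda>xs. mat_of_rows m xs) ` {xs :: 'a vec list. set xs \<subseteq> carrier_vec m \<and> length xs = n}"
  proof
    fix A :: "'a mat" assume "A \<in> carrier_mat n m"
    thus "A \<in> (\<lambda>xs. mat_of_rows m xs) ` {xs. set xs \<subseteq> carrier_vec m \<and> length xs = n}"
      using mat_of_rows_rows[of A] rows_carrier[of A] by (intro image_eqI[of _ _ "rows A"]) auto
  qed
  thus ?thesis using finite_lists_length_eq[OF card_carrier_vec(2)] finite_surj by blast
qed

section \<open>Singer cycles\<close>

lemma pow_mat_add:
  fixes A :: "'a :: comm_semiring_1 mat"
  assumes "A \<in> carrier_mat n n"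
  shows "A ^\<^sub>m (i + j) = A ^\<^sub>m i * A ^\<^sub>m j"
proof (induction j)
  case 0
  show ?case using assms by simp
next
  case (Suc j)
  have "A ^\<^sub>m i * A ^\<^sub>m j * A = A ^\<^sub>m i * (A ^\<^sub>m j * A)"
    using assms by (intro assoc_mult_mat[of _ n n _ n _ n]) auto
  thus ?case using Suc by simp
qed

lemma mat_mult_unit_vec:
  fixes A :: "'a :: comm_semiring_1 mat"
  assumes "A \<in> carrier_mat m n" "j < n"
  shows "A *\<^sub>v unit_vec n j = col A j"
proof (rule eq_vecI)
  fix i assume "i < dim_vec (col A j)"
  thus "(A *\<^sub>v unit_vec n j) $ i = col A j $ i"
    using assms by (simp add: scalar_prod_right_unit)
qed (use assms in simp)

lemma pow_mat_mult_vec: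
  fixes A :: "'a :: comm_semiring_1 mat"
  assumes "A \<in> carrier_mat n n" "v \<in> carrier_vec n"
  shows "(A ^\<^sub>m (i + j)) *\<^sub>v v = (A ^\<^sub>m i) *\<^sub>v ((A ^\<^sub>m j) *\<^sub>v v)"
proof -
  have "A ^\<^sub>m (i + j) = A ^\<^sub>m i * A ^\<^sub>m j"
    using assms(1) by (rule pow_mat_add)
  thus ?thesis using assms by (metis assoc_mult_mat_vec pow_carrier_mat)
qed

lemma mat_eq_if_mult_unit_vec:
  fixes A B :: "'a :: comm_semiring_1 mat"
  assumes "A \<in> carrier_mat m n" "B \<in> carrier_mat m n"
    "\<And>i. i < n \<Longrightarrow> A *\<^sub>v unit_vec n i = B *\<^sub>v unit_vec n i"
  shows "A = B"
proof (rule eq_matI)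
  fix i j assume ij: "i < dim_row B" "j < dim_col B"
  have "col A j = col B j"
    using assms(3)[of j] assms(1,2) ij by (metis carrier_matD(2) mat_mult_unit_vec)
  thus "A $$ (i, j) = B $$ (i, j)" using assms ij by (metis carrier_matD index_col)
qed (use assms in auto)

lemma geometric_sum_nat:
  fixes Q :: nat
  assumes "Q > 0"
  shows "(Q - 1) * (\<Sum>i<m. Q ^ i) + 1 = Q ^ m"
proof -
  obtain r where "Q = Suc r" using assms by (cases Q) auto
  thus ?thesis by (induction m) (auto simp: algebra_simps)
qed

text \<open>Multiplication by a generator \<open>\<theta>\<close> of the multiplicative group of the extension of degree \<open>n\<close>,
  written in the basis \<open>1, \<theta>, \<dots>, \<theta>\<^bsup>n-1\<^esup>\<close>.\<close>

lemma singer_matrix: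
  fixes n k p :: nat
  defines "Q \<equiv> card (UNIV :: 'a :: {field, finite} set)"
  assumes p: "prime p" "Q = p ^ k" and n: "n > 0"
  obtains s :: "'a :: {field, finite} mat" and y where "s \<in> carrier_mat n n"
    "\<And>a. a < n \<Longrightarrow> (s ^\<^sub>m a) *\<^sub>v unit_vec n 0 = unit_vec n a"
    "\<And>v. v \<in> carrier_vec n \<Longrightarrow> v \<noteq> 0\<^sub>v n \<Longrightarrow> \<exists>a. (s ^\<^sub>m a) *\<^sub>v unit_vec n 0 = v"
    "\<And>a b. (s ^\<^sub>m a) *\<^sub>v unit_vec n 0 = (s ^\<^sub>m b) *\<^sub>v unit_vec n 0 \<longleftrightarrow>
       a mod (Q ^ n - 1) = b mod (Q ^ n - 1)"
    "(s ^\<^sub>m (\<Sum>i<n. Q ^ i)) *\<^sub>v unit_vec n 0 = y \<cdot>\<^sub>v unit_vec n 0"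
proof -
  obtain \<theta> :: "'a alg_closure" where th: "{x. x ^ (Q ^ n) = x} - {0} = range (\<lambda>i::nat. \<theta> ^ i)"
    and th_eq: "\<And>i j. \<theta> ^ i = \<theta> ^ j \<longleftrightarrow> i mod (Q ^ n - 1) = j mod (Q ^ n - 1)"
    by (rule finite_field_extension_generator[of p k n, where ?'a = 'a, folded Q_def, OF p n]) (rule that)
  define K where "K = {x :: 'a alg_closure. x ^ (Q ^ n) = x}"
  have Q: "Q > 1" unfolding Q_def using card_mono[of UNIV "{0, 1 :: 'a}"] by simp
  have Qn: "Q ^ n > 1" using one_less_power[OF Q n] .
  have char: "CHAR('a alg_closure) = p"
    using card_eq_prime_power_imp_CHAR[OF p(1), where ?'a = 'a] p(2) by (simp add: Q_def)
  have Qp: "Q ^ n = CHAR('a alg_closure) ^ (k * n)" by (simp only: char p(2) power_mult)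
  have pc: "prime (CHAR('a alg_closure))" by (simp only: char p(1))
  \<comment> \<open>The span of the first \<open>m\<close> powers of \<open>\<theta>\<close> over
    the base field.\<close>
  define S where "S m = (\<lambda>c :: nat \<Rightarrow> 'a. \<Sum>i<m. to_ac (c i) * \<theta> ^ i) ` UNIV" for m
  have "0 \<in> K" using Q by (simp add: K_def)
  have cardK: "card K = Q ^ n" and finK: "finite K"
  proof -
    have "k * n > 0" using Qn Qp by (cases "k * n = 0") auto
    hence dvd: "CHAR('a alg_closure) dvd Q ^ n" unfolding Qp by (rule dvd_power[OF disjI1])
    show "card K = Q ^ n" unfolding K_def by (rule card_power_fixed_points[OF Qn dvd])
    thus "finite K" using Qn by (metis card.infinite not_one_less_zero)
  qed
  have Kpow: "K = insert 0 (range (\<lambda>i::nat. \<theta> ^ i))"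
    using th \<open>0 \<in> K\<close> unfolding K_def by blast
  have card_S: "finite (S m)" "card (S m) \<le> Q ^ m" for m
  proof -
    have eq: "S m = (\<lambda>c. \<Sum>i<m. to_ac (c i) * \<theta> ^ i) ` ({..<m} \<rightarrow>\<^sub>E (UNIV :: 'a set))"
    proof (intro equalityI subsetI)
      fix x assume "x \<in> S m"
      then obtain c where "x = (\<Sum>i<m. to_ac (c i) * \<theta> ^ i)" by (auto simp: S_def)
      also have "\<dots> = (\<Sum>i<m. to_ac (restrict c {..<m} i) * \<theta> ^ i)" by (intro sum.cong) auto
      finally show "x \<in> (\<lambda>c. \<Sum>i<m. to_ac (c i) * \<theta> ^ i) ` ({..<m} \<rightarrow>\<^sub>E (UNIV :: 'a set))"
        by (intro image_eqI[of _ _ "restrict c {..<m}"]) auto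
    qed (auto simp: S_def)
    have fin: "finite ({..<m} \<rightarrow>\<^sub>E (UNIV :: 'a set))" by (intro finite_PiE) auto
    have "card ({..<m} \<rightarrow>\<^sub>E (UNIV :: 'a set)) = Q ^ m"
      unfolding Q_def by (simp add: card_PiE)
    thus "finite (S m)" "card (S m) \<le> Q ^ m"
      unfolding eq using finite_imageI[OF fin] card_image_le[OF fin] by simp_all
  qed
  \<comment> \<open>A relation expressing \<open>\<theta> ^ m\<close> by lower powers makes the span
    stable under multiplication by \<open>\<theta>\<close>, so it contains all powers.\<close>
  have S_closed: "\<theta> ^ i \<in> S m" if m: "\<theta> ^ m \<in> S m" "m > 0" for m i
  proof (induction i)
    case 0
    have "(\<Sum>i<m. to_ac (if i = 0 then 1 else 0 :: 'a) * \<theta> ^ i) = (\<Sum>i<m. if i = 0 then 1 else 0)"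
      by (intro sum.cong) auto
    also have "\<dots> = 1" using m by simp
    finally show ?case unfolding S_def power_0
      by (intro image_eqI[of _ _ "\<lambda>i. if i = 0 then 1 else 0"]) simp_all
  next
    case (Suc i)
    obtain d where d: "\<theta> ^ m = (\<Sum>i<m. to_ac (d i) * \<theta> ^ i)" using m by (auto simp: S_def)
    obtain c where c: "\<theta> ^ i = (\<Sum>i<m. to_ac (c i) * \<theta> ^ i)" using Suc by (auto simp: S_def)
    obtain m' where m': "m = Suc m'" using m by (cases m) auto
    \<comment> \<open>The coefficients move up by one place, leaving 0 at the bottom; the overflow
      \<open>c m'\<close> at exponent \<open>m\<close> is rewritten by the relation
      \<open>d\<close>.\<close>
    define c' where "c' j = (if j = 0 then 0 else c (j - 1)) + c m' * d j" for j
    have "\<theta> ^ Suc i = (\<Sum>i<m. to_ac (c i) * \<theta> ^ Suc i)"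
      using c by (simp add: sum_distrib_left mult_ac)
    also have "\<dots> = (\<Sum>i<m'. to_ac (c i) * \<theta> ^ Suc i) + to_ac (c m') * \<theta> ^ m"
      by (simp add: m')
    also have "(\<Sum>i<m'. to_ac (c i) * \<theta> ^ Suc i) = (\<Sum>j<m. to_ac (if j = 0 then 0 else c (j - 1)) * \<theta> ^ j)"
      unfolding m' sum.lessThan_Suc_shift by simp
    also have "to_ac (c m') * \<theta> ^ m = (\<Sum>j<m. to_ac (c m' * d j) * \<theta> ^ j)"
      unfolding d by (simp add: sum_distrib_left mult_ac)
    finally have "\<theta> ^ Suc i = (\<Sum>j<m. to_ac (c' j) * \<theta> ^ j)"
      by (simp add: c'_def sum.distrib ring_distribs)
    thus ?case by (auto simp: S_def)
  qed
  \<comment> \<open>Otherwise the span, with at most \<open>Q ^ m\<close> elements, would contain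
    all \<open>Q ^ n\<close> elements of \<open>K\<close>.\<close>
  have indep: "\<theta> ^ m \<notin> S m" if "m < n" for m
  proof
    assume m: "\<theta> ^ m \<in> S m"
    have "m > 0" using m by (cases m) (auto simp: S_def)
    have "0 \<in> S m" unfolding S_def by (intro image_eqI[of _ _ "\<lambda>_. 0"]) auto
    hence "K \<subseteq> S m" using S_closed[OF m \<open>m > 0\<close>] unfolding Kpow by blast
    hence "card K \<le> card (S m)" by (rule card_mono[OF card_S(1)])
    hence "Q ^ n \<le> Q ^ m" using card_S(2)[of m] unfolding cardK by linarith
    moreover have "Q ^ m < Q ^ n" using Q that by (intro power_strict_increasing) auto
    ultimately show False by simp
  qed
  \<comment> \<open>The coordinate map for the powers of \<open>\<theta>\<close>, identifying
    vectors of length \<open>n\<close> with the extension field.\<close>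
  define \<phi> where "\<phi> v = (\<Sum>i<n. to_ac (v $ i) * \<theta> ^ i)" for v :: "'a vec"
  have phi_diff: "\<phi> (v - w) = \<phi> v - \<phi> w" if "v \<in> carrier_vec n" "w \<in> carrier_vec n" for v w
    using that by (simp add: \<phi>_def sum_subtractf ring_distribs)
  have phi_smult: "\<phi> (c \<cdot>\<^sub>v v) = to_ac c * \<phi> v" if "v \<in> carrier_vec n" for c v
    using that by (simp add: \<phi>_def sum_distrib_left mult_ac)
  have phi_unit: "\<phi> (unit_vec n a) = \<theta> ^ a" if "a < n" for a
  proof -
    have "\<phi> (unit_vec n a) = (\<Sum>i<n. if i = a then \<theta> ^ i else 0)"
      unfolding \<phi>_def using that by (intro sum.cong) auto
    thus ?thesis using that by simp
  qed
  have phi_0: "v = 0\<^sub>v n" if v: "v \<in> carrier_vec n" and eq: "\<phi> v = 0" for v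
  proof (rule ccontr)
    assume "v \<noteq> 0\<^sub>v n"
    hence ex: "\<exists>i. i < n \<and> v $ i \<noteq> 0" using v by (auto intro!: eq_vecI)
    \<comment> \<open>Solving a vanishing combination for its highest term puts
      \<open>\<theta> ^ m\<close> into the span of the lower powers, against
      \<open>indep\<close>.\<close>
    define m where "m = (GREATEST i. i < n \<and> v $ i \<noteq> 0)"
    have m: "m < n" "v $ m \<noteq> 0"
      using GreatestI_ex_nat[OF ex, of n] by (auto simp: m_def)
    have above: "v $ i = 0" if "i < n" "i > m" for i
      using Greatest_le_nat[of "\<lambda>i. i < n \<and> v $ i \<noteq> 0" i n] that by (force simp: m_def)
    have "0 = (\<Sum>i<n. to_ac (v $ i) * \<theta> ^ i)" using eq by (simp add: \<phi>_def)
    also have "\<dots> = (\<Sum>i<Suc m. to_ac (v $ i) * \<theta> ^ i)"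
      using m above by (intro sum.mono_neutral_right) auto
    finally have e: "to_ac (v $ m) * \<theta> ^ m = - (\<Sum>i<m. to_ac (v $ i) * \<theta> ^ i)"
      by (simp add: eq_neg_iff_add_eq_0 add.commute)
    have "\<theta> ^ m = to_ac (inverse (v $ m)) * (to_ac (v $ m) * \<theta> ^ m)" using m by simp
    also have "\<dots> = (\<Sum>i<m. to_ac (- inverse (v $ m) * v $ i) * \<theta> ^ i)"
      unfolding e by (simp add: sum_distrib_left sum_negf mult_ac)
    finally have "\<theta> ^ m \<in> S m"
      unfolding S_def by (intro image_eqI[of _ _ "\<lambda>i. - inverse (v $ m) * v $ i"]) simp_all
    thus False using indep m by blast
  qed
  have phi_inj: "inj_on \<phi> (carrier_vec n)"
  proof (rule inj_onI)
    fix v w assume vw: "v \<in> carrier_vec n" "w \<in> carrier_vec n" "\<phi> v = \<phi> w"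
    hence "v - w = 0\<^sub>v n" by (intro phi_0) (auto simp: phi_diff)
    hence *: "(v - w) $ i = 0\<^sub>v n $ i" for i by simp
    have "v $ i = w $ i" if "i < n" for i using *[of i] vw that by simp
    thus "v = w" using vw by (intro eq_vecI) auto
  qed
  have addK: "(\<Sum>i\<in>A. f i) \<in> K" if "\<And>i. i \<in> A \<Longrightarrow> f i \<in> K" for A and f :: "nat \<Rightarrow> 'a alg_closure"
    unfolding K_def mem_Collect_eq freshmans_dream_sum'[OF pc Qp]
    using that by (intro sum.cong) (auto simp: K_def)
  have to_ac_K: "to_ac c \<in> K" for c :: 'a
  proof -
    have "c ^ (Q ^ m) = c" for m
      by (induction m) (simp_all add: power_mult mult.commute finite_field_pow_card[of c, folded Q_def])
    thus ?thesis by (simp add: K_def flip: to_ac_power)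
  qed
  \<comment> \<open>The coordinate map is injective, and source and target both have
    \<open>Q ^ n\<close> elements.\<close>
  have phi_K: "\<phi> ` carrier_vec n = K"
  proof (rule card_seteq[OF finK])
    show "\<phi> ` carrier_vec n \<subseteq> K"
    proof
      fix x assume "x \<in> \<phi> ` carrier_vec n"
      then obtain v :: "'a vec" where v: "x = (\<Sum>i<n. to_ac (v $ i) * \<theta> ^ i)" by (auto simp: \<phi>_def)
      have thK: "\<theta> ^ i \<in> K" for i unfolding Kpow by blast
      have "to_ac (v $ i) * \<theta> ^ i \<in> K" for i
        using to_ac_K[of "v $ i"] thK[of i] by (simp add: K_def power_mult_distrib)
      thus "x \<in> K" unfolding v by (intro addK)
    qed
    show "card K \<le> card (\<phi> ` carrier_vec n)"
      by (simp add: card_image[OF phi_inj] cardK card_carrier_vec(1) Q_def)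
  qed
  have "\<theta> ^ n \<in> K" unfolding Kpow by blast
  then obtain c where c: "c \<in> carrier_vec n" "\<phi> c = \<theta> ^ n" unfolding phi_K[symmetric] by auto
  \<comment> \<open>The companion matrix of \<open>\<theta>\<close>: each basis vector is sent to
    the next one, and the last column holds the coordinates of \<open>\<theta> ^ n\<close>.\<close>
  define s where "s = mat n n (\<lambda>(i, j). if j + 1 < n then (if i = j + 1 then 1 else 0) else c $ i)"
  have s: "s \<in> carrier_mat n n" by (simp add: s_def)
  have s_unit: "\<phi> (s *\<^sub>v unit_vec n j) = \<theta> * \<theta> ^ j" if "j < n" for j
  proof (cases "j + 1 < n")
    case True
    have "s *\<^sub>v unit_vec n j = unit_vec n (j + 1)"
      using s True that by (subst mat_mult_unit_vec) (auto simp: s_def intro!: eq_vecI)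
    thus ?thesis using True phi_unit[of "j + 1"] by simp
  next
    case False
    have "s *\<^sub>v unit_vec n j = c"
      using s False that c by (subst mat_mult_unit_vec) (auto simp: s_def intro!: eq_vecI)
    moreover have "n = Suc j" using False that by simp
    ultimately show ?thesis using c(2) by simp
  qed
  have s_phi: "\<phi> (s *\<^sub>v v) = \<theta> * \<phi> v" if v: "v \<in> carrier_vec n" for v
  proof -
    have "(s *\<^sub>v v) $ i = (\<Sum>j<n. s $$ (i, j) * v $ j)" if "i < n" for i
      using v s that by (simp add: scalar_prod_def atLeast0LessThan)
    moreover have "(s *\<^sub>v unit_vec n j) $ i = s $$ (i, j)" if "i < n" "j < n" for i j
      using s that by (simp add: mat_mult_unit_vec)
    ultimately have "\<phi> (s *\<^sub>v v) = (\<Sum>i<n. \<Sum>j<n. to_ac (v $ j) * (to_ac ((s *\<^sub>v unit_vec n j) $ i) * \<theta> ^ i))"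
      unfolding \<phi>_def by (intro sum.cong refl) (simp add: to_ac_sum sum_distrib_right sum_distrib_left mult_ac)
    also have "\<dots> = (\<Sum>j<n. to_ac (v $ j) * \<phi> (s *\<^sub>v unit_vec n j))"
      unfolding \<phi>_def by (subst sum.swap) (simp add: sum_distrib_left)
    also have "\<dots> = \<theta> * \<phi> v"
      unfolding \<phi>_def[of v] by (simp add: s_unit sum_distrib_left mult_ac)
    finally show ?thesis .
  qed
  let ?e = "unit_vec n 0 :: 'a vec"
  have spow: "s ^\<^sub>m a \<in> carrier_mat n n" for a using s by (rule pow_carrier_mat)
  have pow_phi: "\<phi> ((s ^\<^sub>m a) *\<^sub>v ?e) = \<theta> ^ a" for a
  proof (induction a)
    case 0
    show ?case using s n phi_unit[of 0] by simp
  next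
    case (Suc a)
    have "(s ^\<^sub>m Suc a) *\<^sub>v ?e = s *\<^sub>v ((s ^\<^sub>m a) *\<^sub>v ?e)"
      using pow_mat_mult_vec[OF s, of ?e 1 a] s by simp
    thus ?case using Suc s_phi[of "(s ^\<^sub>m a) *\<^sub>v ?e"] spow[of a]
      by (simp add: mult_mat_vec_carrier[where n = n])
  qed
  have car: "(s ^\<^sub>m a) *\<^sub>v ?e \<in> carrier_vec n" for a
    using spow[of a] by (rule mult_mat_vec_carrier) simp
  have iff: "(s ^\<^sub>m a) *\<^sub>v ?e = v \<longleftrightarrow> \<theta> ^ a = \<phi> v" if "v \<in> carrier_vec n" for a v
    using inj_on_eq_iff[OF phi_inj car that] by (simp add: pow_phi)
  \<comment> \<open>The index of the nonzero base field scalars in the group generated by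
    \<open>\<theta>\<close>; the power \<open>\<theta> ^ b\<close> is fixed by the
    \<open>Q\<close>-th power map and hence is a scalar.\<close>
  define b where "b = (\<Sum>i<n. Q ^ i)"
  have bQ: "(Q - 1) * b = Q ^ n - 1"
    using geometric_sum_nat[of Q n] Q unfolding b_def by linarith
  have "(\<theta> ^ b) ^ Q = \<theta> ^ b"
  proof -
    have "b * Q = b + (Q - 1) * b" using Q by (simp add: algebra_simps)
    hence "b * Q mod (Q ^ n - 1) = b mod (Q ^ n - 1)" unfolding bQ by (simp only: mod_add_self2)
    hence "\<theta> ^ (b * Q) = \<theta> ^ b" by (simp only: th_eq)
    thus ?thesis by (simp only: power_mult)
  qed
  hence "\<theta> ^ b \<in> range to_ac" unfolding to_ac_range_iff Q_def .
  then obtain y where y: "\<theta> ^ b = to_ac y" by auto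
  show ?thesis
  proof (rule that[of s y])
    show "(s ^\<^sub>m a) *\<^sub>v ?e = unit_vec n a" if "a < n" for a
      using that by (simp add: iff phi_unit)
    show "\<exists>a. (s ^\<^sub>m a) *\<^sub>v ?e = v" if "v \<in> carrier_vec n" "v \<noteq> 0\<^sub>v n" for v
    proof -
      have "\<phi> v \<in> K" "\<phi> v \<noteq> 0" using that phi_K phi_0 by auto
      thus ?thesis using iff[OF that(1)] unfolding Kpow by auto
    qed
    show "(s ^\<^sub>m a) *\<^sub>v ?e = (s ^\<^sub>m b) *\<^sub>v ?e \<longleftrightarrow> a mod (Q ^ n - 1) = b mod (Q ^ n - 1)" for a b
      by (simp add: iff[OF car] pow_phi th_eq)
    show "(s ^\<^sub>m (\<Sum>i<n. Q ^ i)) *\<^sub>v ?e = y \<cdot>\<^sub>v ?e"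
      using n by (subst iff) (simp_all add: phi_smult phi_unit y[unfolded b_def])
  qed (fact s)
qed

section \<open>Unitary groups in hyperbolic coordinates\<close>

lemma (in group) group_center_normal: "group_center G \<lhd> G"
proof -
  have sub: "subgroup (group_center G) G"
  proof (rule subgroupI)
    show "group_center G \<subseteq> carrier G" by (auto simp: group_center_def)
    have "\<one> \<in> group_center G" by (auto simp: group_center_def)
    thus "group_center G \<noteq> {}" by blast
    show "inv a \<in> group_center G" if a: "a \<in> group_center G" for a
    proof -
      have ac: "a \<in> carrier G" using a by (simp add: group_center_def)
      have "inv a \<otimes> g = g \<otimes> inv a" if g: "g \<in> carrier G" for g
      proof -
        have "a \<otimes> g = g \<otimes> a" using a g by (simp add: group_center_def)
        have "inv a \<otimes> g = inv a \<otimes> ((g \<otimes> a) \<otimes> inv a)" using ac g by (simp add: m_assoc)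
        also have "\<dots> = inv a \<otimes> ((a \<otimes> g) \<otimes> inv a)" by (simp only: \<open>a \<otimes> g = g \<otimes> a\<close>)
        also have "\<dots> = g \<otimes> inv a" using ac g by (simp add: m_assoc[symmetric])
        finally show ?thesis .
      qed
      thus ?thesis using ac by (simp add: group_center_def)
    qed
    show "a \<otimes> b \<in> group_center G" if "a \<in> group_center G" "b \<in> group_center G" for a b
    proof -
      have c: "a \<in> carrier G" "b \<in> carrier G" using that by (auto simp: group_center_def)
      have "a \<otimes> b \<otimes> g = g \<otimes> (a \<otimes> b)" if g: "g \<in> carrier G" for g
      proof -
        have "a \<otimes> b \<otimes> g = a \<otimes> (g \<otimes> b)"
          using \<open>b \<in> group_center G\<close> c g by (simp add: group_center_def m_assoc)
        also have "\<dots> = g \<otimes> a \<otimes> b"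
          using \<open>a \<in> group_center G\<close> c g by (simp add: group_center_def flip: m_assoc)
        finally show ?thesis using c g by (simp add: m_assoc)
      qed
      thus ?thesis using c by (simp add: group_center_def)
    qed
  qed
  moreover have "x \<otimes> h \<otimes> inv x \<in> group_center G"
    if "x \<in> carrier G" "h \<in> group_center G" for x h
  proof -
    have "x \<otimes> h = h \<otimes> x" "h \<in> carrier G" using that by (auto simp: group_center_def)
    hence "x \<otimes> h \<otimes> inv x = h" using that by (simp add: m_assoc)
    thus ?thesis using that by simp
  qed
  ultimately show ?thesis by (simp add: normal_inv_iff)
qed

section \<open>Conjugate transposes and block matrices\<close>

lemma dim_conj_tr [simp]: "dim_row (conj_tr q A) = dim_col A" "dim_col (conj_tr q A) = dim_row A"
  by (simp_all add: conj_tr_def)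

lemma conj_tr_carrier [simp]: "A \<in> carrier_mat a b \<Longrightarrow> conj_tr q A \<in> carrier_mat b a"
  by auto

lemma index_conj_tr [simp]:
  "i < dim_col A \<Longrightarrow> j < dim_row A \<Longrightarrow> conj_tr q A $$ (i, j) = (A $$ (j, i)) ^ q"
  by (simp add: conj_tr_def)

lemma square_mult_carrier_mat [simp]:
  "A \<in> carrier_mat m m \<Longrightarrow> B \<in> carrier_mat m m \<Longrightarrow> A * B \<in> carrier_mat m m"
  by (rule mult_carrier_mat)

lemma conj_tr_four_block:
  assumes "A \<in> carrier_mat a1 b1" "B \<in> carrier_mat a1 b2" "C \<in> carrier_mat a2 b1" "D \<in> carrier_mat a2 b2"
  shows "conj_tr q (four_block_mat A B C D) =
    four_block_mat (conj_tr q A) (conj_tr q C) (conj_tr q B) (conj_tr q D)"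
  using assms unfolding conj_tr_def
  by (simp add: transpose_four_block_mat[OF assms] map_four_block_mat[of _ b1 a1 _ a2 _ b2])

lemma four_block_inject:
  assumes "four_block_mat A B C D = four_block_mat A' B' C' D'"
    "A \<in> carrier_mat a1 b1" "B \<in> carrier_mat a1 b2" "C \<in> carrier_mat a2 b1" "D \<in> carrier_mat a2 b2"
    "A' \<in> carrier_mat a1 b1" "B' \<in> carrier_mat a1 b2" "C' \<in> carrier_mat a2 b1" "D' \<in> carrier_mat a2 b2"
  shows "A = A'" "B = B'" "C = C'" "D = D'"
proof -
  have e: "four_block_mat A B C D $$ (i, j) = four_block_mat A' B' C' D' $$ (i, j)" for i j
    using assms(1) by simp
  show "A = A'"
  proof (rule eq_matI)
    fix i j assume "i < dim_row A'" "j < dim_col A'"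
    thus "A $$ (i, j) = A' $$ (i, j)" using e[of i j] assms(2-) by simp
  qed (use assms(2-) in auto)
  show "B = B'"
  proof (rule eq_matI)
    fix i j assume "i < dim_row B'" "j < dim_col B'"
    thus "B $$ (i, j) = B' $$ (i, j)" using e[of i "b1 + j"] assms(2-) by simp
  qed (use assms(2-) in auto)
  show "C = C'"
  proof (rule eq_matI)
    fix i j assume "i < dim_row C'" "j < dim_col C'"
    thus "C $$ (i, j) = C' $$ (i, j)" using e[of "a1 + i" j] assms(2-) by simp
  qed (use assms(2-) in auto)
  show "D = D'"
  proof (rule eq_matI)
    fix i j assume "i < dim_row D'" "j < dim_col D'"
    thus "D $$ (i, j) = D' $$ (i, j)" using e[of "a1 + i" "b1 + j"] assms(2-) by simp
  qed (use assms(2-) in auto)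
qed

lemma four_block_exhaust:
  assumes "M \<in> carrier_mat (a1 + a2) (b1 + b2)"
  obtains A B C D where "M = four_block_mat A B C D" "A \<in> carrier_mat a1 b1" "B \<in> carrier_mat a1 b2"
    "C \<in> carrier_mat a2 b1" "D \<in> carrier_mat a2 b2"
proof -
  obtain A B C D where sp: "split_block M a1 b1 = (A, B, C, D)" by (cases "split_block M a1 b1") auto
  from split_block[OF sp, of a2 b2] assms show ?thesis by (intro that[of A B C D]) auto
qed

lemma append_vec_exhaust:
  assumes "v \<in> carrier_vec (a + b)"
  obtains x y where "v = x @\<^sub>v y" "x \<in> carrier_vec a" "y \<in> carrier_vec b"
proof
  show "v = vec a (\<lambda>i. v $ i) @\<^sub>v vec b (\<lambda>i. v $ (a + i))"
    using assms by (intro eq_vecI) auto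
qed auto

definition unit_mat :: "nat \<Rightarrow> nat \<Rightarrow> nat \<Rightarrow> 'a :: zero \<Rightarrow> 'a mat" where
  "unit_mat n i j c = mat n n (\<lambda>(a, b). if a = i \<and> b = j then c else 0)"

lemma unit_mat_carrier [simp]: "unit_mat n i j c \<in> carrier_mat n n"
  by (simp add: unit_mat_def)

lemma index_unit_mat [simp]:
  "a < n \<Longrightarrow> b < n \<Longrightarrow> unit_mat n i j c $$ (a, b) = (if a = i \<and> b = j then c else 0)"
  "dim_row (unit_mat n i j c) = n" "dim_col (unit_mat n i j c) = n"
  by (simp_all add: unit_mat_def)

lemma unit_mat_mult:
  fixes P :: "'a :: comm_ring_1 mat"
  assumes P: "P \<in> carrier_mat n n" and ab: "a < n" "b < n" and ij: "i < n" "j < n"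
  shows "(unit_mat n i j c * P) $$ (a, b) = (if a = i then c * P $$ (j, b) else 0)"
    "(P * unit_mat n i j c) $$ (a, b) = (if b = j then P $$ (a, i) * c else 0)"
proof -
  have "(unit_mat n i j c * P) $$ (a, b) = (\<Sum>k<n. (if a = i \<and> k = j then c else 0) * P $$ (k, b))"
    using P ab by (simp add: scalar_prod_def atLeast0LessThan)
  also have "\<dots> = (\<Sum>k<n. if k = j then (if a = i then c * P $$ (j, b) else 0) else 0)"
    by (intro sum.cong) auto
  finally show "(unit_mat n i j c * P) $$ (a, b) = (if a = i then c * P $$ (j, b) else 0)"
    using ij by (simp add: sum.delta)
  have "(P * unit_mat n i j c) $$ (a, b) = (\<Sum>k<n. P $$ (a, k) * (if k = i \<and> b = j then c else 0))"
    using P ab by (simp add: scalar_prod_def atLeast0LessThan)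
  also have "\<dots> = (\<Sum>k<n. if k = i then (if b = j then P $$ (a, i) * c else 0) else 0)"
    by (intro sum.cong) auto
  finally show "(P * unit_mat n i j c) $$ (a, b) = (if b = j then P $$ (a, i) * c else 0)"
    using ij by (simp add: sum.delta)
qed

section \<open>The field with q^2 elements and its conjugation\<close>

locale hermitian_field =
  fixes q p k :: nat and field_type :: "'a :: {field, finite} itself"
  assumes prime_p: "prime p" and q_eq: "q = p ^ k" and k_pos: "k > 0"
    and card_field: "card (UNIV :: 'a set) = q ^ 2"
begin

lemma q_gt_1: "q > 1"
  unfolding q_eq using prime_gt_1_nat[OF prime_p] k_pos by (rule one_less_power)

lemma char_eq: "CHAR('a) = p"
  by (rule card_eq_prime_power_imp_CHAR[OF prime_p, of "k * 2"])
    (simp only: card_field q_eq power_mult)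

lemma bar_add: "(x + y :: 'a) ^ q = x ^ q + y ^ q"
  by (rule freshmans_dream'[of _ k]) (simp_all only: char_eq prime_p q_eq)

lemma bar_bar [simp]: "((x :: 'a) ^ q) ^ q = x"
proof -
  have "(x ^ q) ^ q = x ^ (q ^ 2)" by (simp only: power_mult[symmetric] power2_eq_square)
  thus ?thesis by (simp only: card_field[symmetric] finite_field_pow_card)
qed

text \<open>Registering conjugation as a ring homomorphism lets it pass through matrix products and
  determinants.\<close>

sublocale bar: comm_ring_hom "\<lambda>x :: 'a. x ^ q"
  using q_gt_1 by unfold_locales (simp_all add: bar_add power_mult_distrib)

lemma conj_tr_mult:
  assumes "A \<in> carrier_mat a b" "B \<in> carrier_mat b c"
  shows "conj_tr q (A * B :: 'a mat) = conj_tr q B * conj_tr q A"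
  unfolding conj_tr_def transpose_mult[OF assms]
  using assms by (intro bar.mat_hom_mult) auto

lemma conj_tr_one [simp]: "conj_tr q (1\<^sub>m m :: 'a mat) = 1\<^sub>m m"
  using q_gt_1 by (intro eq_matI) auto

lemma conj_tr_zero [simp]: "conj_tr q (0\<^sub>m a b :: 'a mat) = 0\<^sub>m b a"
  using q_gt_1 by (intro eq_matI) auto

lemma conj_tr_conj_tr [simp]: "conj_tr q (conj_tr q (A :: 'a mat)) = A"
  by (intro eq_matI) auto

lemma conj_tr_smult: "conj_tr q (c \<cdot>\<^sub>m A :: 'a mat) = (c ^ q) \<cdot>\<^sub>m conj_tr q A"
  by (intro eq_matI) (auto simp: power_mult_distrib)

lemma det_conj_tr: "A \<in> carrier_mat m m \<Longrightarrow> det (conj_tr q (A :: 'a mat)) = (det A) ^ q"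
  unfolding conj_tr_def bar.hom_det by (subst det_transpose) auto

lemma SU_iff:
  "A \<in> carrier (SU m q) \<longleftrightarrow> A \<in> carrier_mat m m \<and> A * conj_tr q A = 1\<^sub>m m \<and> det (A :: 'a mat) = 1"
  by (simp add: SU_def)

lemma SU_mult [simp]: "A \<otimes>\<^bsub>SU m q\<^esub> B = A * (B :: 'a mat)"
  by (simp add: SU_def)

lemma SU_one [simp]: "\<one>\<^bsub>SU m q\<^esub> = (1\<^sub>m m :: 'a mat)"
  by (simp add: SU_def)

lemma SU_conj_tr_left:
  assumes "(A :: 'a mat) \<in> carrier (SU m q)"
  shows "conj_tr q A * A = 1\<^sub>m m"
  using assms by (intro mat_mult_left_right_inverse[of A m]) (auto simp: SU_iff)

lemma group_SU: "group (SU m q :: 'a mat monoid)"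
proof (rule groupI)
  fix A B C :: "'a mat"
  assume A: "A \<in> carrier (SU m q)" and B: "B \<in> carrier (SU m q)"
  have Am: "A \<in> carrier_mat m m" "B \<in> carrier_mat m m" using A B by (auto simp: SU_iff)
  have "A * B * conj_tr q (A * B) = A * ((B * conj_tr q B) * conj_tr q A)"
    using Am by (simp add: conj_tr_mult[of A m m B m] assoc_mult_mat[of _ m m _ m _ m])
  thus "A \<otimes>\<^bsub>SU m q\<^esub> B \<in> carrier (SU m q)"
    using A B Am by (simp add: SU_iff det_mult)
next
  fix A :: "'a mat" assume A: "A \<in> carrier (SU m q)"
  hence Am: "A \<in> carrier_mat m m" by (simp add: SU_iff)
  have "conj_tr q A \<in> carrier (SU m q)"
    using SU_conj_tr_left[OF A] A Am by (simp add: SU_iff det_conj_tr)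
  thus "\<exists>B\<in>carrier (SU m q). B \<otimes>\<^bsub>SU m q\<^esub> A = \<one>\<^bsub>SU m q\<^esub>"
    using SU_conj_tr_left[OF A] by auto
qed (auto simp: SU_iff assoc_mult_mat[of _ m m _ m _ m])

lemma finite_SU: "finite (carrier (SU m q :: 'a mat monoid))"
  by (rule finite_subset[OF _ finite_carrier_mat[of m m]]) (auto simp: SU_iff)

text \<open>A root of y^(q+1) = -1 exists in the closure. As -1 is fixed by the q-th power, so is
  the norm of y; this gives y^(q^2) = y, so y lies in the field.\<close>

lemma ex_norm_minus_one: "\<exists>\<alpha> :: 'a. \<alpha> * \<alpha> ^ q = - 1"
proof -
  obtain y :: "'a alg_closure" where y: "y ^ (q + 1) = - 1"
    using nth_root_exists[of "q + 1" "- 1"] by auto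
  have "(- 1 :: 'a) ^ q = - 1" using bar.hom_uminus[of 1] by simp
  hence "to_ac ((- 1 :: 'a) ^ q) = to_ac (- 1)" by simp
  hence m1: "(- 1 :: 'a alg_closure) ^ q = - 1" by simp
  have "(y ^ (q + 1)) ^ q = y ^ (q + 1)" by (simp only: y m1)
  hence "y ^ (q ^ 2) * y ^ q = y * y ^ q"
    by (simp add: power_mult[symmetric] algebra_simps power_add power2_eq_square)
  moreover have "y \<noteq> 0" using y by (cases "y = 0") auto
  ultimately have "y ^ (q ^ 2) = y" by simp
  hence "y \<in> range to_ac" by (simp add: to_ac_range_iff card_field)
  then obtain a where "y = to_ac a" by auto
  hence "to_ac (a * a ^ q) = to_ac (- 1)" using y by simp
  thus ?thesis by (metis to_ac_eq_iff)
qed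

text \<open>The trace X^q + X has at most q roots among q^2 elements. A nonzero trace value is fixed
  by conjugation, so dividing by it normalizes the trace.\<close>

lemma ex_trace_minus_one: "\<exists>\<gamma> :: 'a. \<gamma> + \<gamma> ^ q = - 1"
proof -
  let ?p = "monom 1 q + monom 1 1 :: 'a poly"
  have d: "degree ?p = q"
    using q_gt_1 by (subst degree_add_eq_left) (auto simp: degree_monom_eq)
  hence "?p \<noteq> 0" using q_gt_1 by auto
  hence "card {x. poly ?p x = 0} \<le> q" using card_poly_roots_bound[of ?p] d by simp
  moreover have "q < q ^ 2" using q_gt_1 by (simp add: power2_eq_square)
  ultimately have "{x. poly ?p x = 0} \<noteq> UNIV" using card_field by auto
  then obtain t :: 'a where t: "t ^ q + t \<noteq> 0" by (auto simp: poly_monom)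
  define c where "c = t + t ^ q"
  have c: "c \<noteq> 0" "c ^ q = c" using t by (auto simp: c_def bar_add add.commute)
  have "(- t / c) ^ q = - (t ^ q) / c"
    using bar.hom_uminus[of t] c by (simp only: power_divide)
  hence "(- t / c) + (- t / c) ^ q = - (t + t ^ q) / c"
    by (simp add: add_divide_distrib diff_divide_distrib)
  also have "\<dots> = - 1" using c by (simp add: c_def[symmetric])
  finally show ?thesis by blast
qed

text \<open>A difference \<open>t - t ^ q\<close> with \<open>t\<close> not fixed; this works in
  every characteristic, including 2.\<close>

lemma ex_skew: "\<exists>\<sigma> :: 'a. \<sigma> \<noteq> 0 \<and> \<sigma> ^ q = - \<sigma>"
proof -
  have "q < q ^ 2" using q_gt_1 by (simp add: power2_eq_square)
  hence "{x :: 'a. x ^ q = x} \<noteq> UNIV"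
    using card_power_fixed_points_le(2)[OF q_gt_1, where ?'a = 'a] card_field by auto
  then obtain t :: 'a where "t ^ q \<noteq> t" by auto
  thus ?thesis using bar.hom_minus[of t "t ^ q"] by (intro exI[of _ "t - t ^ q"]) auto
qed

end

section \<open>The hyperbolic basis and isometries written in it\<close>

locale hyperbolic_frame = hermitian_field q p k field_type
  for q p k :: nat and field_type :: "'a :: {field, finite} itself" +
  fixes n :: nat and \<alpha> \<gamma> :: 'a
  assumes n2: "n \<ge> 2" and alpha: "\<alpha> * \<alpha> ^ q = - 1" and gamma: "\<gamma> + \<gamma> ^ q = - 1"
begin

abbreviation "N \<equiv> n + n"

abbreviation scalar :: "'a \<Rightarrow> 'a mat" where "scalar c \<equiv> c \<cdot>\<^sub>m 1\<^sub>m n"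

lemma scalar_mult: "scalar a * scalar b = scalar (a * b)"
proof -
  have "scalar a * scalar b = a \<cdot>\<^sub>m (1\<^sub>m n * (b \<cdot>\<^sub>m 1\<^sub>m n))"
    by (rule mult_smult_assoc_mat[of _ n n _ n]) auto
  thus ?thesis by (auto intro!: eq_matI)
qed

lemma scalar_add: "scalar a + scalar b = scalar (a + b)"
  by (intro eq_matI) (auto simp: algebra_simps)

text \<open>Gram matrix of the form in a hyperbolic basis. Scalar blocks reduce products of frame
  matrices to arithmetic of 2 by 2 matrices over the field.\<close>

definition J :: "'a mat" where
  "J = four_block_mat (scalar 0) (scalar 1) (scalar 1) (scalar 0)"

text \<open>The rows of \<open>B\<close> form a hyperbolic basis for the standard Hermitian form.\<close>

definition B :: "'a mat" where
  "B = four_block_mat (scalar 1) (scalar \<alpha>) (scalar (1 + \<gamma>)) (scalar (\<gamma> * \<alpha>))"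

definition Bi :: "'a mat" where "Bi = conj_tr q B * J"

lemma frame_carrier [simp]: "J \<in> carrier_mat N N" "B \<in> carrier_mat N N" "Bi \<in> carrier_mat N N"
  by (auto simp: J_def B_def Bi_def)

lemma block_mult:
  assumes "A1 \<in> carrier_mat n n" "A2 \<in> carrier_mat n n" "A3 \<in> carrier_mat n n" "A4 \<in> carrier_mat n n"
    "C1 \<in> carrier_mat n n" "C2 \<in> carrier_mat n n" "C3 \<in> carrier_mat n n" "C4 \<in> carrier_mat n n"
  shows "four_block_mat A1 A2 A3 A4 * four_block_mat C1 C2 C3 C4 = four_block_mat (A1 * C1 + A2 * C3)
    (A1 * C2 + A2 * C4) (A3 * C1 + A4 * C3) (A3 * C2 + A4 * C4 :: 'a mat)"
  using assms by (intro mult_four_block_mat[of _ n n _ n _ n]) auto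

lemma scalar_block_mult:
  "four_block_mat (scalar a1) (scalar a2) (scalar a3) (scalar a4) *
   four_block_mat (scalar c1) (scalar c2) (scalar c3) (scalar c4) =
   four_block_mat (scalar (a1 * c1 + a2 * c3)) (scalar (a1 * c2 + a2 * c4))
     (scalar (a3 * c1 + a4 * c3)) (scalar (a3 * c2 + a4 * c4))"
  by (subst block_mult) (simp_all only: scalar_mult scalar_add smult_carrier_mat one_carrier_mat)

lemma J_J: "J * J = 1\<^sub>m N"
proof -
  have "J * J = four_block_mat (scalar 1) (scalar 0) (scalar 0) (scalar 1)"
    unfolding J_def scalar_block_mult by simp
  also have "\<dots> = four_block_mat (1\<^sub>m n) (0\<^sub>m n n) (0\<^sub>m n n) (1\<^sub>m n)"
    by (intro cong_four_block_mat eq_matI) auto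
  finally show ?thesis by simp
qed

text \<open>Rows \<open>(e_i, \<alpha> e_i)\<close> are isotropic because \<open>\<alpha>\<close>
  has norm -1. The other rows are \<open>(e_i, 0)\<close> plus \<open>\<gamma>\<close> times these;
  they pair to 1 with the first family, and the trace -1 of \<open>\<gamma>\<close> makes them
  isotropic.\<close>

lemma B_conj_tr: "B * conj_tr q B = J"
proof -
  have ct: "conj_tr q B = four_block_mat (scalar 1) (scalar ((1 + \<gamma>) ^ q)) (scalar (\<alpha> ^ q)) (scalar ((\<gamma> * \<alpha>) ^ q))"
    unfolding B_def by (subst conj_tr_four_block[of _ n n _ n _ n]) (auto simp: conj_tr_smult)
  have g: "\<gamma> ^ q = - 1 - \<gamma>" using gamma by (simp add: eq_diff_eq add.commute)
  have e: "1 * 1 + \<alpha> * \<alpha> ^ q = 0" using alpha by simp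
  have "\<alpha> * (\<gamma> * \<alpha>) ^ q = \<gamma> ^ q * (\<alpha> * \<alpha> ^ q)" by (simp add: power_mult_distrib mult_ac)
  hence e2: "1 * (1 + \<gamma>) ^ q + \<alpha> * (\<gamma> * \<alpha>) ^ q = 1" by (simp add: bar_add alpha)
  have "\<gamma> * \<alpha> * \<alpha> ^ q = \<gamma> * (\<alpha> * \<alpha> ^ q)" by (simp add: mult_ac)
  hence e3: "(1 + \<gamma>) * 1 + \<gamma> * \<alpha> * \<alpha> ^ q = 1" by (simp add: alpha)
  have "\<gamma> * \<alpha> * (\<gamma> * \<alpha>) ^ q = \<gamma> * \<gamma> ^ q * (\<alpha> * \<alpha> ^ q)" by (simp add: power_mult_distrib mult_ac)
  hence e4: "(1 + \<gamma>) * (1 + \<gamma>) ^ q + \<gamma> * \<alpha> * (\<gamma> * \<alpha>) ^ q = 0"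
    by (simp add: bar_add alpha g algebra_simps)
  show ?thesis unfolding ct unfolding B_def scalar_block_mult e e2 e3 e4 J_def ..
qed

lemma B_Bi: "B * Bi = 1\<^sub>m N"
proof -
  have "B * Bi = (B * conj_tr q B) * J"
    unfolding Bi_def by (rule assoc_mult_mat[symmetric, of _ N N _ N _ N]) auto
  thus ?thesis by (simp only: B_conj_tr J_J)
qed

lemma Bi_B: "Bi * B = 1\<^sub>m N"
  by (rule mat_mult_left_right_inverse[OF _ _ B_Bi]) auto

lemma B_Bi_cancel: "M \<in> carrier_mat N N \<Longrightarrow> B * (Bi * M) = M"
  using assoc_mult_mat[of B N N Bi N M N] by (simp add: B_Bi)

lemma Bi_B_cancel: "M \<in> carrier_mat N N \<Longrightarrow> Bi * (B * M) = M"
  using assoc_mult_mat[of Bi N N B N M N] by (simp add: Bi_B)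

definition hyp_isometry :: "'a mat \<Rightarrow> bool" where
  "hyp_isometry g \<longleftrightarrow> g \<in> carrier_mat N N \<and> g * J * conj_tr q g = J \<and> det g = 1"

text \<open>Passage from hyperbolic to standard coordinates, by conjugation with
  \<open>B\<close>.\<close>

definition \<kappa> :: "'a mat \<Rightarrow> 'a mat" where "\<kappa> g = Bi * (g * B)"

lemma kappa_carrier [simp]: "g \<in> carrier_mat N N \<Longrightarrow> \<kappa> g \<in> carrier_mat N N"
  by (auto simp: \<kappa>_def)

lemma kappa_mult:
  assumes "g \<in> carrier_mat N N" "h \<in> carrier_mat N N"
  shows "\<kappa> g * \<kappa> h = \<kappa> (g * h)"
  using assms unfolding \<kappa>_def
  by (simp add: assoc_mult_mat[of _ N N _ N _ N] B_Bi_cancel)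

lemma kappa_one: "\<kappa> (1\<^sub>m N) = 1\<^sub>m N"
  using left_mult_one_mat[OF frame_carrier(2)] by (simp add: \<kappa>_def Bi_B)

lemma B_kappa: "g \<in> carrier_mat N N \<Longrightarrow> B * \<kappa> g = g * B"
  by (simp add: \<kappa>_def B_Bi_cancel)

text \<open>In the product with the conjugate transpose, \<open>B\<close> meets its own conjugate
  transpose and becomes \<open>J\<close>; the isometry condition for \<open>J\<close> then removes
  \<open>g\<close>.\<close>

lemma kappa_SU:
  assumes g: "hyp_isometry g"
  shows "\<kappa> g \<in> carrier (SU N q)"
proof -
  have gc: "g \<in> carrier_mat N N" and gJ: "g * J * conj_tr q g = J" and gd: "det g = 1"
    using g by (auto simp: hyp_isometry_def)
  note asc = assoc_mult_mat[of _ N N _ N _ N]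
  have "conj_tr q (\<kappa> g) = conj_tr q (g * B) * conj_tr q Bi"
    unfolding \<kappa>_def using gc by (intro conj_tr_mult[of _ N N _ N]) auto
  also have "conj_tr q (g * B) = conj_tr q B * conj_tr q g"
    using gc by (intro conj_tr_mult[of _ N N _ N]) auto
  finally have ct: "conj_tr q (\<kappa> g) = conj_tr q B * conj_tr q g * conj_tr q Bi" .
  have "\<kappa> g * conj_tr q (\<kappa> g) = Bi * (g * (B * conj_tr q B) * conj_tr q g) * conj_tr q Bi"
    unfolding ct unfolding \<kappa>_def using gc by (simp add: asc)
  also have "\<dots> = Bi * (B * conj_tr q B) * conj_tr q Bi"
    by (simp only: B_conj_tr gJ)
  also have "\<dots> = (Bi * B) * (conj_tr q B * conj_tr q Bi)"
    by (simp add: asc)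
  also have "conj_tr q B * conj_tr q Bi = conj_tr q (Bi * B)"
    by (rule conj_tr_mult[symmetric, of _ N N _ N]) auto
  finally have "\<kappa> g * conj_tr q (\<kappa> g) = 1\<^sub>m N" by (simp add: Bi_B)
  moreover have "det (\<kappa> g) = det Bi * (det g * det B)"
    unfolding \<kappa>_def using gc by (simp add: det_mult[of _ N])
  moreover have "det Bi * det B = 1" using det_mult[of Bi N B] by (simp add: Bi_B)
  ultimately show ?thesis using gc gd by (simp add: SU_iff)
qed

text \<open>Multiplied out, the transformed form differs from \<open>J\<close> only by the block
  \<open>conj_tr q S + S\<close>; the upper version below works the same way.\<close>

lemma hyp_isometry_lower:
  assumes S: "S \<in> carrier_mat n n" and skew: "S + conj_tr q S = 0\<^sub>m n n"
  shows "hyp_isometry (four_block_mat (1\<^sub>m n) (0\<^sub>m n n) S (1\<^sub>m n))" (is "hyp_isometry ?g")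
proof -
  have J: "J = four_block_mat (0\<^sub>m n n) (1\<^sub>m n) (1\<^sub>m n) (0\<^sub>m n n)"
    unfolding J_def by (intro cong_four_block_mat eq_matI) auto
  have ct: "conj_tr q ?g = four_block_mat (1\<^sub>m n) (conj_tr q S) (0\<^sub>m n n) (1\<^sub>m n)"
    using S by (subst conj_tr_four_block[of _ n n _ n _ n]) auto
  have "?g * J = four_block_mat (0\<^sub>m n n) (1\<^sub>m n) (1\<^sub>m n) S"
    unfolding J using S by (subst block_mult) auto
  hence "?g * J * conj_tr q ?g = four_block_mat (0\<^sub>m n n) (1\<^sub>m n) (1\<^sub>m n) (conj_tr q S + S)"
    unfolding ct using S by (simp only:) (subst block_mult, auto)
  also have "conj_tr q S + S = 0\<^sub>m n n" using skew S comm_add_mat[of S n n "conj_tr q S"] by simp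
  finally show ?thesis
    using S det_four_block_mat_upper_right_zero[of "1\<^sub>m n" n "0\<^sub>m n n" n S "1\<^sub>m n"]
    by (simp add: hyp_isometry_def flip: J)
qed

lemma hyp_isometry_upper:
  assumes S: "S \<in> carrier_mat n n" and skew: "S + conj_tr q S = 0\<^sub>m n n"
  shows "hyp_isometry (four_block_mat (1\<^sub>m n) S (0\<^sub>m n n) (1\<^sub>m n))" (is "hyp_isometry ?g")
proof -
  have J: "J = four_block_mat (0\<^sub>m n n) (1\<^sub>m n) (1\<^sub>m n) (0\<^sub>m n n)"
    unfolding J_def by (intro cong_four_block_mat eq_matI) auto
  have ct: "conj_tr q ?g = four_block_mat (1\<^sub>m n) (0\<^sub>m n n) (conj_tr q S) (1\<^sub>m n)"
    using S by (subst conj_tr_four_block[of _ n n _ n _ n]) auto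
  have "?g * J = four_block_mat S (1\<^sub>m n) (1\<^sub>m n) (0\<^sub>m n n)"
    unfolding J using S by (subst block_mult) auto
  hence "?g * J * conj_tr q ?g = four_block_mat (S + conj_tr q S) (1\<^sub>m n) (1\<^sub>m n) (0\<^sub>m n n)"
    unfolding ct using S by (simp only:) (subst block_mult, auto)
  thus ?thesis
    using S skew det_four_block_mat_lower_left_zero[of "1\<^sub>m n" n S n "0\<^sub>m n n" "1\<^sub>m n"]
    by (simp add: hyp_isometry_def flip: J)
qed

lemma hyp_isometry_diag:
  assumes A: "A \<in> carrier_mat n n" "C \<in> carrier_mat n n" "conj_tr q A * C = 1\<^sub>m n" "det A * det C = 1"
  shows "hyp_isometry (four_block_mat A (0\<^sub>m n n) (0\<^sub>m n n) C)" (is "hyp_isometry ?g")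
proof -
  have J: "J = four_block_mat (0\<^sub>m n n) (1\<^sub>m n) (1\<^sub>m n) (0\<^sub>m n n)"
    unfolding J_def by (intro cong_four_block_mat eq_matI) auto
  \<comment> \<open>The nonzero blocks of the transformed form are \<open>A * conj_tr q C\<close>
    and \<open>C * conj_tr q A\<close>. Both are the identity, by commuting the two inverse factors
    of the hypothesis and then conjugating.\<close>
  have CA: "C * conj_tr q A = 1\<^sub>m n"
    using A by (intro mat_mult_left_right_inverse[of "conj_tr q A"]) auto
  hence "conj_tr q (C * conj_tr q A) = 1\<^sub>m n" by simp
  hence AC: "A * conj_tr q C = 1\<^sub>m n"
    using A by (simp add: conj_tr_mult[of C n n _ n])
  have ct: "conj_tr q ?g = four_block_mat (conj_tr q A) (0\<^sub>m n n) (0\<^sub>m n n) (conj_tr q C)"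
    using A by (subst conj_tr_four_block[of _ n n _ n _ n]) auto
  have "?g * J = four_block_mat (0\<^sub>m n n) A C (0\<^sub>m n n)"
    unfolding J using A by (subst block_mult) auto
  hence "?g * J * conj_tr q ?g = four_block_mat (0\<^sub>m n n) (A * conj_tr q C) (C * conj_tr q A) (0\<^sub>m n n)"
    unfolding ct using A by (simp only:) (subst block_mult, auto)
  thus ?thesis
    using A det_four_block_mat_lower_left_zero[of A n "0\<^sub>m n n" n "0\<^sub>m n n" C]
    by (simp add: hyp_isometry_def AC CA flip: J)
qed

text \<open>Commutation is tested on the two families of unitriangular isometries. They force block
  diagonal form with equal blocks, and then a block commuting with every skew-Hermitian
  \<open>S\<close>, which is scalar.\<close>

lemma SU_center_scalar:
  assumes z: "z \<in> group_center (SU N q :: 'a mat monoid)"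
  obtains \<zeta> :: 'a where "z = \<zeta> \<cdot>\<^sub>m 1\<^sub>m N" "\<zeta> * \<zeta> ^ q = 1" "\<zeta> ^ N = 1"
proof -
  have zS: "z \<in> carrier (SU N q)" using z by (simp add: group_center_def)
  hence zc: "z \<in> carrier_mat N N" by (simp add: SU_iff)
  define z' where "z' = B * (z * Bi)"
  have z'c: "z' \<in> carrier_mat N N" using zc by (auto simp: z'_def)
  note asc = assoc_mult_mat[of _ N N _ N _ N]
  have comm: "z' * g = g * z'" if g: "hyp_isometry g" for g
  proof -
    have gc: "g \<in> carrier_mat N N" using g by (simp add: hyp_isometry_def)
    have "z * \<kappa> g = \<kappa> g * z" using z kappa_SU[OF g] by (simp add: group_center_def)
    hence "B * (z * \<kappa> g * Bi) = B * (\<kappa> g * z * Bi)" by simp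
    thus ?thesis using zc gc unfolding \<kappa>_def z'_def by (simp add: asc B_Bi B_Bi_cancel right_mult_one_mat[of _ N N])
  qed
  obtain P Q R T where z'_eq: "z' = four_block_mat P Q R T" and
    c: "P \<in> carrier_mat n n" "Q \<in> carrier_mat n n" "R \<in> carrier_mat n n" "T \<in> carrier_mat n n"
    using four_block_exhaust[OF z'c] .
  have low: "P + Q * S = P" "R + T * S = S * P + R"
    if S: "S \<in> carrier_mat n n" "S + conj_tr q S = 0\<^sub>m n n" for S
  proof -
    have "four_block_mat (P + Q * S) Q (R + T * S) T = z' * four_block_mat (1\<^sub>m n) (0\<^sub>m n n) S (1\<^sub>m n)"
      unfolding z'_eq using S c by (subst block_mult) auto
    also have "\<dots> = four_block_mat (1\<^sub>m n) (0\<^sub>m n n) S (1\<^sub>m n) * z'"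
      by (rule comm[OF hyp_isometry_lower[OF S]])
    also have "\<dots> = four_block_mat P Q (S * P + R) (S * Q + T)"
      unfolding z'_eq using S c by (subst block_mult) auto
    finally have e: "four_block_mat (P + Q * S) Q (R + T * S) T = four_block_mat P Q (S * P + R) (S * Q + T)" .
    show "P + Q * S = P" by (rule four_block_inject(1)[OF e, of n n n n]) (use S c in auto)
    show "R + T * S = S * P + R" by (rule four_block_inject(3)[OF e, of n n n n]) (use S c in auto)
  qed
  have up: "P = P + S * R"
    if S: "S \<in> carrier_mat n n" "S + conj_tr q S = 0\<^sub>m n n" for S
  proof -
    have "four_block_mat P (P * S + Q) R (R * S + T) = z' * four_block_mat (1\<^sub>m n) S (0\<^sub>m n n) (1\<^sub>m n)"
      unfolding z'_eq using S c by (subst block_mult) auto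
    also have "\<dots> = four_block_mat (1\<^sub>m n) S (0\<^sub>m n n) (1\<^sub>m n) * z'"
      by (rule comm[OF hyp_isometry_upper[OF S]])
    also have "\<dots> = four_block_mat (P + S * R) (Q + S * T) R T"
      unfolding z'_eq using S c by (subst block_mult) auto
    finally have e: "four_block_mat P (P * S + Q) R (R * S + T) = four_block_mat (P + S * R) (Q + S * T) R T" .
    show "P = P + S * R" by (rule four_block_inject(1)[OF e, of n n n n]) (use S c in auto)
  qed
  \<comment> \<open>Taking \<open>S\<close> to be a nonzero skew scalar matrix kills both
    off-diagonal blocks and identifies the diagonal ones.\<close>
  obtain \<sigma> :: 'a where sg: "\<sigma> \<noteq> 0" "\<sigma> ^ q = - \<sigma>" using ex_skew by blast
  have sk: "scalar \<sigma> + conj_tr q (scalar \<sigma>) = 0\<^sub>m n n"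
    by (intro eq_matI) (auto simp: conj_tr_smult sg)
  have QS: "M * scalar \<sigma> = \<sigma> \<cdot>\<^sub>m M" "scalar \<sigma> * M = \<sigma> \<cdot>\<^sub>m M" if "M \<in> carrier_mat n n" for M
    using that mult_smult_distrib[of M n n "1\<^sub>m n" n \<sigma>] mult_smult_assoc_mat[of "1\<^sub>m n" n n M n \<sigma>]
    by simp_all
  have Q0: "Q = 0\<^sub>m n n"
  proof (rule eq_matI)
    fix i j assume ij: "i < dim_row (0\<^sub>m n n :: 'a mat)" "j < dim_col (0\<^sub>m n n :: 'a mat)"
    have "(P + \<sigma> \<cdot>\<^sub>m Q) $$ (i, j) = P $$ (i, j)" using low(1)[OF _ sk] c by (simp add: QS)
    thus "Q $$ (i, j) = 0\<^sub>m n n $$ (i, j)" using ij sg c by auto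
  qed (use c in auto)
  have R0: "R = 0\<^sub>m n n"
  proof (rule eq_matI)
    fix i j assume ij: "i < dim_row (0\<^sub>m n n :: 'a mat)" "j < dim_col (0\<^sub>m n n :: 'a mat)"
    have "(P + \<sigma> \<cdot>\<^sub>m R) $$ (i, j) = P $$ (i, j)" using up[OF _ sk] c by (simp add: QS)
    thus "R $$ (i, j) = 0\<^sub>m n n $$ (i, j)" using ij sg c by auto
  qed (use c in auto)
  have TS: "T * S = S * P" if S: "S \<in> carrier_mat n n" "S + conj_tr q S = 0\<^sub>m n n" for S
    using low(2)[OF S] S c by (simp add: R0)
  have TP: "T = P"
  proof (rule eq_matI)
    fix i j assume ij: "i < dim_row P" "j < dim_col P"
    have "(\<sigma> \<cdot>\<^sub>m T) $$ (i, j) = (\<sigma> \<cdot>\<^sub>m P) $$ (i, j)" using TS[OF _ sk] c by (simp add: QS)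
    thus "T $$ (i, j) = P $$ (i, j)" using ij sg c by auto
  qed (use c in auto)
  \<comment> \<open>For \<open>S\<close> with the single entry \<open>\<sigma>\<close> at
    \<open>(i, i)\<close>, entry \<open>(i, j)\<close> of the commutation relation reduces to
    \<open>\<sigma> * P $$ (i, j) = 0\<close>.\<close>
  have off: "P $$ (i, j) = 0" if ij: "i < n" "j < n" "i \<noteq> j" for i j
  proof -
    have "unit_mat n i i \<sigma> + conj_tr q (unit_mat n i i \<sigma>) = 0\<^sub>m n n"
      using q_gt_1 by (intro eq_matI) (auto simp: sg)
    hence "(P * unit_mat n i i \<sigma>) $$ (i, j) = (unit_mat n i i \<sigma> * P) $$ (i, j)"
      using TS[of "unit_mat n i i \<sigma>"] TP by simp
    thus ?thesis using ij sg c by (simp add: unit_mat_mult del: index_mult_mat(1))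
  qed
  have diag: "P $$ (i, i) = P $$ (0, 0)" if i: "i < n" for i
  proof (cases "i = 0")
    case False
    \<comment> \<open>A skew matrix exchanging the indices 0 and \<open>i\<close> up to sign; entry
      \<open>(i, 0)\<close> of the commutation relation compares the two diagonal entries.\<close>
    let ?S = "unit_mat n i 0 1 + unit_mat n 0 i (- 1) :: 'a mat"
    have m1: "(- 1 :: 'a) ^ q = - 1" using bar.hom_uminus[of 1] by simp
    have "?S + conj_tr q ?S = 0\<^sub>m n n"
      using q_gt_1 i False by (intro eq_matI) (auto simp: m1)
    hence eq: "P * ?S = ?S * P" using TS[of ?S] TP by simp
    have "P * ?S = P * unit_mat n i 0 1 + P * unit_mat n 0 i (- 1)"
      by (rule mult_add_distrib_mat[of _ n n _ n]) (use c in auto)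
    moreover have "?S * P = unit_mat n i 0 1 * P + unit_mat n 0 i (- 1) * P"
      by (rule add_mult_distrib_mat[of _ n n _ _ n]) (use c in auto)
    ultimately have "(P * unit_mat n i 0 1 + P * unit_mat n 0 i (- 1)) $$ (i, 0) =
        (unit_mat n i 0 1 * P + unit_mat n 0 i (- 1) * P) $$ (i, 0)"
      using eq by simp
    thus ?thesis using i False c(1) n2 by (simp add: unit_mat_mult del: index_mult_mat(1))
  qed simp
  define \<zeta> where "\<zeta> = P $$ (0, 0)"
  have "P = scalar \<zeta>"
  proof (rule eq_matI)
    fix i j assume ij: "i < dim_row (scalar \<zeta>)" "j < dim_col (scalar \<zeta>)"
    have "P $$ (i, i) = \<zeta>" using diag[of i] ij by (simp add: \<zeta>_def)
    thus "P $$ (i, j) = scalar \<zeta> $$ (i, j)" using ij off[of i j] by (cases "i = j") simp_all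
  qed (use c in auto)
  hence "z' = four_block_mat (scalar \<zeta>) (0\<^sub>m n n) (0\<^sub>m n n) (scalar \<zeta>)"
    by (simp add: z'_eq Q0 R0 TP)
  also have "\<dots> = \<zeta> \<cdot>\<^sub>m four_block_mat (1\<^sub>m n) (0\<^sub>m n n) (0\<^sub>m n n) (1\<^sub>m n)"
    by (subst smult_four_block_mat[of _ n n _ n _ n]) (auto intro!: cong_four_block_mat eq_matI)
  finally have z'z: "z' = \<zeta> \<cdot>\<^sub>m 1\<^sub>m N" by simp
  have "z = Bi * (z' * B)"
    using zc unfolding z'_def by (simp add: asc Bi_B_cancel Bi_B)
  also have "\<dots> = \<zeta> \<cdot>\<^sub>m 1\<^sub>m N"
    unfolding z'z using mult_smult_assoc_mat[of "1\<^sub>m N" N N B N \<zeta>] mult_smult_distrib[of Bi N N B N \<zeta>]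
      left_mult_one_mat[OF frame_carrier(2)]
    by (simp add: Bi_B)
  finally have zeq: "z = \<zeta> \<cdot>\<^sub>m 1\<^sub>m N" .
  have "det z = 1" "z * conj_tr q z = 1\<^sub>m N" using zS by (auto simp: SU_iff)
  hence "\<zeta> ^ N = 1" by (simp add: zeq)
  moreover have "(\<zeta> \<cdot>\<^sub>m 1\<^sub>m N * ((\<zeta> ^ q) \<cdot>\<^sub>m 1\<^sub>m N)) = (\<zeta> * \<zeta> ^ q) \<cdot>\<^sub>m (1\<^sub>m N :: 'a mat)"
    using mult_smult_assoc_mat[of "1\<^sub>m N" N N "(\<zeta> ^ q) \<cdot>\<^sub>m 1\<^sub>m N :: 'a mat" N \<zeta>] by (auto intro!: eq_matI)
  hence "(\<zeta> * \<zeta> ^ q) \<cdot>\<^sub>m (1\<^sub>m N :: 'a mat) = 1\<^sub>m N"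
    using \<open>z * conj_tr q z = 1\<^sub>m N\<close> by (simp add: zeq conj_tr_smult)
  hence "((\<zeta> * \<zeta> ^ q) \<cdot>\<^sub>m (1\<^sub>m N :: 'a mat)) $$ (0, 0) = 1\<^sub>m N $$ (0, 0)" by simp
  hence "\<zeta> * \<zeta> ^ q = 1" using n2 by simp
  ultimately show ?thesis using zeq that by blast
qed

end

section \<open>Action on the first column\<close>

lemma smult_one_mat_mult_vec:
  fixes v :: "'a :: comm_ring_1 vec"
  assumes "v \<in> carrier_vec m"
  shows "(c \<cdot>\<^sub>m 1\<^sub>m m) *\<^sub>v v = c \<cdot>\<^sub>v v"
proof (rule eq_vecI)
  fix i assume i: "i < dim_vec (c \<cdot>\<^sub>v v)"
  have "row (c \<cdot>\<^sub>m 1\<^sub>m m) i = c \<cdot>\<^sub>v unit_vec m i"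
    using i assms by (intro eq_vecI) auto
  thus "((c \<cdot>\<^sub>m 1\<^sub>m m) *\<^sub>v v) $ i = (c \<cdot>\<^sub>v v) $ i"
    using i assms by (simp add: smult_scalar_prod_distrib[of _ m])
qed (use assms in auto)

lemma append_vec_inject:
  assumes "x @\<^sub>v y = x' @\<^sub>v y'" "x \<in> carrier_vec m" "x' \<in> carrier_vec m"
  shows "x = x'" "y = y'"
  using assms append_vec_eq[of x m x' y y'] by auto

lemma block_diag_mult_vec:
  fixes A :: "'a :: comm_ring_1 mat"
  assumes "A \<in> carrier_mat n n" "C \<in> carrier_mat n n" "x \<in> carrier_vec n" "y \<in> carrier_vec n"
  shows "four_block_mat A (0\<^sub>m n n) (0\<^sub>m n n) C *\<^sub>v (x @\<^sub>v y) = (A *\<^sub>v x) @\<^sub>v (C *\<^sub>v y)"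
proof -
  have "0\<^sub>m n n *\<^sub>v y = 0\<^sub>v n" "0\<^sub>m n n *\<^sub>v x = 0\<^sub>v n"
    using assms by (auto intro!: eq_vecI)
  moreover have "A *\<^sub>v x \<in> carrier_vec n" "C *\<^sub>v y \<in> carrier_vec n"
    using assms by (auto intro: mult_mat_vec_carrier)
  ultimately show ?thesis
    using four_block_mat_mult_vec[of A n n "0\<^sub>m n n" n "0\<^sub>m n n" n C x y] assms by simp
qed

lemma block_lower_mult_vec:
  fixes S :: "'a :: comm_ring_1 mat"
  assumes "S \<in> carrier_mat n n" "x \<in> carrier_vec n" "y \<in> carrier_vec n"
  shows "four_block_mat (1\<^sub>m n) (0\<^sub>m n n) S (1\<^sub>m n) *\<^sub>v (x @\<^sub>v y) = x @\<^sub>v (S *\<^sub>v x + y)"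
proof -
  have "0\<^sub>m n n *\<^sub>v y = 0\<^sub>v n" using assms by (auto intro!: eq_vecI)
  thus ?thesis
    using four_block_mat_mult_vec[of "1\<^sub>m n" n n "0\<^sub>m n n" n S n "1\<^sub>m n" x y] assms by simp
qed

section \<open>The stabilizer of the first basis vector\<close>

context hermitian_field
begin

definition emb :: "nat \<Rightarrow> 'a mat \<Rightarrow> 'a mat" where
  "emb m A = four_block_mat (1\<^sub>m 1) (0\<^sub>m 1 m) (0\<^sub>m m 1) A"

lemma emb_carrier [simp]: "A \<in> carrier_mat m m \<Longrightarrow> emb m A \<in> carrier_mat (1 + m) (1 + m)"
  unfolding emb_def by (rule four_block_carrier_mat) auto

lemma emb_mult:
  assumes "A \<in> carrier_mat m m" "C \<in> carrier_mat m m"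
  shows "emb m A * emb m C = emb m (A * C)"
  unfolding emb_def using assms by (subst mult_four_block_mat[of _ 1 1 _ m _ m]) auto

lemma emb_one: "emb m (1\<^sub>m m) = 1\<^sub>m (1 + m)"
  unfolding emb_def by (rule four_block_one_mat)

lemma emb_inject:
  assumes "emb m A = emb m C" "A \<in> carrier_mat m m" "C \<in> carrier_mat m m"
  shows "A = C"
  using assms(1) unfolding emb_def by (rule four_block_inject(4)[of _ _ _ _ _ _ _ _ 1 1 m m]) (use assms in auto)

lemma conj_tr_emb: "A \<in> carrier_mat m m \<Longrightarrow> conj_tr q (emb m A) = emb m (conj_tr q A)"
  unfolding emb_def by (subst conj_tr_four_block[of _ 1 1 _ m _ m]) auto

lemma det_emb: "A \<in> carrier_mat m m \<Longrightarrow> det (emb m A) = det A"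
  unfolding emb_def by (subst det_four_block_mat_lower_left_zero[of _ 1 _ m]) auto

lemma emb_SU_iff:
  assumes "A \<in> carrier_mat m m"
  shows "emb m A \<in> carrier (SU (1 + m) q) \<longleftrightarrow> A \<in> carrier (SU m q)"
proof -
  have "emb m A * conj_tr q (emb m A) = emb m (A * conj_tr q A)"
    using assms by (simp add: conj_tr_emb emb_mult)
  moreover have "emb m (A * conj_tr q A) = 1\<^sub>m (1 + m) \<longleftrightarrow> A * conj_tr q A = 1\<^sub>m m"
    using emb_inject[of m "A * conj_tr q A" "1\<^sub>m m"] emb_one[of m] assms by auto
  ultimately show ?thesis using assms emb_carrier[OF assms] det_emb[OF assms] by (simp add: SU_iff)
qed

lemma emb_fixes:
  assumes "A \<in> carrier_mat m m"
  shows "emb m A *\<^sub>v unit_vec (1 + m) 0 = unit_vec (1 + m) 0"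
  using assms by (subst mat_mult_unit_vec[OF emb_carrier[OF assms]])
    (auto intro!: eq_vecI simp: emb_def)

text \<open>If \<open>g\<close> fixes the vector, so does its inverse, the conjugate transpose.
  Hence both the first column and the first row of \<open>g\<close> are those of the
  identity.\<close>

lemma SU_stabilizer:
  assumes g: "g \<in> carrier (SU (1 + m) q)" and fix_e: "g *\<^sub>v unit_vec (1 + m) 0 = unit_vec (1 + m) 0"
  obtains A where "A \<in> carrier (SU m q)" "g = emb m A"
proof -
  let ?e = "unit_vec (1 + m) 0 :: 'a vec"
  have gc: "g \<in> carrier_mat (1 + m) (1 + m)" using g by (simp add: SU_iff)
  have "conj_tr q g *\<^sub>v ?e = conj_tr q g *\<^sub>v (g *\<^sub>v ?e)" by (simp only: fix_e)
  also have "\<dots> = (conj_tr q g * g) *\<^sub>v ?e"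
    using gc by (intro assoc_mult_mat_vec[symmetric, of _ "1 + m" "1 + m" _ "1 + m"]) auto
  also have "\<dots> = ?e" using SU_conj_tr_left[OF g] by simp
  finally have ct: "conj_tr q g *\<^sub>v ?e = ?e" .
  have col: "g $$ (i, 0) = ?e $ i" if "i < 1 + m" for i
    using arg_cong[OF fix_e, of "\<lambda>v :: 'a vec. v $ i"] mat_mult_unit_vec[OF gc, of 0] that gc by simp
  have row: "g $$ (0, i) = ?e $ i" if i: "i < 1 + m" for i
  proof -
    have "col (conj_tr q g) 0 = ?e"
      using ct mat_mult_unit_vec[of "conj_tr q g" "1 + m" "1 + m" 0] gc by simp
    hence "col (conj_tr q g) 0 $ i = ?e $ i" by simp
    hence "(g $$ (0, i)) ^ q = ?e $ i" using i gc by simp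
    hence "((g $$ (0, i)) ^ q) ^ q = (?e $ i) ^ q" by simp
    thus ?thesis using i q_gt_1 by (auto split: if_splits)
  qed
  obtain P Q R A where g_eq: "g = four_block_mat P Q R A" and
    c: "P \<in> carrier_mat 1 1" "Q \<in> carrier_mat 1 m" "R \<in> carrier_mat m 1" "A \<in> carrier_mat m m"
    using four_block_exhaust[OF gc] .
  have "P = 1\<^sub>m 1" using col[of 0] c by (intro eq_matI) (auto simp: g_eq)
  moreover have "Q = 0\<^sub>m 1 m"
  proof (rule eq_matI)
    fix i j assume "i < dim_row (0\<^sub>m 1 m :: 'a mat)" "j < dim_col (0\<^sub>m 1 m :: 'a mat)"
    thus "Q $$ (i, j) = 0\<^sub>m 1 m $$ (i, j)" using row[of "1 + j"] c by (auto simp: g_eq)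
  qed (use c in auto)
  moreover have "R = 0\<^sub>m m 1"
  proof (rule eq_matI)
    fix i j assume "i < dim_row (0\<^sub>m m 1 :: 'a mat)" "j < dim_col (0\<^sub>m m 1 :: 'a mat)"
    thus "R $$ (i, j) = 0\<^sub>m m 1 $$ (i, j)" using col[of "1 + i"] c by (auto simp: g_eq)
  qed (use c in auto)
  ultimately have "g = emb m A" by (simp add: g_eq emb_def)
  thus ?thesis using that[of A] emb_SU_iff[OF c(4)] g by simp
qed

end

section \<open>First columns in hyperbolic coordinates\<close>

context hyperbolic_frame
begin

lemma B_append:
  assumes "a \<in> carrier_vec n" "b \<in> carrier_vec n"
  shows "B *\<^sub>v (a @\<^sub>v b) = (a + \<alpha> \<cdot>\<^sub>v b) @\<^sub>v ((1 + \<gamma>) \<cdot>\<^sub>v a + (\<gamma> * \<alpha>) \<cdot>\<^sub>v b)"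
  unfolding B_def using assms
  by (subst four_block_mat_mult_vec[of _ n n _ n _ n]) (auto simp: smult_one_mat_mult_vec)

abbreviation e0 :: "'a vec" where "e0 \<equiv> unit_vec n 0"

text \<open>The orbit map of the first basis vector. On the unitary group its fibres are the left
  cosets of the stabilizer, so its values label the transversal to be factorized.\<close>

definition bcol :: "'a mat \<Rightarrow> 'a vec" where "bcol g = B *\<^sub>v (g *\<^sub>v unit_vec N 0)"

text \<open>The base point of the orbit; its second half is the vector \<open>y_0\<close> of the
  starting pair.\<close>

lemma bcol_one: "bcol (1\<^sub>m N) = e0 @\<^sub>v ((1 + \<gamma>) \<cdot>\<^sub>v e0)"
proof -
  have "unit_vec N 0 = e0 @\<^sub>v (0\<^sub>v n :: 'a vec)" using n2 by (intro eq_vecI) auto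
  hence "bcol (1\<^sub>m N) = B *\<^sub>v (e0 @\<^sub>v 0\<^sub>v n)" by (simp add: bcol_def)
  also have "\<dots> = (e0 + \<alpha> \<cdot>\<^sub>v 0\<^sub>v n) @\<^sub>v ((1 + \<gamma>) \<cdot>\<^sub>v e0 + (\<gamma> * \<alpha>) \<cdot>\<^sub>v 0\<^sub>v n)"
    by (rule B_append) auto
  also have "\<dots> = e0 @\<^sub>v ((1 + \<gamma>) \<cdot>\<^sub>v e0)"
    by (intro arg_cong2[of _ _ _ _ append_vec] eq_vecI) auto
  finally show ?thesis .
qed

lemma bcol_kappa_mult:
  assumes "g \<in> carrier_mat N N" "h \<in> carrier_mat N N"
  shows "bcol (\<kappa> g * h) = g *\<^sub>v bcol h"
proof -
  let ?e = "unit_vec N 0 :: 'a vec"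
  have he: "h *\<^sub>v ?e \<in> carrier_vec N" using assms by (intro mult_mat_vec_carrier) auto
  have "bcol (\<kappa> g * h) = B *\<^sub>v (\<kappa> g *\<^sub>v (h *\<^sub>v ?e))"
    unfolding bcol_def using assms by (subst assoc_mult_mat_vec[of _ N N _ N]) auto
  also have "\<dots> = (B * \<kappa> g) *\<^sub>v (h *\<^sub>v ?e)"
    using assms he by (intro assoc_mult_mat_vec[symmetric, of _ N N _ N]) auto
  also have "\<dots> = (g * B) *\<^sub>v (h *\<^sub>v ?e)" using assms by (simp add: B_kappa)
  also have "\<dots> = g *\<^sub>v bcol h"
    unfolding bcol_def using assms he by (intro assoc_mult_mat_vec[of _ N N _ N]) auto
  finally show ?thesis .
qed

lemma bcol_kappa: "g \<in> carrier_mat N N \<Longrightarrow> bcol (\<kappa> g) = g *\<^sub>v bcol (1\<^sub>m N)"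
  using bcol_kappa_mult[of g "1\<^sub>m N"] right_mult_one_mat[OF kappa_carrier, of g] by simp

lemma bcol_mult_fixed:
  assumes "g \<in> carrier_mat N N" "h \<in> carrier_mat N N" "h *\<^sub>v unit_vec N 0 = unit_vec N 0"
  shows "bcol (g * h) = bcol g"
proof -
  have "(g * h) *\<^sub>v unit_vec N 0 = g *\<^sub>v unit_vec N 0"
    using assms assoc_mult_mat_vec[of g N N h N "unit_vec N 0"] by simp
  thus ?thesis by (simp add: bcol_def)
qed

text \<open>Invertibility of \<open>B\<close> turns equal labels into equal first columns, and
  \<open>conj_tr q g\<close> is inverse to \<open>g\<close>.\<close>

lemma bcol_eq_imp_fixed:
  assumes g: "g \<in> carrier (SU N q)" and h: "h \<in> carrier (SU N q)" and eq: "bcol g = bcol h"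
  shows "(conj_tr q g * h) *\<^sub>v unit_vec N 0 = unit_vec N 0"
proof -
  let ?e = "unit_vec N 0 :: 'a vec"
  have c: "g \<in> carrier_mat N N" "h \<in> carrier_mat N N" using g h by (auto simp: SU_iff)
  have Bi_bcol: "Bi *\<^sub>v bcol f = f *\<^sub>v ?e" if "f \<in> carrier_mat N N" for f
  proof -
    have fe: "f *\<^sub>v ?e \<in> carrier_vec N" using that by (intro mult_mat_vec_carrier) auto
    have "Bi *\<^sub>v bcol f = (Bi * B) *\<^sub>v (f *\<^sub>v ?e)"
      unfolding bcol_def using fe by (intro assoc_mult_mat_vec[symmetric, of _ N N _ N]) auto
    thus ?thesis using fe by (simp add: Bi_B)
  qed
  have ge: "g *\<^sub>v ?e = h *\<^sub>v ?e" using eq Bi_bcol c by metis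
  have "(conj_tr q g * h) *\<^sub>v ?e = conj_tr q g *\<^sub>v (g *\<^sub>v ?e)"
    unfolding ge using c by (intro assoc_mult_mat_vec[of _ N N _ N]) auto
  also have "\<dots> = (conj_tr q g * g) *\<^sub>v ?e"
    using c by (intro assoc_mult_mat_vec[symmetric, of _ N N _ N]) auto
  also have "\<dots> = ?e" using SU_conj_tr_left[OF g] by simp
  finally show ?thesis .
qed

text \<open>Coordinatewise form of the identity \<open>conj_tr q B * J * B = 1\<close>, which
  translates the standard length of a vector into hyperbolic coordinates.\<close>

lemma hyperbolic_form:
  assumes "x = a + \<alpha> * b" "y = (1 + \<gamma>) * a + \<gamma> * \<alpha> * b"
  shows "x ^ q * y + y ^ q * x = a ^ q * a + b ^ q * b"
proof -
  define a' b' \<alpha>' where "a' = a ^ q" and "b' = b ^ q" and "\<alpha>' = \<alpha> ^ q"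
  have g: "\<gamma> ^ q = - 1 - \<gamma>" using gamma by (simp add: eq_diff_eq add.commute)
  have al: "\<alpha> * \<alpha>' = - 1" using alpha by (simp add: \<alpha>'_def)
  have x': "x ^ q = a' + \<alpha>' * b'"
    by (simp add: assms(1) a'_def b'_def \<alpha>'_def bar_add power_mult_distrib)
  have y': "y ^ q = - \<gamma> * a' + (- 1 - \<gamma>) * \<alpha>' * b'"
    by (simp add: assms(2) a'_def b'_def \<alpha>'_def bar_add power_mult_distrib g)
  have "x ^ q * y + y ^ q * x = a' * a - (\<alpha> * \<alpha>') * (b' * b)"
    unfolding x' y' unfolding assms by (simp add: algebra_simps)
  thus ?thesis by (simp add: al a'_def b'_def)
qed

lemma SU_bcol:
  assumes g: "g \<in> carrier (SU N q)"
  obtains x y :: "'a vec" where "bcol g = x @\<^sub>v y" "x \<in> carrier_vec n" "y \<in> carrier_vec n"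
    "(\<Sum>i<n. (x $ i) ^ q * y $ i + (y $ i) ^ q * x $ i) = 1"
proof -
  have gc: "g \<in> carrier_mat N N" using g by (simp add: SU_iff)
  have col: "g *\<^sub>v unit_vec N 0 = col g 0" using mat_mult_unit_vec[OF gc, of 0] n2 by simp
  obtain a b where ab: "col g 0 = a @\<^sub>v b" "a \<in> carrier_vec n" "b \<in> carrier_vec n"
    using append_vec_exhaust[of "col g 0" n n] gc by (metis col_dim carrier_matD(1))
  define x where "x = a + \<alpha> \<cdot>\<^sub>v b"
  define y where "y = (1 + \<gamma>) \<cdot>\<^sub>v a + (\<gamma> * \<alpha>) \<cdot>\<^sub>v b"
  have "bcol g = x @\<^sub>v y"
    unfolding bcol_def col ab(1) x_def y_def using ab by (intro B_append)
  moreover have "x \<in> carrier_vec n" "y \<in> carrier_vec n" using ab by (auto simp: x_def y_def)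
  moreover have "(\<Sum>i<n. (x $ i) ^ q * y $ i + (y $ i) ^ q * x $ i) = 1"
  proof -
    have split: "(\<Sum>i<n + m. f i) = (\<Sum>i<n. f i) + (\<Sum>i<m. f (n + i))" for f :: "nat \<Rightarrow> 'a" and m
      by (induction m) (auto simp: add_ac)
    \<comment> \<open>The corner entry says that the first column of \<open>g\<close> has length
      1.\<close>
    have "1 = (conj_tr q g * g) $$ (0, 0)" using SU_conj_tr_left[OF g] n2 by simp
    also have "\<dots> = (\<Sum>i<N. (g $$ (i, 0)) ^ q * g $$ (i, 0))"
      using gc n2 by (simp add: scalar_prod_def atLeast0LessThan)
    also have "\<dots> = (\<Sum>i<N. (col g 0 $ i) ^ q * col g 0 $ i)"
      using gc n2 by (intro sum.cong) auto
    also have "\<dots> = (\<Sum>i<n. (a $ i) ^ q * a $ i + (b $ i) ^ q * b $ i)"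
      unfolding split ab(1) using ab by (simp add: sum.distrib)
    also have "\<dots> = (\<Sum>i<n. (x $ i) ^ q * y $ i + (y $ i) ^ q * x $ i)"
    proof (intro sum.cong refl)
      fix i assume "i \<in> {..<n}"
      thus "(a $ i) ^ q * a $ i + (b $ i) ^ q * b $ i = (x $ i) ^ q * y $ i + (y $ i) ^ q * x $ i"
        using ab by (intro hyperbolic_form[symmetric]) (auto simp: x_def y_def)
    qed
    finally show ?thesis by simp
  qed
  ultimately show ?thesis using that by blast
qed

text \<open>In a pair \<open>(A, C)\<close> the matrix \<open>C\<close> is the inverse of the
  conjugate transpose of \<open>A\<close>. Carrying it along avoids matrix inversion, and the monoid
  laws suffice for factorizing subsets.\<close>

definition levi :: "('a mat \<times> 'a mat) monoid" where
  "levi = \<lparr>carrier = {(A, C). A \<in> carrier_mat n n \<and> C \<in> carrier_mat n n \<and>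
      conj_tr q A * C = 1\<^sub>m n \<and> det A * det C = 1},
    monoid.mult = (\<lambda>(A, C) (A', C'). (A * A', C * C')), one = (1\<^sub>m n, 1\<^sub>m n)\<rparr>"

lemma levi_iff: "(A, C) \<in> carrier levi \<longleftrightarrow> A \<in> carrier_mat n n \<and> C \<in> carrier_mat n n \<and>
    conj_tr q A * C = 1\<^sub>m n \<and> det A * det C = 1"
  by (simp add: levi_def)

lemma levi_mult [simp]: "(A, C) \<otimes>\<^bsub>levi\<^esub> (A', C') = (A * A', C * C')"
  by (simp add: levi_def)

lemma levi_one [simp]: "\<one>\<^bsub>levi\<^esub> = (1\<^sub>m n, 1\<^sub>m n)"
  by (simp add: levi_def)

lemma conj_tr_pair_mult:
  assumes "A \<in> carrier_mat n n" "C \<in> carrier_mat n n" "A' \<in> carrier_mat n n" "C' \<in> carrier_mat n n"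
    "conj_tr q A * C = 1\<^sub>m n" "conj_tr q A' * C' = (1\<^sub>m n :: 'a mat)"
  shows "conj_tr q (A * A') * (C * C') = 1\<^sub>m n"
proof -
  have "conj_tr q (A * A') * (C * C') = conj_tr q A' * ((conj_tr q A * C) * C')"
    using assms(1-4) by (simp add: conj_tr_mult[of A n n A' n] assoc_mult_mat[of _ n n _ n _ n])
  thus ?thesis using assms by simp
qed

lemma monoid_levi: "Group.monoid levi"
proof (rule monoidI)
  fix g h assume gh: "g \<in> carrier levi" "h \<in> carrier levi"
  obtain A C A' C' where e: "g = (A, C)" "h = (A', C')" by (cases g, cases h) auto
  have "det (A * A') * det (C * C') = (det A * det C) * (det A' * det C')"
    using gh by (simp add: e levi_iff det_mult[of _ n] mult_ac)
  thus "g \<otimes>\<^bsub>levi\<^esub> h \<in> carrier levi"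
    using gh conj_tr_pair_mult[of A C A' C'] by (simp add: e levi_iff)
qed (auto simp: levi_iff levi_def assoc_mult_mat[of _ n n _ n _ n])

sublocale levi: Group.monoid levi by (rule monoid_levi)

definition lev :: "'a mat \<times> 'a mat \<Rightarrow> 'a mat" where
  "lev g = \<kappa> (four_block_mat (fst g) (0\<^sub>m n n) (0\<^sub>m n n) (snd g))"

lemma lev_SU: "g \<in> carrier levi \<Longrightarrow> lev g \<in> carrier (SU N q)"
  unfolding lev_def by (cases g) (auto simp: levi_iff intro!: kappa_SU hyp_isometry_diag)

lemma lev_mult:
  assumes "A \<in> carrier_mat n n" "C \<in> carrier_mat n n" "A' \<in> carrier_mat n n" "C' \<in> carrier_mat n n"
  shows "lev (A, C) * lev (A', C') = lev (A * A', C * C')"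
proof -
  have "four_block_mat A (0\<^sub>m n n) (0\<^sub>m n n) C * four_block_mat A' (0\<^sub>m n n) (0\<^sub>m n n) C' =
      four_block_mat (A * A') (0\<^sub>m n n) (0\<^sub>m n n) (C * C')"
    using assms by (subst block_mult) auto
  thus ?thesis using assms by (simp add: lev_def kappa_mult)
qed

lemma lev_hom: "lev \<in> hom levi (SU N q)"
proof (rule homI)
  fix g h assume "g \<in> carrier levi" "h \<in> carrier levi"
  thus "lev (g \<otimes>\<^bsub>levi\<^esub> h) = lev g \<otimes>\<^bsub>SU N q\<^esub> lev h"
    by (cases g; cases h) (simp add: levi_iff lev_mult)
qed (rule lev_SU)

lemma lev_one: "lev (1\<^sub>m n, 1\<^sub>m n) = 1\<^sub>m N"
  by (simp add: lev_def kappa_one)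

lemma bcol_lev_mult:
  assumes "A \<in> carrier_mat n n" "C \<in> carrier_mat n n" "h \<in> carrier_mat N N"
    "bcol h = x @\<^sub>v y" "x \<in> carrier_vec n" "y \<in> carrier_vec n"
  shows "bcol (lev (A, C) * h) = (A *\<^sub>v x) @\<^sub>v (C *\<^sub>v y)"
  using assms by (simp add: lev_def bcol_kappa_mult block_diag_mult_vec)

text \<open>The first column is free and the first row is forced by skew-Hermitian symmetry. The
  corner belongs to both, which is why \<open>skew_vecs\<close> asks for trace zero at index
  0.\<close>

definition skew_mat :: "'a vec \<Rightarrow> 'a mat" where
  "skew_mat c = mat n n (\<lambda>(i, j). if j = 0 then c $ i else if i = 0 then - ((c $ j) ^ q) else 0)"

definition skew_vecs :: "'a vec set" where
  "skew_vecs = {c \<in> carrier_vec n. c $ 0 + (c $ 0) ^ q = 0}"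

definition unip :: "'a vec \<Rightarrow> 'a mat" where
  "unip c = \<kappa> (four_block_mat (1\<^sub>m n) (0\<^sub>m n n) (skew_mat c) (1\<^sub>m n))"

lemma skew_mat_carrier [simp]: "skew_mat c \<in> carrier_mat n n"
  by (simp add: skew_mat_def)

lemma unip_SU:
  assumes "c \<in> skew_vecs"
  shows "unip c \<in> carrier (SU N q)"
proof -
  have u: "(- ((c $ j) ^ q)) ^ q = - (c $ j)" for j using bar.hom_uminus[of "(c $ j) ^ q"] by simp
  have "skew_mat c + conj_tr q (skew_mat c) = 0\<^sub>m n n"
  proof (rule eq_matI)
    fix i j assume "i < dim_row (0\<^sub>m n n :: 'a mat)" "j < dim_col (0\<^sub>m n n :: 'a mat)"
    thus "(skew_mat c + conj_tr q (skew_mat c)) $$ (i, j) = 0\<^sub>m n n $$ (i, j)"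
      using assms q_gt_1 by (auto simp: skew_mat_def skew_vecs_def u)
  qed (auto simp: skew_mat_def)
  thus ?thesis unfolding unip_def by (intro kappa_SU hyp_isometry_lower) auto
qed

lemma skew_vecs_add: "c \<in> skew_vecs \<Longrightarrow> d \<in> skew_vecs \<Longrightarrow> c + d \<in> skew_vecs"
  using n2 by (auto simp: skew_vecs_def bar_add) (metis add.assoc add.commute add.right_neutral)

text \<open>Block unitriangular matrices multiply by adding their corner blocks; this makes the
  unipotent isometries an abelian group.\<close>

lemma unip_mult:
  assumes "c \<in> skew_vecs" "d \<in> skew_vecs"
  shows "unip c * unip d = unip (c + d)"
proof -
  have "skew_mat c + skew_mat d = skew_mat (c + d)"
    using assms by (intro eq_matI) (auto simp: skew_mat_def skew_vecs_def bar_add)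
  moreover have "four_block_mat (1\<^sub>m n) (0\<^sub>m n n) S (1\<^sub>m n) * four_block_mat (1\<^sub>m n) (0\<^sub>m n n) T (1\<^sub>m n) =
      four_block_mat (1\<^sub>m n) (0\<^sub>m n n) (S + T) (1\<^sub>m n)"
    if "S \<in> carrier_mat n n" "T \<in> carrier_mat n n" for S T :: "'a mat"
    using that by (subst block_mult) auto
  ultimately show ?thesis by (simp add: unip_def kappa_mult)
qed

lemma unip_zero: "0\<^sub>v n \<in> skew_vecs" "unip (0\<^sub>v n) = 1\<^sub>m N"
proof -
  show "0\<^sub>v n \<in> skew_vecs" using n2 q_gt_1 by (auto simp: skew_vecs_def)
  have "skew_mat (0\<^sub>v n) = 0\<^sub>m n n"
    using q_gt_1 by (intro eq_matI) (auto simp: skew_mat_def)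
  thus "unip (0\<^sub>v n) = 1\<^sub>m N" by (simp add: unip_def kappa_one)
qed

text \<open>The first column of \<open>skew_mat c\<close> is \<open>c\<close>, so the parameter can
  be read off from the image of the base point.\<close>

lemma bcol_unip:
  assumes "c \<in> skew_vecs"
  shows "bcol (unip c) = e0 @\<^sub>v (c + (1 + \<gamma>) \<cdot>\<^sub>v e0)"
proof -
  have "skew_mat c *\<^sub>v e0 = c"
    using assms n2 mat_mult_unit_vec[OF skew_mat_carrier, of 0 c]
    by (auto intro!: eq_vecI simp: skew_mat_def skew_vecs_def)
  thus ?thesis unfolding unip_def
    by (subst bcol_kappa) (auto simp: bcol_one block_lower_mult_vec)
qed

end

section \<open>A transversal in the Levi factor\<close>

lemma det_pow_mat:
  fixes A :: "'a :: comm_ring_1 mat"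
  assumes "A \<in> carrier_mat m m"
  shows "det (A ^\<^sub>m a) = det A ^ a"
  using assms by (induction a) (auto simp: det_mult[of _ m] mult.commute)

text \<open>Serves to prescribe a scalar on the first basis vector with the inverse scalar on the
  last, as in \<open>rho\<close>, or to adjust a determinant while fixing the first
  \<open>n - 1\<close> basis vectors, as in \<open>corr\<close>.\<close>

definition corner_diag :: "nat \<Rightarrow> 'a :: comm_ring_1 \<Rightarrow> 'a \<Rightarrow> 'a mat" where
  "corner_diag n x z = mat n n (\<lambda>(i, j). if i = j then if i = 0 then x else if i = n - 1 then z else 1 else 0)"

lemma corner_diag_carrier [simp]: "corner_diag n x z \<in> carrier_mat n n"
  by (simp add: corner_diag_def)

lemma dim_corner_diag [simp]: "dim_row (corner_diag n x z) = n" "dim_col (corner_diag n x z) = n"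
  by (simp_all add: corner_diag_def)

lemma corner_diag_one: "corner_diag n 1 1 = 1\<^sub>m n"
  by (intro eq_matI) (auto simp: corner_diag_def)

lemma corner_diag_mult_vec:
  assumes "i < n"
  shows "corner_diag n x z *\<^sub>v unit_vec n i = (if i = 0 then x else if i = n - 1 then z else 1) \<cdot>\<^sub>v unit_vec n i"
  using assms by (subst mat_mult_unit_vec[OF corner_diag_carrier]) (auto intro!: eq_vecI simp: corner_diag_def)

lemma corner_diag_mult: "corner_diag n x z * corner_diag n x' z' = corner_diag n (x * x') (z * z')"
proof (rule mat_eq_if_mult_unit_vec[of _ n n])
  fix i assume i: "i < n"
  let ?f = "\<lambda>x z. if i = 0 then x else if i = n - 1 then z else 1"
  have "(corner_diag n x z * corner_diag n x' z') *\<^sub>v unit_vec n i =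
      corner_diag n x z *\<^sub>v (corner_diag n x' z' *\<^sub>v unit_vec n i)"
    by (rule assoc_mult_mat_vec[of _ n n _ n]) auto
  also have "\<dots> = corner_diag n x z *\<^sub>v (?f x' z' \<cdot>\<^sub>v unit_vec n i)"
    using i by (simp only: corner_diag_mult_vec)
  also have "\<dots> = ?f x' z' \<cdot>\<^sub>v (corner_diag n x z *\<^sub>v unit_vec n i)"
    by (intro eq_vecI) (auto simp: corner_diag_def)
  also have "\<dots> = corner_diag n (x * x') (z * z') *\<^sub>v unit_vec n i"
    using i by (simp add: corner_diag_mult_vec smult_smult_assoc mult.commute)
  finally show "(corner_diag n x z * corner_diag n x' z') *\<^sub>v unit_vec n i =
    corner_diag n (x * x') (z * z') *\<^sub>v unit_vec n i" .
qed auto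

lemma det_corner_diag:
  assumes "n \<ge> 2"
  shows "det (corner_diag n x z) = x * z"
proof -
  have "upper_triangular (corner_diag n x z)" by (auto simp: corner_diag_def upper_triangular_def)
  hence "det (corner_diag n x z) = (\<Prod>i = 0..<n. corner_diag n x z $$ (i, i))"
    using det_upper_triangular[of "corner_diag n x z" n] by (simp add: prod_list_diag_prod)
  also have "\<dots> = (\<Prod>i = 0..<n. if i = 0 then x else if i = n - 1 then z else 1)"
    by (intro prod.cong) (auto simp: corner_diag_def)
  also have "\<dots> = (\<Prod>i\<in>{0, n - 1}. if i = 0 then x else if i = n - 1 then z else 1)"
    using assms by (intro prod.mono_neutral_right) auto
  also have "\<dots> = x * z" using assms by auto
  finally show ?thesis .
qed

section \<open>Powers of the Singer cycle\<close>

locale singer_frame = hyperbolic_frame q p k field_type n \<alpha> \<gamma>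
  for q p k :: nat and field_type :: "'a :: {field, finite} itself" and n :: nat and \<alpha> \<gamma> :: 'a +
  fixes s :: "'a mat" and y :: 'a
  assumes s_carrier [simp]: "s \<in> carrier_mat n n"
    and s_unit: "\<And>a. a < n \<Longrightarrow> (s ^\<^sub>m a) *\<^sub>v unit_vec n 0 = unit_vec n a"
    and s_surj: "\<And>v. v \<in> carrier_vec n \<Longrightarrow> v \<noteq> 0\<^sub>v n \<Longrightarrow> \<exists>a. (s ^\<^sub>m a) *\<^sub>v unit_vec n 0 = v"
    and s_eq_iff: "\<And>a b. (s ^\<^sub>m a) *\<^sub>v unit_vec n 0 = (s ^\<^sub>m b) *\<^sub>v unit_vec n 0 \<longleftrightarrow>
      a mod ((q ^ 2) ^ n - 1) = b mod ((q ^ 2) ^ n - 1)"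
    and s_scalar: "(s ^\<^sub>m (\<Sum>i<n. (q ^ 2) ^ i)) *\<^sub>v unit_vec n 0 = y \<cdot>\<^sub>v unit_vec n 0"
begin

text \<open>The order of the Singer cycle; \<open>idx\<close> below is the index of the scalars in
  the group it generates, with \<open>ord_s = (q ^ 2 - 1) * idx\<close>.\<close>

abbreviation "ord_s \<equiv> (q ^ 2) ^ n - 1"
abbreviation "idx \<equiv> \<Sum>i<n. (q ^ 2) ^ i"

lemma dim_s [simp]: "dim_row s = n" "dim_col s = n"
  using s_carrier by (auto simp del: s_carrier)

lemma e0_carrier [simp]: "e0 \<in> carrier_vec n" by simp

lemma q2: "q ^ 2 - 1 = (q - 1) * (q + 1)"
  using q_gt_1 by (simp add: power2_eq_square algebra_simps)

lemma ord_s_eq: "ord_s = (q - 1) * (q + 1) * idx"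
proof -
  have "(q ^ 2 - 1) * idx + 1 = (q ^ 2) ^ n"
    using q_gt_1 by (intro geometric_sum_nat) simp
  thus ?thesis unfolding q2 by linarith
qed

lemma idx_pos: "idx > 0"
proof -
  have "(q ^ 2) ^ 0 \<le> idx" using n2 q_gt_1 by (intro member_le_sum) auto
  thus ?thesis by simp
qed

lemma ord_s_pos: "ord_s > 0"
  unfolding ord_s_eq using idx_pos q_gt_1 by simp

text \<open>Modulo \<open>q + 1\<close> the square of \<open>q\<close> is 1, so each of the
  \<open>n\<close> summands is 1. This ties the scalars to the gcd of \<open>n\<close> and
  \<open>q + 1\<close>.\<close>

lemma idx_cong: "[idx = n] (mod (q + 1))"
proof -
  have "0 < q ^ 2" using q_gt_1 by simp
  hence "q ^ 2 = (q - 1) * (q + 1) + 1" using q2 by linarith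
  hence "[q ^ 2 = 1] (mod (q + 1))" by (simp only: cong_def mod_mult_self3)
  hence "[(q ^ 2) ^ i = 1 ^ i] (mod (q + 1))" for i by (rule cong_pow)
  hence "[idx = (\<Sum>i<n. 1 ^ i)] (mod (q + 1))" by (intro cong_sum)
  thus ?thesis by simp
qed

lemma s_pow_carrier [simp]: "s ^\<^sub>m a \<in> carrier_mat n n"
  by (rule pow_carrier_mat) simp

lemma s_pow_add_e0: "(s ^\<^sub>m (a + b)) *\<^sub>v e0 = (s ^\<^sub>m a) *\<^sub>v ((s ^\<^sub>m b) *\<^sub>v e0)"
  by (rule pow_mat_mult_vec[of _ n]) auto

text \<open>The basis vectors are images of \<open>e0\<close> under powers of \<open>s\<close>, and
  these powers commute, so a power is determined by its effect on \<open>e0\<close>.\<close>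

lemma s_pow_eqI:
  assumes "a mod ord_s = b mod ord_s"
  shows "s ^\<^sub>m a = s ^\<^sub>m b"
proof (rule mat_eq_if_mult_unit_vec[of _ n n])
  fix i assume i: "i < n"
  have "(a + i) mod ord_s = (b + i) mod ord_s" using assms by (metis mod_add_left_eq)
  hence "(s ^\<^sub>m (a + i)) *\<^sub>v e0 = (s ^\<^sub>m (b + i)) *\<^sub>v e0" by (simp only: s_eq_iff)
  thus "(s ^\<^sub>m a) *\<^sub>v unit_vec n i = (s ^\<^sub>m b) *\<^sub>v unit_vec n i"
    unfolding s_pow_add_e0 s_unit[OF i] .
qed auto

lemma s_pow_ord: "s ^\<^sub>m ord_s = 1\<^sub>m n"
  using s_pow_eqI[of ord_s 0] s_carrier by simp

lemma s_pow_scalarI: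
  assumes "(s ^\<^sub>m a) *\<^sub>v e0 = \<zeta> \<cdot>\<^sub>v e0"
  shows "s ^\<^sub>m a = \<zeta> \<cdot>\<^sub>m 1\<^sub>m n"
proof (rule mat_eq_if_mult_unit_vec[of _ n n])
  fix i assume i: "i < n"
  have "(s ^\<^sub>m a) *\<^sub>v unit_vec n i = (s ^\<^sub>m (a + i)) *\<^sub>v e0"
    by (simp only: s_pow_add_e0 s_unit[OF i])
  also have "\<dots> = (s ^\<^sub>m i) *\<^sub>v ((s ^\<^sub>m a) *\<^sub>v e0)"
    unfolding add.commute[of a i] by (rule s_pow_add_e0)
  also have "\<dots> = \<zeta> \<cdot>\<^sub>v unit_vec n i"
    unfolding assms using mult_mat_vec[OF s_pow_carrier e0_carrier] by (simp add: s_unit[OF i])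
  finally show "(s ^\<^sub>m a) *\<^sub>v unit_vec n i = (\<zeta> \<cdot>\<^sub>m 1\<^sub>m n) *\<^sub>v unit_vec n i"
    by (simp add: smult_one_mat_mult_vec)
qed auto

lemma s_pow_times_e0:
  assumes "(s ^\<^sub>m a) *\<^sub>v e0 = \<zeta> \<cdot>\<^sub>v e0"
  shows "(s ^\<^sub>m (a * t)) *\<^sub>v e0 = \<zeta> ^ t \<cdot>\<^sub>v e0"
proof (induction t)
  case 0
  show ?case using s_carrier by simp
next
  case (Suc t)
  have "(s ^\<^sub>m (a * Suc t)) *\<^sub>v e0 = (s ^\<^sub>m a) *\<^sub>v (\<zeta> ^ t \<cdot>\<^sub>v e0)"
    using s_pow_add_e0[of a "a * t"] Suc by simp
  thus ?case
    using mult_mat_vec[OF s_pow_carrier e0_carrier] assms by (simp add: smult_smult_assoc mult.commute)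
qed

lemma scalar_e0_inj:
  fixes c d :: 'a
  assumes "c \<cdot>\<^sub>v e0 = d \<cdot>\<^sub>v e0"
  shows "c = d"
proof -
  have "(c \<cdot>\<^sub>v e0) $ 0 = (d \<cdot>\<^sub>v e0) $ 0" by (simp only: assms)
  thus ?thesis using n2 by simp
qed

text \<open>Write the scalar as the power of \<open>s\<close> with exponent \<open>v\<close>. The
  norm condition gives \<open>v = (q - 1) * idx * m\<close>, the determinant condition gives
  \<open>q + 1 dvd m * N\<close>. Modulo \<open>q + 1\<close>, \<open>idx\<close> is
  \<open>n\<close> and \<open>q - 1\<close> is -2, so \<open>v\<close> vanishes.\<close>

lemma scalar_is_s_pow:
  assumes z: "\<zeta> * \<zeta> ^ q = 1" "\<zeta> ^ N = 1"
  obtains l where "s ^\<^sub>m ((q + 1) * l) = \<zeta> \<cdot>\<^sub>m 1\<^sub>m n"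
proof -
  have "\<zeta> \<noteq> 0" using z by auto
  have "(\<zeta> \<cdot>\<^sub>v e0) $ 0 = \<zeta>" "(0\<^sub>v n :: 'a vec) $ 0 = 0" using n2 by simp_all
  hence "\<zeta> \<cdot>\<^sub>v e0 \<noteq> 0\<^sub>v n" using \<open>\<zeta> \<noteq> 0\<close> by metis
  then obtain v where v: "(s ^\<^sub>m v) *\<^sub>v e0 = \<zeta> \<cdot>\<^sub>v e0" using s_surj[of "\<zeta> \<cdot>\<^sub>v e0"] by auto
  have dvd: "ord_s dvd v * t" if "\<zeta> ^ t = 1" for t
  proof -
    have "(s ^\<^sub>m (v * t)) *\<^sub>v e0 = (s ^\<^sub>m 0) *\<^sub>v e0"
      using s_pow_times_e0[OF v, of t] that s_carrier by simp
    thus ?thesis unfolding s_eq_iff by (simp add: mod_eq_0_iff_dvd)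
  qed
  have d1: "ord_s dvd v * (q + 1)" using dvd[of "q + 1"] z(1) by simp
  hence "(q - 1) * (q + 1) * idx dvd v * (q + 1)" by (simp only: ord_s_eq)
  hence "(q + 1) * ((q - 1) * idx) dvd (q + 1) * v" by (simp only: mult_ac)
  hence "q + 1 = 0 \<or> (q - 1) * idx dvd v" by (simp only: nat_mult_dvd_cancel_disj)
  hence "(q - 1) * idx dvd v" by linarith
  then obtain m where m: "v = (q - 1) * idx * m" by (elim dvdE)
  have "ord_s dvd v * N" using dvd[OF z(2)] .
  hence "((q - 1) * idx) * (q + 1) dvd ((q - 1) * idx) * (m * N)"
    unfolding ord_s_eq m by (simp only: mult_ac)
  hence "(q - 1) * idx = 0 \<or> q + 1 dvd m * N" by (simp only: nat_mult_dvd_cancel_disj)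
  moreover have "(q - 1) * idx > 0" using idx_pos q_gt_1 by (intro mult_pos_pos) linarith+
  ultimately have d2: "q + 1 dvd m * N" by linarith
  have "[(q - 1) * idx * m = (q - 1) * n * m] (mod (q + 1))"
    using idx_cong by (intro cong_mult cong_refl)
  moreover have "q + 1 dvd (q - 1) * n * m"
  proof -
    \<comment> \<open>The congruence of \<open>q - 1\<close> with -2 is expressed without negative
      numbers by adding \<open>m * N\<close>.\<close>
    have "(q - 1) * n * m + m * N = (q + 1) * (n * m)"
      using q_gt_1 by (cases q) (auto simp: algebra_simps)
    thus ?thesis using d2 by (metis dvd_add_left_iff dvd_triv_left)
  qed
  ultimately have "q + 1 dvd v" unfolding m by (metis cong_dvd_iff)
  then obtain l where "v = (q + 1) * l" by (elim dvdE)
  thus ?thesis using s_pow_scalarI[OF v] that by blast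
qed

text \<open>As \<open>s\<close> has order \<open>ord_s\<close>, the inner power is the inverse of
  \<open>s\<close>, so \<open>s'\<close> is the second component belonging to
  \<open>s\<close>.\<close>

definition s' :: "'a mat" where "s' = conj_tr q (s ^\<^sub>m (ord_s - 1))"

lemma s'_carrier [simp]: "s' \<in> carrier_mat n n" "s' ^\<^sub>m a \<in> carrier_mat n n"
  by (auto simp: s'_def)

lemma dim_s' [simp]: "dim_row s' = n" "dim_col s' = n"
  by (simp_all add: s'_def)

lemma conj_tr_s_pow: "conj_tr q (s ^\<^sub>m a) * s' ^\<^sub>m a = 1\<^sub>m n"
proof (induction a)
  case 0
  show ?case using s_carrier s'_carrier(1) by simp
next
  case (Suc a)
  have "conj_tr q s * s' = conj_tr q (s ^\<^sub>m (ord_s - 1) * s)"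
    unfolding s'_def by (rule conj_tr_mult[symmetric, of _ n n _ n]) auto
  also have "s ^\<^sub>m (ord_s - 1) * s = s ^\<^sub>m Suc (ord_s - 1)" by simp
  also have "Suc (ord_s - 1) = ord_s" using ord_s_pos by (rule Suc_diff_1)
  also have "s ^\<^sub>m ord_s = 1\<^sub>m n" by (rule s_pow_ord)
  finally have "conj_tr q s * s' = 1\<^sub>m n" by simp
  thus ?case using Suc conj_tr_pair_mult[of "s ^\<^sub>m a" "s' ^\<^sub>m a" s s'] by simp
qed

lemma s'_pow_unique:
  assumes "A \<in> carrier_mat n n" "conj_tr q (s ^\<^sub>m a) * A = 1\<^sub>m n"
  shows "s' ^\<^sub>m a = A"
proof -
  have inv: "A * conj_tr q (s ^\<^sub>m a) = 1\<^sub>m n"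
    using assms by (intro mat_mult_left_right_inverse[of "conj_tr q (s ^\<^sub>m a)"]) auto
  have "A = A * (conj_tr q (s ^\<^sub>m a) * s' ^\<^sub>m a)" using assms by (simp add: conj_tr_s_pow)
  also have "\<dots> = (A * conj_tr q (s ^\<^sub>m a)) * s' ^\<^sub>m a"
    using assms by (intro assoc_mult_mat[symmetric, of _ n n _ n _ n]) auto
  also have "\<dots> = 1\<^sub>m n * s' ^\<^sub>m a" by (simp only: inv)
  also have "\<dots> = s' ^\<^sub>m a" by (rule left_mult_one_mat) (rule s'_carrier)
  finally show ?thesis by (rule sym)
qed

text \<open>The exponent is unrestricted; membership in \<open>levi\<close> is a determinant
  condition, which \<open>sp_levi\<close> verifies for multiples of \<open>q + 1\<close>.\<close>

definition sp :: "nat \<Rightarrow> 'a mat \<times> 'a mat" where "sp a = (s ^\<^sub>m a, s' ^\<^sub>m a)"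

lemma sp_add: "sp (a + b) = (s ^\<^sub>m a * s ^\<^sub>m b, s' ^\<^sub>m a * s' ^\<^sub>m b)"
  unfolding sp_def using pow_mat_add[OF s_carrier] pow_mat_add[OF s'_carrier(1)] by simp

lemma sp_eqI:
  assumes "a mod ord_s = b mod ord_s"
  shows "sp a = sp b"
proof -
  have "s ^\<^sub>m a = s ^\<^sub>m b" using assms by (rule s_pow_eqI)
  moreover from this have "s' ^\<^sub>m a = s' ^\<^sub>m b"
    using conj_tr_s_pow[of b] by (intro s'_pow_unique) auto
  ultimately show ?thesis by (simp add: sp_def)
qed

abbreviation "\<delta> \<equiv> det s"

lemma delta_nonzero: "\<delta> \<noteq> 0"
proof
  assume "\<delta> = 0"
  hence "det (s ^\<^sub>m ord_s) = 0" using ord_s_pos by (simp add: det_pow_mat[OF s_carrier])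
  thus False unfolding s_pow_ord by simp
qed

lemma det_s': "\<delta> ^ q * det s' = 1"
proof -
  have "det (conj_tr q (s ^\<^sub>m 1) * s' ^\<^sub>m 1) = 1" by (simp only: conj_tr_s_pow det_one)
  thus ?thesis
    using det_mult[of "conj_tr q s" n s'] s_carrier s'_carrier(1) by (simp add: det_conj_tr[of s n])
qed

text \<open>For x = \<open>\<delta> ^ q * det s'\<close>, which is 1, the product of the two
  determinants at exponent \<open>q + 1\<close> is x times its conjugate.\<close>

lemma sp_levi: "sp ((q + 1) * i) \<in> carrier levi"
proof -
  have "\<delta> ^ (q + 1) * det s' ^ (q + 1) = (\<delta> ^ q * det s') * (\<delta> * det s' ^ q)"
    by (simp add: mult_ac)
  also have "\<delta> * det s' ^ q = (\<delta> ^ q * det s') ^ q"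
    by (simp only: power_mult_distrib bar_bar)
  finally have "\<delta> ^ (q + 1) * det s' ^ (q + 1) = 1" by (simp add: det_s')
  hence "(\<delta> ^ (q + 1) * det s' ^ (q + 1)) ^ i = 1" by simp
  hence "\<delta> ^ ((q + 1) * i) * det s' ^ ((q + 1) * i) = 1"
    by (simp only: power_mult_distrib power_mult)
  thus ?thesis
    using conj_tr_s_pow[of "(q + 1) * i"]
    by (simp only: sp_def levi_iff det_pow_mat[OF s_carrier] det_pow_mat[OF s'_carrier(1)]
        s_pow_carrier s'_carrier simp_thms)
qed

text \<open>Right multiplication by the second factor corrects the determinant of \<open>s\<^bsup>a\<^esup>\<close> without
  changing the images of the first \<open>n - 1\<close> basis vectors.\<close>

definition corr :: "nat \<Rightarrow> 'a mat \<times> 'a mat" where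
  "corr a = (s ^\<^sub>m a * corner_diag n 1 (inverse \<delta> ^ a), s' ^\<^sub>m a * corner_diag n 1 ((\<delta> ^ q) ^ a))"

lemma conj_tr_corner_diag: "conj_tr q (corner_diag n x z) = corner_diag n (x ^ q) (z ^ q)" for x z :: 'a
  using q_gt_1 by (intro eq_matI) (auto simp: corner_diag_def)

text \<open>The inserted powers of \<open>\<delta>\<close> cancel the determinant of the first
  component and, by \<open>det_s'\<close>, that of the second. The two correcting matrices
  themselves satisfy the pair condition, so it survives.\<close>

lemma corr_levi: "corr a \<in> carrier levi"
proof -
  have "(inverse \<delta> ^ a) ^ q * (\<delta> ^ q) ^ a = (inverse \<delta> * \<delta>) ^ (q * a)"
    by (simp only: power_mult_distrib power_mult[symmetric] mult.commute[of a q])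
  hence "conj_tr q (corner_diag n 1 (inverse \<delta> ^ a)) * corner_diag n 1 ((\<delta> ^ q) ^ a) = 1\<^sub>m n"
    using delta_nonzero by (simp add: conj_tr_corner_diag corner_diag_mult corner_diag_one)
  hence "conj_tr q (fst (corr a)) * snd (corr a) = 1\<^sub>m n"
    unfolding corr_def fst_conv snd_conv by (intro conj_tr_pair_mult conj_tr_s_pow) auto
  moreover have "det (fst (corr a)) * det (snd (corr a)) = (inverse \<delta> * \<delta> * (\<delta> ^ q * det s')) ^ a"
    using n2 unfolding corr_def
    by (simp add: det_mult[of _ n] det_corner_diag det_pow_mat[OF s_carrier]
        det_pow_mat[OF s'_carrier(1)] power_mult_distrib mult_ac)
  ultimately show ?thesis using delta_nonzero det_s' by (simp add: corr_def levi_iff)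
qed

lemma corr_unit:
  assumes "i + 1 < n"
  shows "fst (corr a) *\<^sub>v unit_vec n i = (s ^\<^sub>m (a + i)) *\<^sub>v e0"
proof -
  have "fst (corr a) *\<^sub>v unit_vec n i = (s ^\<^sub>m a) *\<^sub>v (corner_diag n 1 (inverse \<delta> ^ a) *\<^sub>v unit_vec n i)"
    unfolding corr_def fst_conv by (rule assoc_mult_mat_vec[of _ n n _ n]) auto
  also have "corner_diag n 1 (inverse \<delta> ^ a) *\<^sub>v unit_vec n i = unit_vec n i"
    using assms by (simp add: corner_diag_mult_vec)
  also have "(s ^\<^sub>m a) *\<^sub>v unit_vec n i = (s ^\<^sub>m (a + i)) *\<^sub>v e0"
    using assms by (simp add: s_pow_add_e0 s_unit)
  finally show ?thesis .
qed

lemma unit_vec_inj: "a < n \<Longrightarrow> b < n \<Longrightarrow> unit_vec n a = (unit_vec n b :: 'a vec) \<Longrightarrow> a = b"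
  by (metis index_unit_vec(1) one_neq_zero)

lemma levi_fst_mult: 
  assumes "g \<in> carrier levi" "h \<in> carrier levi" "v \<in> carrier_vec n"
  shows "fst (g \<otimes>\<^bsub>levi\<^esub> h) *\<^sub>v v = fst g *\<^sub>v (fst h *\<^sub>v v)"
  using assms assoc_mult_mat_vec[of "fst g" n n "fst h" n v] by (cases g; cases h) (simp add: levi_iff)

text \<open>Induction over the prime factors of \<open>m\<close>: an index below
  \<open>r * m'\<close> is split as \<open>j * m' + a\<close>. The small part \<open>a\<close> is
  reached by induction, the multiple of \<open>m'\<close> by a block of \<open>r\<close> elements
  \<open>corr (j * m')\<close>.\<close>

lemma levi_block:
  assumes "m > 0" "m \<le> n"
  shows "\<exists>g. (\<forall>a<m. g a \<in> carrier levi \<and> fst (g a) *\<^sub>v e0 = unit_vec n a) \<and> mls_on levi (g ` {..<m})"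
  using assms
proof (induction m rule: less_induct)
  case (less m)
  show ?case
  proof (cases "m = 1")
    case True
    have "(\<lambda>_. \<one>\<^bsub>levi\<^esub>) ` {..<m} = {\<one>\<^bsub>levi\<^esub>}" using True by auto
    thus ?thesis using True levi.one_closed mls_on_one[of levi]
      by (intro exI[of _ "\<lambda>_. \<one>\<^bsub>levi\<^esub>"]) auto
  next
    case False
    then obtain r m' where r: "prime r" "m = r * m'"
      using prime_factor_nat[of m] less.prems by (auto elim: dvdE)
    \<comment> \<open>The inequality leaves room at the end: an index below \<open>m'\<close> is at
      most \<open>n - 2\<close>, where \<open>corr\<close> acts like a power of
      \<open>s\<close>.\<close>
    have m': "m' > 0" "2 * m' \<le> m" using r less.prems prime_ge_2_nat[of r] by auto
    obtain g where g: "\<And>a. a < m' \<Longrightarrow> g a \<in> carrier levi" "\<And>a. a < m' \<Longrightarrow> fst (g a) *\<^sub>v e0 = unit_vec n a"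
      "mls_on levi (g ` {..<m'})"
      using less.IH[of m'] m' less.prems by auto
    define h where "h a = corr ((a div m') * m') \<otimes>\<^bsub>levi\<^esub> g (a mod m')" for a
    have lt: "j * m' + a < m" if "j < r" "a < m'" for j a
    proof -
      have "j * m' + a < Suc j * m'" using that by simp
      also have "\<dots> \<le> r * m'" using that by (intro mult_le_mono1) simp
      finally show ?thesis using r by simp
    qed
    have act: "fst (corr (j * m') \<otimes>\<^bsub>levi\<^esub> g a) *\<^sub>v e0 = unit_vec n (j * m' + a)" if ja: "j < r" "a < m'" for j a
    proof -
      have "fst (corr (j * m') \<otimes>\<^bsub>levi\<^esub> g a) *\<^sub>v e0 = fst (corr (j * m')) *\<^sub>v unit_vec n a"
        using ja g corr_levi by (simp add: levi_fst_mult)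
      also have "\<dots> = (s ^\<^sub>m (j * m' + a)) *\<^sub>v e0"
        using ja m' less.prems by (intro corr_unit) linarith
      also have "\<dots> = unit_vec n (j * m' + a)"
        using lt[OF ja] less.prems by (intro s_unit) linarith
      finally show ?thesis .
    qed
    have h: "h a \<in> carrier levi" "fst (h a) *\<^sub>v e0 = unit_vec n a" if "a < m" for a
    proof -
      have a: "a div m' < r" "a mod m' < m'"
        using that r m' by (auto simp: less_mult_imp_div_less)
      show "h a \<in> carrier levi" unfolding h_def using a g corr_levi by (intro levi.m_closed) auto
      show "fst (h a) *\<^sub>v e0 = unit_vec n a" unfolding h_def using act[OF a] by simp
    qed
    let ?C = "(\<lambda>j. corr (j * m')) ` {..<r}"
    \<comment> \<open>Different products are told apart by the basis vector to which they send
      \<open>e0\<close>.\<close>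
    have inj_pair: "j = j' \<and> a = a'" if e: "corr (j * m') \<otimes>\<^bsub>levi\<^esub> g a = corr (j' * m') \<otimes>\<^bsub>levi\<^esub> g a'"
      and lts: "j < r" "j' < r" "a < m'" "a' < m'" for j j' a a'
    proof -
      have "unit_vec n (j * m' + a) = (unit_vec n (j' * m' + a') :: 'a vec)"
        using e act[of j a] act[of j' a'] lts by simp
      hence eq: "j * m' + a = j' * m' + a'"
        using lt[of j a] lt[of j' a'] lts less.prems by (intro unit_vec_inj) auto
      hence "(j * m' + a) div m' = (j' * m' + a') div m'" "(j * m' + a) mod m' = (j' * m' + a') mod m'"
        by simp_all
      thus ?thesis using lts by simp
    qed
    have "inj_on (\<lambda>j. corr (j * m')) {..<r}"
    proof (rule inj_onI)
      fix j j' assume "j \<in> {..<r}" "j' \<in> {..<r}" "corr (j * m') = corr (j' * m')"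
      thus "j = j'" using inj_pair[of j 0 j' 0] m' by auto
    qed
    hence C: "mls_on levi ?C"
      using r corr_levi by (intro levi.mls_on_prime) (auto simp: card_image)
    have "bij_betw (\<lambda>(x, y). x \<otimes>\<^bsub>levi\<^esub> y) (?C \<times> g ` {..<m'}) (h ` {..<m})"
      unfolding bij_betw_def
    proof
      show "inj_on (\<lambda>(x, y). x \<otimes>\<^bsub>levi\<^esub> y) (?C \<times> g ` {..<m'})"
      proof (rule inj_onI)
        fix u v assume u: "u \<in> ?C \<times> g ` {..<m'}" and v: "v \<in> ?C \<times> g ` {..<m'}"
          and e: "(\<lambda>(x, y). x \<otimes>\<^bsub>levi\<^esub> y) u = (\<lambda>(x, y). x \<otimes>\<^bsub>levi\<^esub> y) v"
        from u obtain j a where ja: "j < r" "a < m'" "u = (corr (j * m'), g a)" by blast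
        from v obtain j' a' where ja': "j' < r" "a' < m'" "v = (corr (j' * m'), g a')" by blast
        have "j = j' \<and> a = a'"
          using e unfolding ja(3) ja'(3) split by (rule inj_pair) (fact ja ja')+
        thus "u = v" using ja ja' by simp
      qed
      show "(\<lambda>(x, y). x \<otimes>\<^bsub>levi\<^esub> y) ` (?C \<times> g ` {..<m'}) = h ` {..<m}"
      proof (intro equalityI subsetI)
        fix x assume "x \<in> (\<lambda>(x, y). x \<otimes>\<^bsub>levi\<^esub> y) ` (?C \<times> g ` {..<m'})"
        then obtain u where u: "u \<in> ?C \<times> g ` {..<m'}" "x = (\<lambda>(x, y). x \<otimes>\<^bsub>levi\<^esub> y) u" by blast
        from u(1) obtain j a where ja: "j < r" "a < m'" "u = (corr (j * m'), g a)" by blast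
        have "x = corr (j * m') \<otimes>\<^bsub>levi\<^esub> g a" unfolding u(2) ja(3) split ..
        hence "x = h (j * m' + a)" using ja by (simp add: h_def)
        thus "x \<in> h ` {..<m}" using lt[OF ja(1,2)] by blast
      next
        fix x assume "x \<in> h ` {..<m}"
        then obtain a where a: "a < m" "x = h a" by auto
        hence "a div m' < r" "a mod m' < m'" using r m' by (auto simp: less_mult_imp_div_less)
        thus "x \<in> (\<lambda>(x, y). x \<otimes>\<^bsub>levi\<^esub> y) ` (?C \<times> g ` {..<m'})"
          unfolding a(2) h_def by (intro image_eqI[of _ _ "(corr (a div m' * m'), g (a mod m'))"]) auto
      qed
    qed
    hence "mls_on levi (h ` {..<m})"
      using r m' by (intro levi.mls_on_mult[OF C g(3)]) (auto simp: prime_gt_0_nat lessThan_empty_iff)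
    thus ?thesis using h by blast
  qed
qed

section \<open>Scalars acting on the first basis vector\<close>

lemma y_pow: "y ^ ((q - 1) * (q + 1)) = 1"
proof -
  have "y ^ ((q - 1) * (q + 1)) \<cdot>\<^sub>v e0 = (s ^\<^sub>m (idx * ((q - 1) * (q + 1)))) *\<^sub>v e0"
    by (rule s_pow_times_e0[OF s_scalar, symmetric])
  also have "idx * ((q - 1) * (q + 1)) = ord_s" unfolding ord_s_eq by (rule mult.commute)
  also have "(s ^\<^sub>m ord_s) *\<^sub>v e0 = 1 \<cdot>\<^sub>v e0" unfolding s_pow_ord by simp
  finally show ?thesis by (rule scalar_e0_inj)
qed

lemma y_nonzero: "y \<noteq> 0"
proof
  assume "y = 0"
  hence "y ^ ((q - 1) * (q + 1)) = 0" using q_gt_1 by simp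
  thus False unfolding y_pow by simp
qed

definition rho :: "'a mat \<times> 'a mat" where
  "rho = (corner_diag n y (inverse y), corner_diag n (inverse (y ^ q)) (y ^ q))"

lemma rho_levi: "rho \<in> carrier levi"
proof -
  have "inverse y ^ q * y ^ q = 1" using y_nonzero by (simp flip: power_mult_distrib)
  thus ?thesis using n2 y_nonzero
    by (simp add: rho_def levi_iff conj_tr_corner_diag corner_diag_mult corner_diag_one det_corner_diag)
qed

lemma rho_pow_e0: "fst (rho [^]\<^bsub>levi\<^esub> j) *\<^sub>v e0 = y ^ j \<cdot>\<^sub>v e0" for j :: nat
proof (induction j)
  case (Suc j)
  have pc: "rho [^]\<^bsub>levi\<^esub> j \<in> carrier levi" using rho_levi by (rule levi.nat_pow_closed)
  hence fc: "fst (rho [^]\<^bsub>levi\<^esub> j) \<in> carrier_mat n n"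
    by (cases "rho [^]\<^bsub>levi\<^esub> j") (simp add: levi_iff)
  have "fst rho *\<^sub>v e0 = y \<cdot>\<^sub>v e0"
    using n2 corner_diag_mult_vec[of 0 n y "inverse y"] by (simp add: rho_def)
  hence "fst (rho [^]\<^bsub>levi\<^esub> Suc j) *\<^sub>v e0 = fst (rho [^]\<^bsub>levi\<^esub> j) *\<^sub>v (y \<cdot>\<^sub>v e0)"
    using levi_fst_mult[OF pc rho_levi e0_carrier] by simp
  also have "\<dots> = y \<cdot>\<^sub>v (fst (rho [^]\<^bsub>levi\<^esub> j) *\<^sub>v e0)" by (rule mult_mat_vec[OF fc e0_carrier])
  finally show ?case using Suc by (simp add: smult_smult_assoc)
qed simp

section \<open>Representatives of the residues modulo q + 1\<close>

abbreviation "e \<equiv> gcd n (q + 1)"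
abbreviation "f \<equiv> (q + 1) div e"

lemma e_f: "e > 0" "f > 0" "e * f = q + 1" "e \<le> n"
proof -
  show "e > 0" by simp
  show ef: "e * f = q + 1" by simp
  show "f > 0"
  proof (rule ccontr)
    assume "\<not> f > 0"
    hence "e * f = 0" by (simp only: not_gr_zero mult_0_right)
    thus False using ef by linarith
  qed
  show "e \<le> n" using n2 by (intro gcd_le1_nat) simp
qed

text \<open>Modulo \<open>e\<close> the number \<open>idx\<close> is 0, since \<open>e\<close>
  divides \<open>n\<close>; this recovers \<open>a\<close>. What remains is
  \<open>n * j = n * j'\<close> modulo \<open>q + 1\<close>; after division by \<open>e\<close>, the
  factor \<open>n div e\<close> is coprime to \<open>f\<close> and cancels.\<close>

lemma residue_unique:
  assumes lts: "a < e" "a' < e" "j < f" "j' < f" and cong: "[a + idx * j = a' + idx * j'] (mod (q + 1))"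
  shows "a = a' \<and> j = j'"
proof -
  have "[idx = n] (mod e)" using idx_cong by (rule cong_dvd_modulus_nat) simp
  moreover have "[n = 0] (mod e)" by (simp add: cong_0_iff)
  ultimately have idx0: "[idx = 0] (mod e)" by (rule cong_trans)
  have "[a + idx * j = a' + idx * j'] (mod e)" using cong by (rule cong_dvd_modulus_nat) simp
  moreover have "[a + idx * j = a + 0 * j] (mod e)" "[a' + idx * j' = a' + 0 * j'] (mod e)"
    by (rule cong_add[OF cong_refl cong_mult[OF idx0 cong_refl]])+
  ultimately have "[a = a'] (mod e)" by (metis cong_sym cong_trans add.right_neutral mult_zero_left)
  hence aa: "a = a'" using lts by (simp add: cong_def)
  have "[idx * j = idx * j'] (mod (q + 1))" using cong unfolding aa by (simp only: cong_add_lcancel_nat)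
  moreover have "[idx * j = n * j] (mod (q + 1))" "[idx * j' = n * j'] (mod (q + 1))"
    using idx_cong by (auto intro!: cong_mult)
  ultimately have nj: "[n * j = n * j'] (mod (q + 1))" by (metis cong_sym cong_trans)
  define n1 where "n1 = n div e"
  have n1: "n = e * n1" by (simp add: n1_def)
  have cop: "coprime n1 f" unfolding n1_def using n2 by (intro div_gcd_coprime) simp
  have "(e * (n1 * j)) mod (e * f) = (e * (n1 * j')) mod (e * f)"
    using nj unfolding cong_def e_f(3) by (metis mult.assoc n1)
  hence "[n1 * j = n1 * j'] (mod f)" unfolding mod_mult_mult1 cong_def using e_f(1) by simp
  hence "[j = j'] (mod f)" using cop by (simp add: cong_mult_lcancel_nat coprime_commute)
  thus ?thesis using aa lts by (simp add: cong_def)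
qed

lemma dvd_ord_s: "q + 1 dvd ord_s"
  unfolding ord_s_eq by (intro dvd_mult2 dvd_mult dvd_refl)

text \<open>The number \<open>\<nu> r\<close> is an exponent of \<open>s\<close> with the same
  effect on \<open>e0\<close> as \<open>r\<close>. Its residue modulo \<open>q + 1\<close> labels an
  orbit of the powers of \<open>s ^\<^sub>m (q + 1)\<close>, and \<open>R\<close> meets each residue
  once.\<close>

lemma levi_transversal:
  obtains R \<nu> where "mls_on levi R" "R \<subseteq> carrier levi" "R \<noteq> {}"
    "\<And>r. r \<in> R \<Longrightarrow> fst r *\<^sub>v e0 = (s ^\<^sub>m \<nu> r) *\<^sub>v e0"
    "\<And>r r'. r \<in> R \<Longrightarrow> r' \<in> R \<Longrightarrow> [\<nu> r = \<nu> r'] (mod (q + 1)) \<Longrightarrow> r = r'"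
    "\<And>t. \<exists>r\<in>R. [\<nu> r = t] (mod (q + 1))"
proof -
  obtain g where g: "\<And>a. a < e \<Longrightarrow> g a \<in> carrier levi" "\<And>a. a < e \<Longrightarrow> fst (g a) *\<^sub>v e0 = unit_vec n a"
    and mg: "mls_on levi (g ` {..<e})"
    using levi_block[OF e_f(1,4)] by blast
  let ?I = "{..<e} \<times> {..<f}"
  define el where "el = (\<lambda>(a, j). g a \<otimes>\<^bsub>levi\<^esub> rho [^]\<^bsub>levi\<^esub> (j :: nat))"
  define num where "num = (\<lambda>(a, j). a + idx * j)"
  have rp: "rho [^]\<^bsub>levi\<^esub> j \<in> carrier levi" for j :: nat using rho_levi by (rule levi.nat_pow_closed)
  have act: "fst (g a \<otimes>\<^bsub>levi\<^esub> rho [^]\<^bsub>levi\<^esub> j) *\<^sub>v e0 = (s ^\<^sub>m (a + idx * j)) *\<^sub>v e0" if a: "a < e" for a and j :: nat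
  proof -
    have gc: "fst (g a) \<in> carrier_mat n n" using g(1)[OF a] by (cases "g a") (simp add: levi_iff)
    have "fst (g a \<otimes>\<^bsub>levi\<^esub> rho [^]\<^bsub>levi\<^esub> j) *\<^sub>v e0 = fst (g a) *\<^sub>v (y ^ j \<cdot>\<^sub>v e0)"
      using levi_fst_mult[OF g(1)[OF a] rp e0_carrier] by (simp add: rho_pow_e0)
    also have "\<dots> = y ^ j \<cdot>\<^sub>v (fst (g a) *\<^sub>v e0)" by (rule mult_mat_vec[OF gc e0_carrier])
    also have "fst (g a) *\<^sub>v e0 = (s ^\<^sub>m a) *\<^sub>v e0" using g(2)[OF a] s_unit[of a] a e_f(4) by simp
    also have "y ^ j \<cdot>\<^sub>v ((s ^\<^sub>m a) *\<^sub>v e0) = (s ^\<^sub>m a) *\<^sub>v (y ^ j \<cdot>\<^sub>v e0)"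
      by (rule mult_mat_vec[OF s_pow_carrier e0_carrier, symmetric])
    also have "\<dots> = (s ^\<^sub>m a) *\<^sub>v ((s ^\<^sub>m (idx * j)) *\<^sub>v e0)"
      by (simp only: s_pow_times_e0[OF s_scalar])
    finally show ?thesis by (simp only: s_pow_add_e0)
  qed
  have num_inj: "u = v" if "u \<in> ?I" "v \<in> ?I" "[num u = num v] (mod (q + 1))" for u v
  proof -
    obtain a j a' j' where uv: "u = (a, j)" "v = (a', j')" by (cases u; cases v)
    have lts: "a < e" "a' < e" "j < f" "j' < f" using that(1,2) unfolding uv by simp_all
    have "[a + idx * j = a' + idx * j'] (mod (q + 1))" using that(3) unfolding uv num_def split .
    thus ?thesis using residue_unique[OF lts] unfolding uv by blast
  qed
  have el_act: "fst (el u) *\<^sub>v e0 = (s ^\<^sub>m num u) *\<^sub>v e0" if "u \<in> ?I" for u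
  proof -
    obtain a j where u: "u = (a, j)" by (cases u)
    show ?thesis using act[of a j] that unfolding u el_def num_def split by blast
  qed
  have el_inj: "inj_on el ?I"
  proof (rule inj_onI)
    fix u v assume uv: "u \<in> ?I" "v \<in> ?I" "el u = el v"
    hence "(s ^\<^sub>m num u) *\<^sub>v e0 = (s ^\<^sub>m num v) *\<^sub>v e0" using el_act by metis
    hence "[num u = num v] (mod ord_s)" unfolding s_eq_iff cong_def .
    hence "[num u = num v] (mod (q + 1))" using dvd_ord_s by (rule cong_dvd_modulus_nat)
    thus "u = v" using uv num_inj by blast
  qed
  have "inj_on (\<lambda>u. num u mod (q + 1)) ?I"
    using num_inj by (intro inj_onI) (auto simp: cong_def)
  moreover have "(\<lambda>u. num u mod (q + 1)) ` ?I \<subseteq> {..<q + 1}" by auto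
  moreover have "card ?I = card {..<q + 1}" using e_f(3) by (simp add: card_cartesian_product)
  \<comment> \<open>There are \<open>e * f = q + 1\<close> index pairs with distinct residues, so
    all residues occur.\<close>
  ultimately have num_surj: "(\<lambda>u. num u mod (q + 1)) ` ?I = {..<q + 1}"
    by (intro card_subset_eq) (auto simp: card_image)
  define R where "R = el ` ?I"
  define \<nu> where "\<nu> r = num (inv_into ?I el r)" for r
  have nu: "\<nu> (el u) = num u" if "u \<in> ?I" for u
    unfolding \<nu>_def using inv_into_f_f[OF el_inj that] by simp
  \<comment> \<open>Equal powers of \<open>rho\<close> stay equal after multiplication by
    \<open>g 0\<close>, so injectivity is inherited from \<open>el\<close>.\<close>
  have inj_rho: "inj_on (\<lambda>j::nat. rho [^]\<^bsub>levi\<^esub> j) {..<f}"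
  proof (rule inj_onI)
    fix i j assume ij: "i \<in> {..<f}" "j \<in> {..<f}" "rho [^]\<^bsub>levi\<^esub> i = rho [^]\<^bsub>levi\<^esub> j"
    hence "el (0, i) = el (0, j)" by (simp add: el_def)
    thus "i = j" using inj_onD[OF el_inj, of "(0, i)" "(0, j)"] ij e_f(1) by auto
  qed
  have mr: "mls_on levi ((\<lambda>j. rho [^]\<^bsub>levi\<^esub> j) ` {..<f})"
    using rho_levi e_f(2) inj_rho by (rule levi.mls_on_powers)
  have bij: "bij_betw (\<lambda>(x, y). x \<otimes>\<^bsub>levi\<^esub> y) (g ` {..<e} \<times> (\<lambda>j. rho [^]\<^bsub>levi\<^esub> j) ` {..<f}) R"
    unfolding bij_betw_def
  proof
    show "inj_on (\<lambda>(x, y). x \<otimes>\<^bsub>levi\<^esub> y) (g ` {..<e} \<times> (\<lambda>j. rho [^]\<^bsub>levi\<^esub> j) ` {..<f})"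
    proof (rule inj_onI)
      fix u v assume u: "u \<in> g ` {..<e} \<times> (\<lambda>j. rho [^]\<^bsub>levi\<^esub> j) ` {..<f}"
        and v: "v \<in> g ` {..<e} \<times> (\<lambda>j. rho [^]\<^bsub>levi\<^esub> j) ` {..<f}"
        and eq: "(\<lambda>(x, y). x \<otimes>\<^bsub>levi\<^esub> y) u = (\<lambda>(x, y). x \<otimes>\<^bsub>levi\<^esub> y) v"
      from u obtain a j where aj: "a < e" "j < f" "u = (g a, rho [^]\<^bsub>levi\<^esub> j)" by blast
      from v obtain a' j' where aj': "a' < e" "j' < f" "v = (g a', rho [^]\<^bsub>levi\<^esub> j')" by blast
      have "el (a, j) = el (a', j')" using eq unfolding aj(3) aj'(3) el_def split .
      hence "(a, j) = (a', j')" using aj aj' by (intro inj_onD[OF el_inj]) auto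
      thus "u = v" using aj aj' by simp
    qed
    show "(\<lambda>(x, y). x \<otimes>\<^bsub>levi\<^esub> y) ` (g ` {..<e} \<times> (\<lambda>j. rho [^]\<^bsub>levi\<^esub> j) ` {..<f}) = R"
    proof -
      have "(\<lambda>(x, y). x \<otimes>\<^bsub>levi\<^esub> y) ` (map_prod g (\<lambda>j. rho [^]\<^bsub>levi\<^esub> j) ` ?I) = R"
        unfolding R_def el_def image_image by (intro image_cong) auto
      thus ?thesis by (simp only: map_prod_surj_on[OF refl refl])
    qed
  qed
  have ne: "0 \<in> {..<e}" "0 \<in> {..<f}" using e_f(1,2) by (simp_all only: lessThan_iff)
  have "g ` {..<e} \<noteq> {}" "(\<lambda>j. rho [^]\<^bsub>levi\<^esub> j) ` {..<f} \<noteq> {}" using ne by blast+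
  hence "mls_on levi R"
    by (intro levi.mls_on_mult[OF mg mr _ _ _ _ bij] finite_imageI finite_lessThan)
  show ?thesis
  proof (rule that[of R \<nu>])
    show "mls_on levi R" by fact
    thus "R \<subseteq> carrier levi" by (rule levi.mls_on_subset)
    show "R \<noteq> {}" unfolding R_def using ne by blast
    show "fst r *\<^sub>v e0 = (s ^\<^sub>m \<nu> r) *\<^sub>v e0" if rR: "r \<in> R" for r
    proof -
      obtain u where u: "u \<in> ?I" "r = el u" using rR unfolding R_def by blast
      show ?thesis using el_act[OF u(1)] by (simp only: u(2) nu[OF u(1)])
    qed
    show "r = r'" if rR: "r \<in> R" "r' \<in> R" and cong: "[\<nu> r = \<nu> r'] (mod (q + 1))" for r r'
    proof -
      obtain u v where uv: "u \<in> ?I" "v \<in> ?I" "r = el u" "r' = el v" using rR unfolding R_def by blast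
      have "[num u = num v] (mod (q + 1))" using cong by (simp only: uv(3,4) nu[OF uv(1)] nu[OF uv(2)])
      thus ?thesis using num_inj[OF uv(1,2)] uv(3,4) by blast
    qed
    show "\<exists>r\<in>R. [\<nu> r = t] (mod (q + 1))" for t
    proof -
      have "t mod (q + 1) \<in> (\<lambda>u. num u mod (q + 1)) ` ?I" unfolding num_surj by simp
      then obtain u where u: "u \<in> ?I" "t mod (q + 1) = num u mod (q + 1)" by (rule imageE)
      have "[\<nu> (el u) = t] (mod (q + 1))" unfolding nu[OF u(1)] cong_def u(2) ..
      thus ?thesis using u(1) unfolding R_def by blast
    qed
  qed
qed

section \<open>Factorization of the special unitary group\<close>

lemma center_subset:
  assumes "z \<in> group_center (SU N q)"
  obtains l where "z = lev (sp ((q + 1) * l))"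
proof -
  obtain \<zeta> where z: "z = \<zeta> \<cdot>\<^sub>m 1\<^sub>m N" "\<zeta> * \<zeta> ^ q = 1" "\<zeta> ^ N = 1"
    using SU_center_scalar[OF assms] .
  obtain l where l: "s ^\<^sub>m ((q + 1) * l) = \<zeta> \<cdot>\<^sub>m 1\<^sub>m n" using scalar_is_s_pow[OF z(2,3)] .
  \<comment> \<open>The norm condition makes the scalar its own inverse conjugate transpose, so both
    blocks of the pair are the same scalar matrix.\<close>
  have "conj_tr q (\<zeta> \<cdot>\<^sub>m 1\<^sub>m n) * (\<zeta> \<cdot>\<^sub>m 1\<^sub>m n) = 1\<^sub>m n"
    using z(2) scalar_mult[of "\<zeta> ^ q" \<zeta>] by (simp add: conj_tr_smult mult.commute) (auto intro!: eq_matI)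
  hence "s' ^\<^sub>m ((q + 1) * l) = \<zeta> \<cdot>\<^sub>m 1\<^sub>m n"
    by (intro s'_pow_unique) (simp_all only: l smult_carrier_mat one_carrier_mat)
  hence "lev (sp ((q + 1) * l)) = \<kappa> (four_block_mat (\<zeta> \<cdot>\<^sub>m 1\<^sub>m n) (0\<^sub>m n n) (0\<^sub>m n n) (\<zeta> \<cdot>\<^sub>m 1\<^sub>m n))"
    by (simp only: lev_def sp_def l fst_conv snd_conv)
  also have "four_block_mat (\<zeta> \<cdot>\<^sub>m 1\<^sub>m n) (0\<^sub>m n n) (0\<^sub>m n n) (\<zeta> \<cdot>\<^sub>m 1\<^sub>m n) = \<zeta> \<cdot>\<^sub>m (1\<^sub>m N :: 'a mat)"
    by (intro eq_matI) auto
  also have "\<kappa> (\<zeta> \<cdot>\<^sub>m 1\<^sub>m N) = \<zeta> \<cdot>\<^sub>m 1\<^sub>m N"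
    unfolding \<kappa>_def using mult_smult_assoc_mat[of "1\<^sub>m N" N N B N \<zeta>] mult_smult_distrib[of Bi N N B N \<zeta>]
      left_mult_one_mat[OF frame_carrier(2)] by (simp add: Bi_B)
  finally show ?thesis by (intro that[of l]) (simp only: z(1))
qed

abbreviation "sg i \<equiv> lev (sp ((q + 1) * i))"

lemma sg_mult: "sg i * sg j = sg (i + j)"
proof -
  have "sp ((q + 1) * (i + j)) = sp ((q + 1) * i + (q + 1) * j)" by (simp only: distrib_left)
  thus ?thesis unfolding sp_add by (simp add: sp_def lev_mult)
qed

lemma sg_SU: "sg i \<in> carrier (SU N q)"
  using sp_levi by (rule lev_SU)

lemma N_Suc: "N = 1 + (N - 1)" using n2 by simp

lemma emb_N:
  assumes "A \<in> carrier (SU (N - 1) q)"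
  shows "emb (N - 1) A \<in> carrier (SU N q)" "emb (N - 1) A *\<^sub>v unit_vec N 0 = unit_vec N 0"
proof -
  have "A \<in> carrier_mat (N - 1) (N - 1)" using assms by (simp add: SU_iff)
  thus "emb (N - 1) A \<in> carrier (SU N q)" "emb (N - 1) A *\<^sub>v unit_vec N 0 = unit_vec N 0"
    using emb_SU_iff[of A "N - 1"] emb_fixes[of A "N - 1"] assms unfolding N_Suc[symmetric] by auto
qed

lemma bcol_factor:
  assumes r: "r \<in> carrier levi" and c: "c \<in> skew_vecs"
  shows "bcol (sg i * lev r * unip c) =
    ((s ^\<^sub>m ((q + 1) * i)) *\<^sub>v (fst r *\<^sub>v e0)) @\<^sub>v
    ((s' ^\<^sub>m ((q + 1) * i) * snd r) *\<^sub>v (c + (1 + \<gamma>) \<cdot>\<^sub>v e0))"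
proof -
  obtain A C where rAC: "r = (A, C)" and AC: "A \<in> carrier_mat n n" "C \<in> carrier_mat n n"
    using r by (cases r) (auto simp: levi_iff)
  have c': "c \<in> carrier_vec n" using c by (simp add: skew_vecs_def)
  have "sg i * lev r = lev (s ^\<^sub>m ((q + 1) * i) * A, s' ^\<^sub>m ((q + 1) * i) * C)"
    unfolding rAC sp_def using AC by (intro lev_mult) auto
  hence "bcol (sg i * lev r * unip c) =
      ((s ^\<^sub>m ((q + 1) * i) * A) *\<^sub>v e0) @\<^sub>v ((s' ^\<^sub>m ((q + 1) * i) * C) *\<^sub>v (c + (1 + \<gamma>) \<cdot>\<^sub>v e0))"
    using AC c' unip_SU[OF c] bcol_unip[OF c] by (simp only:) (intro bcol_lev_mult, auto simp: SU_iff)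
  also have "(s ^\<^sub>m ((q + 1) * i) * A) *\<^sub>v e0 = (s ^\<^sub>m ((q + 1) * i)) *\<^sub>v (A *\<^sub>v e0)"
    using AC by (intro assoc_mult_mat_vec[of _ n n _ n]) auto
  finally show ?thesis by (simp add: rAC)
qed

text \<open>Factors are recovered from the left. The first half of the image of the base vector
  gives the total exponent of \<open>s\<close>, whose residue modulo \<open>q + 1\<close> gives
  \<open>r\<close>, and then \<open>sg i\<close> follows. After cancellation the second half gives
  \<open>c\<close>, and \<open>A\<close> is what remains.\<close>

lemma SU_factor_unique:
  assumes r: "r \<in> carrier levi" "r' \<in> carrier levi"
    and act: "fst r *\<^sub>v e0 = (s ^\<^sub>m t) *\<^sub>v e0" "fst r' *\<^sub>v e0 = (s ^\<^sub>m t') *\<^sub>v e0"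
    and inj: "[t = t'] (mod (q + 1)) \<Longrightarrow> r = r'"
    and c: "c \<in> skew_vecs" "c' \<in> skew_vecs"
    and A: "A \<in> carrier (SU (N - 1) q)" "A' \<in> carrier (SU (N - 1) q)"
    and eq: "sg i * lev r * unip c * emb (N - 1) A = sg i' * lev r' * unip c' * emb (N - 1) A'"
  shows "r = r' \<and> sg i = sg i' \<and> c = c' \<and> A = A'"
proof -
  interpret G: group "SU N q :: 'a mat monoid" by (rule group_SU)
  have SUs: "sg i \<in> carrier (SU N q)" "sg i' \<in> carrier (SU N q)" "lev r \<in> carrier (SU N q)"
    "lev r' \<in> carrier (SU N q)" "unip c \<in> carrier (SU N q)" "unip c' \<in> carrier (SU N q)"
    "emb (N - 1) A \<in> carrier (SU N q)" "emb (N - 1) A' \<in> carrier (SU N q)"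
    using sg_SU lev_SU[OF r(1)] lev_SU[OF r(2)] unip_SU[OF c(1)] unip_SU[OF c(2)] emb_N(1)[OF A(1)] emb_N(1)[OF A(2)] by auto
  have cm: "u \<in> carrier_mat N N" if "u \<in> carrier (SU N q)" for u :: "'a mat" using that by (simp add: SU_iff)
  have bc: "bcol (g * emb (N - 1) A'') = bcol g"
    if "g \<in> carrier_mat N N" "A'' \<in> carrier (SU (N - 1) q)" for g A''
    using that emb_N[OF that(2)] cm by (intro bcol_mult_fixed) auto
  \<comment> \<open>The embedded factor fixes the first basis vector and drops out.\<close>
  have "bcol (sg i * lev r * unip c) = bcol (sg i' * lev r' * unip c')"
    using bc[of "sg i * lev r * unip c" A] bc[of "sg i' * lev r' * unip c'" A'] eq A SUs cm by simp
  hence "(s ^\<^sub>m ((q + 1) * i)) *\<^sub>v (fst r *\<^sub>v e0) = (s ^\<^sub>m ((q + 1) * i')) *\<^sub>v (fst r' *\<^sub>v e0)"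
    unfolding bcol_factor[OF r(1) c(1)] bcol_factor[OF r(2) c(2)]
    by (rule append_vec_inject(1)[of _ _ _ _ n])
      (unfold act, (rule mult_mat_vec_carrier[OF s_pow_carrier])+, simp, (rule mult_mat_vec_carrier[OF s_pow_carrier])+, simp)
  hence "(s ^\<^sub>m ((q + 1) * i + t)) *\<^sub>v e0 = (s ^\<^sub>m ((q + 1) * i' + t')) *\<^sub>v e0"
    unfolding act s_pow_add_e0 .
  hence m: "[(q + 1) * i + t = (q + 1) * i' + t'] (mod ord_s)" unfolding s_eq_iff cong_def .
  \<comment> \<open>The modulus may be lowered because \<open>q + 1\<close> divides
    \<open>ord_s\<close>; the terms with \<open>i\<close> and \<open>i'\<close> then vanish.\<close>
  hence "[(q + 1) * i + t = (q + 1) * i' + t'] (mod (q + 1))" using dvd_ord_s by (rule cong_dvd_modulus_nat)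
  hence "[t = t'] (mod (q + 1))" by (simp only: cong_def mod_mult_self4)
  hence rr: "r = r'" by (rule inj)
  have "(s ^\<^sub>m t) *\<^sub>v e0 = (s ^\<^sub>m t') *\<^sub>v e0" using act rr by simp
  hence "[t = t'] (mod ord_s)" unfolding s_eq_iff cong_def .
  hence "[(q + 1) * i' + t' = (q + 1) * i' + t] (mod ord_s)" by (intro cong_add cong_refl) (rule cong_sym)
  hence "[(q + 1) * i + t = (q + 1) * i' + t] (mod ord_s)" using m cong_trans by blast
  hence "[(q + 1) * i = (q + 1) * i'] (mod ord_s)" by (simp only: cong_add_rcancel_nat)
  hence ss: "sg i = sg i'" unfolding cong_def using sp_eqI by metis
  let ?L = "sg i * lev r"
  have L: "?L \<in> carrier (SU N q)" using G.m_closed[OF SUs(1,3)] by simp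
  have "?L * (unip c * emb (N - 1) A) = ?L * (unip c' * emb (N - 1) A')"
    using eq SUs cm L unfolding rr[symmetric] ss[symmetric] by (simp add: assoc_mult_mat[of _ N N _ N _ N])
  hence "?L \<otimes>\<^bsub>SU N q\<^esub> (unip c \<otimes>\<^bsub>SU N q\<^esub> emb (N - 1) A) = ?L \<otimes>\<^bsub>SU N q\<^esub> (unip c' \<otimes>\<^bsub>SU N q\<^esub> emb (N - 1) A')"
    by simp
  hence ue: "unip c \<otimes>\<^bsub>SU N q\<^esub> emb (N - 1) A = unip c' \<otimes>\<^bsub>SU N q\<^esub> emb (N - 1) A'"
    by (subst (asm) G.Units_l_cancel) (use L SUs in \<open>auto simp del: SU_mult\<close>)
  hence "bcol (unip c) = bcol (unip c')"
    using bc[of "unip c" A] bc[of "unip c'" A'] A SUs cm by simp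
  hence "c + (1 + \<gamma>) \<cdot>\<^sub>v e0 = c' + (1 + \<gamma>) \<cdot>\<^sub>v e0"
    unfolding bcol_unip[OF c(1)] bcol_unip[OF c(2)] by (rule append_vec_inject(2)[of _ _ _ _ n]) auto
  hence i: "(c + (1 + \<gamma>) \<cdot>\<^sub>v e0) $ j = (c' + (1 + \<gamma>) \<cdot>\<^sub>v e0) $ j" for j by simp
  have cc: "c = c'"
  proof (rule eq_vecI)
    fix j assume "j < dim_vec c'"
    thus "c $ j = c' $ j" using i[of j] c by (auto simp: skew_vecs_def)
  qed (use c in \<open>auto simp: skew_vecs_def\<close>)
  have "unip c \<otimes>\<^bsub>SU N q\<^esub> emb (N - 1) A = unip c \<otimes>\<^bsub>SU N q\<^esub> emb (N - 1) A'"
    using ue unfolding cc .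
  hence "emb (N - 1) A = emb (N - 1) A'"
    by (subst (asm) G.Units_l_cancel) (use SUs in \<open>auto simp del: SU_mult\<close>)
  moreover have "A \<in> carrier_mat (N - 1) (N - 1)" "A' \<in> carrier_mat (N - 1) (N - 1)"
    using A by (simp_all only: SU_iff)
  ultimately have "A = A'" by (rule emb_inject)
  thus ?thesis using rr ss cc by blast
qed

text \<open>Each factor corrects part of the image of the first basis vector:
  \<open>sg i * lev r\<close> adjusts its first half, \<open>unip c\<close> the second, and the rest
  lies in the stabilizer.\<close>

lemma SU_factor_exists:
  assumes g: "g \<in> carrier (SU N q)"
    and R: "R \<subseteq> carrier levi" "\<And>r. r \<in> R \<Longrightarrow> fst r *\<^sub>v e0 = (s ^\<^sub>m \<nu> r) *\<^sub>v e0"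
      "\<And>t. \<exists>r\<in>R. [\<nu> r = t] (mod (q + 1))"
  shows "\<exists>i. \<exists>r\<in>R. \<exists>c\<in>skew_vecs. \<exists>A\<in>carrier (SU (N - 1) q).
    g = sg i * lev r * unip c * emb (N - 1) A"
proof -
  interpret G: group "SU N q :: 'a mat monoid" by (rule group_SU)
  have cm: "u \<in> carrier_mat N N" if "u \<in> carrier (SU N q)" for u :: "'a mat" using that by (simp add: SU_iff)
  have ctSU: "conj_tr q u \<in> carrier (SU N q)" if "u \<in> carrier (SU N q)" for u :: "'a mat"
    using that SU_conj_tr_left[OF that] by (simp add: SU_iff det_conj_tr[OF cm[OF that]])
  obtain x y' :: "'a vec" where xy: "bcol g = x @\<^sub>v y'" "x \<in> carrier_vec n" "y' \<in> carrier_vec n"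
    "(\<Sum>i<n. (x $ i) ^ q * y' $ i + (y' $ i) ^ q * x $ i) = 1"
    using SU_bcol[OF g] .
  \<comment> \<open>A vanishing first half would make the length 0 instead of 1.\<close>
  have "x \<noteq> 0\<^sub>v n" using xy q_gt_1 by auto
  then obtain v where v: "(s ^\<^sub>m v) *\<^sub>v e0 = x" using s_surj xy by blast
  obtain r where r: "r \<in> R" "[\<nu> r = v] (mod (q + 1))" using R(3) by blast
  have rl: "r \<in> carrier levi" using r R(1) by blast
  \<comment> \<open>Adding a multiple of \<open>ord_s\<close> leaves the power of \<open>s\<close>
    unchanged and makes the subtraction of \<open>\<nu> r\<close> exact on natural numbers.\<close>
  have "1 * \<nu> r \<le> ord_s * \<nu> r" using ord_s_pos by (intro mult_le_mono1) linarith
  hence "\<nu> r \<le> v + ord_s * \<nu> r" by linarith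
  moreover have "[v + ord_s * \<nu> r = \<nu> r] (mod (q + 1))"
  proof -
    have "[v + ord_s * \<nu> r = \<nu> r + 0 * \<nu> r] (mod (q + 1))"
      using r(2) dvd_ord_s by (intro cong_add cong_mult cong_refl) (auto simp: cong_sym cong_0_iff)
    thus ?thesis by simp
  qed
  ultimately obtain i where i: "v + ord_s * \<nu> r = (q + 1) * i + \<nu> r"
    by (metis cong_diff_iff_cong_0_nat cong_0_iff dvdE le_add_diff_inverse2)
  have "v mod ord_s = ((q + 1) * i + \<nu> r) mod ord_s" unfolding i[symmetric] by simp
  hence "(s ^\<^sub>m v) *\<^sub>v e0 = (s ^\<^sub>m ((q + 1) * i + \<nu> r)) *\<^sub>v e0" by (simp only: s_eq_iff)
  hence xi: "x = (s ^\<^sub>m ((q + 1) * i)) *\<^sub>v (fst r *\<^sub>v e0)"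
    unfolding v s_pow_add_e0 R(2)[OF r(1)] .
  obtain A C where rAC: "r = (A, C)" and AC: "A \<in> carrier_mat n n" "C \<in> carrier_mat n n"
    using rl by (cases r) (auto simp: levi_iff)
  define a where "a = (q + 1) * i"
  define W where "W = s ^\<^sub>m a * A"
  define V where "V = s' ^\<^sub>m a * C"
  have WV: "W \<in> carrier_mat n n" "V \<in> carrier_mat n n" using AC by (auto simp: W_def V_def)
  have L: "sg i * lev r = lev (W, V)"
    unfolding rAC sp_def W_def V_def a_def using AC by (intro lev_mult) auto
  have wl: "(W, V) \<in> carrier levi"
    using levi.m_closed[OF sp_levi[of i] rl] by (simp add: sp_def rAC W_def V_def a_def)
  have LS: "lev (W, V) \<in> carrier (SU N q)" using wl by (rule lev_SU)
  \<comment> \<open>The conjugate transpose is the inverse, so this strips the Levi part from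
    \<open>g\<close>.\<close>
  define g1 where "g1 = conj_tr q (lev (W, V)) * g"
  have g1: "g1 \<in> carrier (SU N q)" using G.m_closed[OF ctSU[OF LS] g] by (simp add: g1_def)
  have "lev (W, V) * g1 = (lev (W, V) * conj_tr q (lev (W, V))) * g"
    unfolding g1_def using cm[OF LS] cm[OF g] by (intro assoc_mult_mat[symmetric, of _ N N _ N _ N]) auto
  hence Lg1: "lev (W, V) * g1 = g" using LS cm[OF g] by (simp add: SU_iff)
  obtain x1 y1 :: "'a vec" where xy1: "bcol g1 = x1 @\<^sub>v y1" "x1 \<in> carrier_vec n" "y1 \<in> carrier_vec n"
    "(\<Sum>i<n. (x1 $ i) ^ q * y1 $ i + (y1 $ i) ^ q * x1 $ i) = 1"
    using SU_bcol[OF g1] .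
  have bg: "bcol g = (W *\<^sub>v x1) @\<^sub>v (V *\<^sub>v y1)"
    using bcol_lev_mult[OF WV cm[OF g1] xy1(1-3)] by (simp only: Lg1)
  have "x = W *\<^sub>v x1"
    by (rule append_vec_inject(1)[of x y' _ _ n]) (use bg xy xy1 WV in \<open>auto intro: mult_mat_vec_carrier\<close>)
  moreover have "x = W *\<^sub>v e0"
    unfolding xi rAC W_def a_def fst_conv using AC by (intro assoc_mult_mat_vec[symmetric, of _ n n _ n]) auto
  ultimately have We: "W *\<^sub>v x1 = W *\<^sub>v e0" by simp
  have "conj_tr q W * V = 1\<^sub>m n" using wl by (simp add: levi_iff)
  hence "conj_tr q (conj_tr q W * V) = 1\<^sub>m n" by simp
  \<comment> \<open>The inverse of \<open>W\<close> is \<open>conj_tr q V\<close>; cancelling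
    \<open>W\<close> shows that the first half has been brought to \<open>e0\<close>.\<close>
  hence VW: "conj_tr q V * W = 1\<^sub>m n" using WV by (simp add: conj_tr_mult[of "conj_tr q W" n n V n])
  have inv: "conj_tr q V *\<^sub>v (W *\<^sub>v u) = u" if "u \<in> carrier_vec n" for u
    using assoc_mult_mat_vec[of "conj_tr q V" n n W n u] VW WV that by simp
  have "x1 = conj_tr q V *\<^sub>v (W *\<^sub>v x1)" by (rule inv[OF xy1(2), symmetric])
  also have "\<dots> = e0" unfolding We by (rule inv[OF e0_carrier])
  finally have x1: "x1 = e0" .
  have "(\<Sum>i<n. (x1 $ i) ^ q * y1 $ i + (y1 $ i) ^ q * x1 $ i) = (\<Sum>i<n. if i = 0 then y1 $ 0 + (y1 $ 0) ^ q else 0)"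
    unfolding x1 using q_gt_1 by (intro sum.cong) auto
  hence tr: "y1 $ 0 + (y1 $ 0) ^ q = 1" using xy1(4) n2 by simp
  \<comment> \<open>The difference from the base point. Both \<open>y1 $ 0\<close> and
    \<open>1 + \<gamma>\<close> have trace 1, so the entry of \<open>c\<close> at 0 has trace
    zero.\<close>
  define c where "c = y1 - (1 + \<gamma>) \<cdot>\<^sub>v e0"
  have cS: "c \<in> skew_vecs"
  proof -
    have c0: "c $ 0 = y1 $ 0 - (1 + \<gamma>)" using xy1(3) n2 by (simp add: c_def)
    have cq: "(c $ 0) ^ q = (y1 $ 0) ^ q - (1 + \<gamma> ^ q)"
      unfolding c0 using bar.hom_minus[of "y1 $ 0" "1 + \<gamma>"] by (simp add: bar_add)
    have "c $ 0 + (c $ 0) ^ q = (y1 $ 0 - (1 + \<gamma>)) + ((y1 $ 0) ^ q - (1 + \<gamma> ^ q))"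
      by (subst cq, subst c0, rule refl)
    also have "\<dots> = (y1 $ 0 + (y1 $ 0) ^ q) - 1 - (1 + (\<gamma> + \<gamma> ^ q))"
      by (simp add: algebra_simps)
    also have "\<dots> = 0" unfolding tr gamma by simp
    finally have "c $ 0 + (c $ 0) ^ q = 0" .
    moreover have "c \<in> carrier_vec n" using xy1(3) by (simp add: c_def)
    ultimately show ?thesis unfolding skew_vecs_def by blast
  qed
  have "c + (1 + \<gamma>) \<cdot>\<^sub>v e0 = y1" using xy1(3) by (intro eq_vecI) (auto simp: c_def)
  hence bu: "bcol (unip c) = bcol g1" by (simp add: bcol_unip[OF cS] xy1(1) x1)
  have uS: "unip c \<in> carrier (SU N q)" using cS by (rule unip_SU)
  have g2: "conj_tr q (unip c) * g1 \<in> carrier (SU N q)" using G.m_closed[OF ctSU[OF uS] g1] by simp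
  \<comment> \<open>As \<open>unip c\<close> and \<open>g1\<close> have the same label, their
    quotient fixes the first basis vector and comes from the smaller unitary group.\<close>
  have "(conj_tr q (unip c) * g1) *\<^sub>v unit_vec N 0 = unit_vec N 0"
    using uS g1 bu by (rule bcol_eq_imp_fixed)
  then obtain A' where A': "A' \<in> carrier (SU (N - 1) q)" "conj_tr q (unip c) * g1 = emb (N - 1) A'"
    using SU_stabilizer[of "conj_tr q (unip c) * g1" "N - 1"] g2 unfolding N_Suc[symmetric] by blast
  have "unip c * emb (N - 1) A' = (unip c * conj_tr q (unip c)) * g1"
    unfolding A'(2)[symmetric] using cm[OF uS] cm[OF g1] by (intro assoc_mult_mat[symmetric, of _ N N _ N _ N]) auto
  hence ug: "unip c * emb (N - 1) A' = g1" using uS cm[OF g1] by (simp add: SU_iff)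
  have "sg i * lev r * unip c * emb (N - 1) A' = lev (W, V) * (unip c * emb (N - 1) A')"
    unfolding L using cm[OF LS] cm[OF uS] cm[OF emb_N(1)[OF A'(1)]] by (intro assoc_mult_mat[of _ N N _ N _ N])
  also have "\<dots> = g" by (simp only: ug Lg1)
  finally show ?thesis using r(1) cS A'(1) by blast
qed

section \<open>The main theorem\<close>

text \<open>Every central element is some \<open>sg l\<close>, so passing to the quotient shrinks
  only the cyclic factor; the other three factors are mapped injectively.\<close>

lemma PSU_has_MLS:
  assumes M: "has_MLS (SU (N - 1) q :: 'a mat monoid)"
  shows "has_MLS (PSU N q :: 'a mat set monoid)"
proof -
  let ?G = "SU N q :: 'a mat monoid"
  define Z where "Z = group_center ?G"
  interpret G: group ?G by (rule group_SU)
  interpret Z: normal Z ?G unfolding Z_def by (rule G.group_center_normal)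
  define P where "P = ?G Mod Z"
  interpret P: group P unfolding P_def by (rule Z.factorgroup_is_group)
  define \<pi> where "\<pi> g = Z #>\<^bsub>?G\<^esub> g" for g
  have hom: "\<pi> \<in> hom ?G P" unfolding \<pi>_def P_def by (rule Z.r_coset_hom_Mod)
  have pi_mult: "\<pi> (g * h) = \<pi> g \<otimes>\<^bsub>P\<^esub> \<pi> h" if "g \<in> carrier ?G" "h \<in> carrier ?G" for g h
    using hom_mult[OF hom that] by simp
  have pi_one: "\<pi> (1\<^sub>m N) = \<one>\<^bsub>P\<^esub>"
    using hom_one[OF hom G.group_axioms P.group_axioms] by simp
  have car: "carrier P = \<pi> ` carrier ?G"
    unfolding P_def \<pi>_def FactGroup_def RCOSETS_def by auto
  have pi_closed: "\<pi> g \<in> carrier P" if "g \<in> carrier ?G" for g using car that by blast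
  have finP: "finite (carrier P)" unfolding car using finite_SU by blast
  have mult_closed: "g * h \<in> carrier ?G" if "g \<in> carrier ?G" "h \<in> carrier ?G" for g h
    using G.m_closed[OF that] by simp
  have pi_eqD: "\<exists>z\<in>Z. g = z * h" if "\<pi> g = \<pi> h" "g \<in> carrier ?G" "h \<in> carrier ?G" for g h
  proof -
    have "g \<in> Z #>\<^bsub>?G\<^esub> h" using G.rcos_self[OF that(2) Z.subgroup_axioms] that(1) by (simp add: \<pi>_def)
    thus ?thesis by (auto simp: r_coset_def)
  qed
  have pi_absorb: "\<pi> (z * g) = \<pi> g" if "z \<in> Z" "g \<in> carrier ?G" for z g
  proof -
    have "z * g \<in> Z #>\<^bsub>?G\<^esub> g" using that by (auto simp: r_coset_def)
    thus ?thesis unfolding \<pi>_def using G.repr_independence[OF _ that(2) Z.subgroup_axioms] by blast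
  qed
  obtain R \<nu> where R: "mls_on levi R" "R \<subseteq> carrier levi" "R \<noteq> {}"
    "\<And>r. r \<in> R \<Longrightarrow> fst r *\<^sub>v e0 = (s ^\<^sub>m \<nu> r) *\<^sub>v e0"
    "\<And>r r'. r \<in> R \<Longrightarrow> r' \<in> R \<Longrightarrow> [\<nu> r = \<nu> r'] (mod (q + 1)) \<Longrightarrow> r = r'"
    "\<And>t. \<exists>r\<in>R. [\<nu> r = t] (mod (q + 1))"
    by (rule levi_transversal) (rule that)
  let ?M = "SU (N - 1) q :: 'a mat monoid"
  interpret M: group ?M by (rule group_SU)
  let ?em = "emb (N - 1)"
  define el where "el i r c A = sg i * lev r * unip c * ?em A" for i r c A
  have SUs: "sg i \<in> carrier ?G" "r \<in> R \<Longrightarrow> lev r \<in> carrier ?G" "c \<in> skew_vecs \<Longrightarrow> unip c \<in> carrier ?G"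
    "A \<in> carrier ?M \<Longrightarrow> ?em A \<in> carrier ?G" for i r c A
    by (rule sg_SU, rule lev_SU, erule subsetD[OF R(2)], erule unip_SU, erule emb_N(1))
  have one_M: "1\<^sub>m (N - 1) \<in> carrier ?M" using M.one_closed by simp
  have em_one: "?em (1\<^sub>m (N - 1)) = 1\<^sub>m N" using emb_one[of "N - 1"] unfolding N_Suc[symmetric] .
  have sg_0: "sg 0 = 1\<^sub>m N" by (simp add: sp_def lev_one)
  have el_closed: "el i r c A \<in> carrier ?G" if "r \<in> R" "c \<in> skew_vecs" "A \<in> carrier ?M" for i r c A
    unfolding el_def using SUs that by (intro mult_closed)
  have pi_el: "\<pi> (el i r c A) = \<pi> (sg i) \<otimes>\<^bsub>P\<^esub> \<pi> (lev r) \<otimes>\<^bsub>P\<^esub> \<pi> (unip c) \<otimes>\<^bsub>P\<^esub> \<pi> (?em A)"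
    if "r \<in> R" "c \<in> skew_vecs" "A \<in> carrier ?M" for i r c A
    unfolding el_def using SUs that by (simp add: pi_mult mult_closed)
  \<comment> \<open>Equality modulo the centre costs a factor \<open>sg l\<close>, which is absorbed
    into \<open>sg i'\<close>; therefore only the image of \<open>sg i\<close> in the quotient is
    determined.\<close>
  have uniq: "\<pi> (sg i) = \<pi> (sg i') \<and> r = r' \<and> c = c' \<and> A = A'"
    if r: "r \<in> R" "r' \<in> R" and c: "c \<in> skew_vecs" "c' \<in> skew_vecs" and A: "A \<in> carrier ?M" "A' \<in> carrier ?M"
      and eq: "\<pi> (el i r c A) = \<pi> (el i' r' c' A')" for i i' r r' c c' A A'
  proof -
    obtain z where z: "z \<in> Z" "el i r c A = z * el i' r' c' A'"
      using pi_eqD[OF eq el_closed[OF r(1) c(1) A(1)] el_closed[OF r(2) c(2) A(2)]] by blast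
    obtain l where l: "z = sg l" using z(1) center_subset unfolding Z_def by blast
    have cm: "u \<in> carrier_mat N N" if "u \<in> carrier ?G" for u using that by (simp add: SU_iff)
    have cms: "sg l \<in> carrier_mat N N" "sg i' \<in> carrier_mat N N" "lev r' \<in> carrier_mat N N"
      "unip c' \<in> carrier_mat N N" "?em A' \<in> carrier_mat N N"
      by (rule cm[OF SUs(1)], rule cm[OF SUs(1)], rule cm[OF SUs(2)[OF r(2)]],
          rule cm[OF SUs(3)[OF c(2)]], rule cm[OF SUs(4)[OF A(2)]])
    have "z * el i' r' c' A' = (sg l * sg i') * lev r' * unip c' * ?em A'"
      unfolding l el_def using cms by (simp add: assoc_mult_mat[of _ N N _ N _ N])
    hence "sg i * lev r * unip c * ?em A = sg (l + i') * lev r' * unip c' * ?em A'"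
      using z(2) unfolding el_def sg_mult by simp
    hence res: "r = r' \<and> sg i = sg (l + i') \<and> c = c' \<and> A = A'"
      using r R(2) R(4)[OF r(1)] R(4)[OF r(2)] R(5)[OF r] c A
      by (intro SU_factor_unique[of r r' "\<nu> r" "\<nu> r'"]) auto
    moreover have "\<pi> (sg (l + i')) = \<pi> (sg i')"
      using pi_absorb[OF z(1) SUs(1)[of i']] by (simp only: l sg_mult)
    ultimately show ?thesis by simp
  qed
  \<comment> \<open>The images of the four factors: the cyclic group of Singer powers, the Levi
    transversal, the unipotent group and the smaller unitary group.\<close>
  define A where "A = \<pi> ` range sg"
  define B where "B = (\<pi> \<circ> lev) ` R"
  define C where "C = \<pi> ` unip ` skew_vecs"
  define D where "D = (\<pi> \<circ> ?em) ` carrier ?M"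
  have sub: "A \<subseteq> carrier P" "B \<subseteq> carrier P" "C \<subseteq> carrier P" "D \<subseteq> carrier P"
    unfolding A_def B_def C_def D_def using SUs pi_closed by auto
  have mA: "mls_on P A"
  proof (rule P.mls_on_abelian_subgroup)
    have m: "\<pi> (sg i) \<otimes>\<^bsub>P\<^esub> \<pi> (sg j) = \<pi> (sg (i + j))" for i j
      using pi_mult[OF SUs(1) SUs(1)] by (simp only: sg_mult)
    show "subgroup A P"
    proof (rule P.finite_subgroupI)
      show "finite A" using sub(1) finP by (rule finite_subset)
      show "A \<noteq> {}" by (auto simp: A_def)
      fix a b assume "a \<in> A" "b \<in> A"
      then obtain i j where "a = \<pi> (sg i)" "b = \<pi> (sg j)" unfolding A_def by blast
      thus "a \<otimes>\<^bsub>P\<^esub> b \<in> A" unfolding A_def by (simp only: m) blast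
    qed (fact sub(1))
    show "finite A" using sub(1) finP by (rule finite_subset)
    fix a b assume "a \<in> A" "b \<in> A"
    then obtain i j where "a = \<pi> (sg i)" "b = \<pi> (sg j)" unfolding A_def by blast
    thus "a \<otimes>\<^bsub>P\<^esub> b = b \<otimes>\<^bsub>P\<^esub> a" by (simp only: m add.commute[of i j])
  qed
  have mC: "mls_on P C"
  proof (rule P.mls_on_abelian_subgroup)
    have m: "\<pi> (unip c) \<otimes>\<^bsub>P\<^esub> \<pi> (unip d) = \<pi> (unip (c + d))" if "c \<in> skew_vecs" "d \<in> skew_vecs" for c d
      using pi_mult[OF SUs(3) SUs(3)] that by (simp only: unip_mult)
    show "subgroup C P"
    proof (rule P.finite_subgroupI)
      show "finite C" using sub(3) finP by (rule finite_subset)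
      show "C \<noteq> {}" using unip_zero(1) by (auto simp: C_def)
      fix a b assume "a \<in> C" "b \<in> C"
      then obtain c d where "a = \<pi> (unip c)" "b = \<pi> (unip d)" "c \<in> skew_vecs" "d \<in> skew_vecs"
        unfolding C_def by blast
      thus "a \<otimes>\<^bsub>P\<^esub> b \<in> C" unfolding C_def using m[of c d] skew_vecs_add[of c d] by simp
    qed (fact sub(3))
    show "finite C" using sub(3) finP by (rule finite_subset)
    fix a b assume "a \<in> C" "b \<in> C"
    then obtain c d where ab: "a = \<pi> (unip c)" "b = \<pi> (unip d)" and cd: "c \<in> skew_vecs" "d \<in> skew_vecs"
      unfolding C_def by blast
    have "c + d = d + c" using cd by (intro comm_add_vec[of _ n]) (auto simp: skew_vecs_def)
    thus "a \<otimes>\<^bsub>P\<^esub> b = b \<otimes>\<^bsub>P\<^esub> a" using m[of c d] m[of d c] cd unfolding ab by simp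
  qed
  have mB: "mls_on P B"
    unfolding B_def
  proof (rule levi.mls_on_hom[OF P.is_monoid _ _ R(1) _ R(3)])
    show "\<pi> \<circ> lev \<in> hom levi P" using lev_hom hom by (rule hom_compose)
    show "(\<pi> \<circ> lev) \<one>\<^bsub>levi\<^esub> = \<one>\<^bsub>P\<^esub>" by (simp add: lev_one pi_one)
    \<comment> \<open>Injectivity on one factor is uniqueness with the remaining factors
      trivial.\<close>
    show "inj_on (\<pi> \<circ> lev) R"
    proof (rule inj_onI)
      fix r r' assume r: "r \<in> R" "r' \<in> R" and e: "(\<pi> \<circ> lev) r = (\<pi> \<circ> lev) r'"
      have "\<pi> (el 0 r (0\<^sub>v n) (1\<^sub>m (N - 1))) = \<pi> (el 0 r' (0\<^sub>v n) (1\<^sub>m (N - 1)))"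
        using e r one_M unip_zero(1) by (simp add: pi_el)
      thus "r = r'" using uniq[OF r unip_zero(1) unip_zero(1) one_M one_M] by blast
    qed
  qed
  \<comment> \<open>The assumed signature of the smaller unitary group is transported along the
    embedding followed by the projection.\<close>
  have mD: "mls_on P D"
    unfolding D_def
  proof (rule M.mls_on_hom[OF P.is_monoid])
    show "\<pi> \<circ> ?em \<in> hom ?M P"
    proof (rule homI)
      fix u v assume uv: "u \<in> carrier ?M" "v \<in> carrier ?M"
      have "?em (u * v) = ?em u * ?em v" using uv by (intro emb_mult[symmetric]) (auto simp: SU_iff)
      thus "(\<pi> \<circ> ?em) (u \<otimes>\<^bsub>?M\<^esub> v) = (\<pi> \<circ> ?em) u \<otimes>\<^bsub>P\<^esub> (\<pi> \<circ> ?em) v"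
        using uv SUs(4) by (simp add: pi_mult)
    qed (use SUs(4) pi_closed in auto)
    show "(\<pi> \<circ> ?em) \<one>\<^bsub>?M\<^esub> = \<one>\<^bsub>P\<^esub>" by (simp only: comp_apply SU_one em_one pi_one)
    show "mls_on ?M (carrier ?M)" using M by (simp only: has_MLS_iff_mls_on)
    show "inj_on (\<pi> \<circ> ?em) (carrier ?M)"
    proof (rule inj_onI)
      fix u v assume uv: "u \<in> carrier ?M" "v \<in> carrier ?M" and e: "(\<pi> \<circ> ?em) u = (\<pi> \<circ> ?em) v"
      obtain r where r: "r \<in> R" using R(3) by blast
      have "\<pi> (el 0 r (0\<^sub>v n) u) = \<pi> (el 0 r (0\<^sub>v n) v)"
        using e uv r unip_zero(1) by (simp add: pi_el)
      thus "u = v" using uniq[OF r r unip_zero(1) unip_zero(1) uv] by blast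
    qed
    show "carrier ?M \<noteq> {}" using one_M by blast
  qed
  have "has_MLS P"
  proof (rule P.has_MLS_four_factors[OF mA mB mC mD finP])
    show "A \<noteq> {}" "B \<noteq> {}" using R(3) by (auto simp: A_def B_def)
    show "\<one>\<^bsub>P\<^esub> \<in> C" unfolding C_def pi_one[symmetric] unip_zero(2)[symmetric] using unip_zero(1) by blast
    show "\<one>\<^bsub>P\<^esub> \<in> D" unfolding D_def pi_one[symmetric] em_one[symmetric]
      using one_M by (intro image_eqI[of _ _ "1\<^sub>m (N - 1)"]) simp_all
  next
    fix a b c d a' b' c' d'
    assume "a \<in> A" "b \<in> B" "c \<in> C" "d \<in> D" "a' \<in> A" "b' \<in> B" "c' \<in> C" "d' \<in> D"
      and eq: "a \<otimes>\<^bsub>P\<^esub> b \<otimes>\<^bsub>P\<^esub> c \<otimes>\<^bsub>P\<^esub> d = a' \<otimes>\<^bsub>P\<^esub> b' \<otimes>\<^bsub>P\<^esub> c' \<otimes>\<^bsub>P\<^esub> d'"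
    then obtain i r u v i' r' u' v' where ab: "a = \<pi> (sg i)" "b = \<pi> (lev r)" "c = \<pi> (unip u)" "d = \<pi> (?em v)"
        "a' = \<pi> (sg i')" "b' = \<pi> (lev r')" "c' = \<pi> (unip u')" "d' = \<pi> (?em v')"
      and m: "r \<in> R" "r' \<in> R" "u \<in> skew_vecs" "u' \<in> skew_vecs" "v \<in> carrier ?M" "v' \<in> carrier ?M"
      unfolding A_def B_def C_def D_def comp_def by blast
    have "\<pi> (el i r u v) = \<pi> (el i' r' u' v')"
      using eq m unfolding ab by (simp only: pi_el)
    thus "a = a' \<and> b = b' \<and> c = c' \<and> d = d'" using uniq[OF m] unfolding ab by blast
  next
    fix x assume "x \<in> carrier P"
    then obtain g where g: "g \<in> carrier ?G" "x = \<pi> g" unfolding car by blast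
    obtain i r c v where w: "r \<in> R" "c \<in> skew_vecs" "v \<in> carrier ?M" "g = el i r c v"
      using SU_factor_exists[OF g(1) R(2,4,6)] unfolding el_def by blast
    have "x = \<pi> (sg i) \<otimes>\<^bsub>P\<^esub> \<pi> (lev r) \<otimes>\<^bsub>P\<^esub> \<pi> (unip c) \<otimes>\<^bsub>P\<^esub> \<pi> (?em v)"
      unfolding g(2) w(4) using w by (simp only: pi_el)
    moreover have "\<pi> (sg i) \<in> A" "\<pi> (lev r) \<in> B" "\<pi> (unip c) \<in> C" "\<pi> (?em v) \<in> D"
      unfolding A_def B_def C_def D_def comp_def using w by blast+
    ultimately show "\<exists>a\<in>A. \<exists>b\<in>B. \<exists>c\<in>C. \<exists>d\<in>D. x = a \<otimes>\<^bsub>P\<^esub> b \<otimes>\<^bsub>P\<^esub> c \<otimes>\<^bsub>P\<^esub> d" by blast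
  qed
  thus ?thesis by (simp add: PSU_def P_def Z_def)
qed

end

theorem theorem4p1:
  fixes q n :: nat
  assumes "prime_power q"
    and "n \<ge> 2"
    and "card (UNIV :: ('a::{field,finite}) set) = q ^ 2"
    and "has_MLS (SU (2 * n - 1) q :: 'a mat monoid)"
  shows "has_MLS (PSU (2 * n) q :: 'a mat set monoid)"
proof -
  obtain p k where pk: "prime p" "k \<ge> 1" "q = p ^ k"
    using assms(1) unfolding prime_power_def by blast
  interpret H: hermitian_field q p k "TYPE('a)"
    using pk assms(3) by unfold_locales auto
  obtain \<alpha> \<gamma> :: 'a where ag: "\<alpha> * \<alpha> ^ q = - 1" "\<gamma> + \<gamma> ^ q = - 1"
    using H.ex_norm_minus_one H.ex_trace_minus_one by blast
  \<comment> \<open>The Singer construction is applied over the field with q^2 elements, whose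
    cardinality it expects as a power of a prime.\<close>
  have Q: "card (UNIV :: 'a set) = p ^ (k * 2)" unfolding assms(3) pk(3) by (simp only: power_mult)
  have "n > 0" using assms(2) by simp
  obtain s :: "'a mat" and y where s: "s \<in> carrier_mat n n"
    "\<And>a. a < n \<Longrightarrow> (s ^\<^sub>m a) *\<^sub>v unit_vec n 0 = unit_vec n a"
    "\<And>v. v \<in> carrier_vec n \<Longrightarrow> v \<noteq> 0\<^sub>v n \<Longrightarrow> \<exists>a. (s ^\<^sub>m a) *\<^sub>v unit_vec n 0 = v"
    "\<And>a b. (s ^\<^sub>m a) *\<^sub>v unit_vec n 0 = (s ^\<^sub>m b) *\<^sub>v unit_vec n 0 \<longleftrightarrow>
      a mod ((q ^ 2) ^ n - 1) = b mod ((q ^ 2) ^ n - 1)"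
    "(s ^\<^sub>m (\<Sum>i<n. (q ^ 2) ^ i)) *\<^sub>v unit_vec n 0 = y \<cdot>\<^sub>v unit_vec n 0"
    by (rule singer_matrix[OF pk(1) Q \<open>n > 0\<close>, unfolded assms(3)]) (rule that)
  interpret S: singer_frame q p k "TYPE('a)" n \<alpha> \<gamma> s y
    by unfold_locales (fact assms(2) ag s)+
  have "has_MLS (SU (n + n - 1) q :: 'a mat monoid)" using assms(4) by (simp only: mult_2)
  thus ?thesis unfolding mult_2 by (rule S.PSU_has_MLS)
qed

end
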